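(* Let $n\ge1$, $\hbar>0$ and $p\in\mathbb{C}^n$. Then $\mathcal{A}_{p,\hbar}$, with the pointwise product, the canonical Poisson bracket and complex conjugation, is a Fréchet-Poisson $^*$-algebra; that is, $\mathcal{A}_{p,\hbar}$ is a Fréchet $^*$-algebra with respect to the pointwise product and complex conjugation, it is closed under the Poisson bracket, and the Poisson bracket $\{\cdot,\cdot\}:\mathcal{A}_{p,\hbar}\times\mathcal{A}_{p,\hbar}\to\mathcal{A}_{p,\hbar}$ is continuous.
   Context: Conventions: $\mathbb{N}=\{0,1,2,\dots\}$; $z=(z^1,\dots,z^n)$ are the standard holomorphic coordinates on $\mathbb{C}^n$; multiindex notation is the usual componentwise one; $\sum_{N=0}^\infty$ means summation over $N\in\mathbb{N}^n$ and $\sum_{I=0}^R$ summation over $I\in\mathbb{N}^n$ with $I\le R$. The canonical Poisson bracket on $\mathbb{C}^n$ is $\{f,g\}=\frac{2}{\mathrm{i}}\sum_{k=1}^n\left(\frac{\partial f}{\partial z^k}\frac{\partial g}{\partial\overline{z}^k}-\frac{\partial f}{\partial\overline{z}^k}\frac{\partial g}{\partial z^k}\right)$. A Fréchet $^*$-algebra is a Fréchet space with a jointly continuous associative bilinear product and a continuous antilinear involutive anti-automorphism. For $f\in C^\infty(\mathbb{C}^n)$, $m\in\mathbb{N}$, $\ell\in\{0,\dots,2^m-1\}$, $R,S\in\mathbb{N}^n$ define recursively, with values in $[0,+\infty]$, $$h^{p,\hbar}_{0,0,R,S}(f)=\sum_{N=0}^\infty\frac{(2\hbar)^{|R|+|S|+|N|}}{N!}\left|\frac{\partial^{|R|+|S|+|N|}f}{\partial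 z^R\partial\overline{z}^{N+S}}(p)\right|^2,$$ and for $m\ge1$ $$h^{p,\hbar}_{m,\ell,R,S}(f)=\sum_{N=0}^\infty\frac1{N!}\Big(\sum_{I=0}^R\sum_{J=0}^{N+S}\tbinom{R}{I}\tbinom{N+S}{J}h^{p,\hbar}_{m-1,\ell/2,I,J}(f)\Big)^2\quad(\ell\text{ even}),$$ $$h^{p,\hbar}_{m,\ell,R,S}(f)=\sum_{N=0}^\infty\frac1{N!}\Big(\sum_{I=0}^R\sum_{J=0}^{N+S}\tbinom{R}{I}\tbinom{N+S}{J}h^{p,\hbar}_{m-1,(\ell-1)/2,J,I}(f)\Big)^2\quad(\ell\text{ odd}).$$ Put $\|f\|^{p,\hbar}_{m,\ell,R,S}=\big(h^{p,\hbar}_{m,\ell,R,S}(f)\big)^{1/2^{m+1}}$ and $\widetilde{\mathcal{A}}_{p,\hbar}=\{f\in C^\infty(\mathbb{C}^n)\mid \|f\|^{p,\hbar}_{m,\ell,R,S}<\infty\text{ for all }m,\ell,R,S\}$, a vector space on which these are seminorms. Define $\mathcal{A}_{p,\hbar}=\widetilde{\mathcal{A}}_{p,\hbar}/\{f\in C^\infty(\mathbb{C}^n)\mid \mathsf{j}^\infty_pf=0\}$ (quotient by the functions with vanishing $\infty$-jet at $p$), with the topology induced by all the seminorms; it is a Fréchet space. Every class has a unique real-analytic representative, so $\mathcal{A}_{p,\hbar}$ is identified with a subspace of $C^\omega(\mathbb{C}^n)$. *)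

theory Defs
  imports "HOL-Analysis.Analysis" "HOL-Algebra.Module" "HOL-Algebra.Algebraic_Closure_Type"
begin

section \<open>Smooth functions and Wirtinger derivatives\<close>

text \<open>
  The manifold \<open>\<complex>\<^sup>n\<close> is the type \<open>complex^'n\<close>. Smoothness is real smoothness: every function of
  class \<open>C\<^sup>k\<^sup>+\<^sup>1\<close> is differentiable with all directional derivatives of class \<open>C\<^sup>k\<close>.
\<close>

primrec C_class :: "nat \<Rightarrow> ('a::real_normed_vector \<Rightarrow> 'b::real_normed_vector) \<Rightarrow> bool" where
  "C_class 0 f \<longleftrightarrow> continuous_on UNIV f"
| "C_class (Suc k) f \<longleftrightarrow>
     (\<forall>x. f differentiable (at x)) \<and> (\<forall>v. C_class k (\<lambda>x. frechet_derivative f (at x) v))"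

definition smooth :: "('a::real_normed_vector \<Rightarrow> 'b::real_normed_vector) \<Rightarrow> bool" where
  "smooth f \<longleftrightarrow> (\<forall>k. C_class k f)"

text \<open>With \<open>z\<^sup>k = x\<^sup>k + \<i> y\<^sup>k\<close>, the directions \<open>axis k 1\<close> and \<open>axis k \<i>\<close> are those of
  \<open>x\<^sup>k\<close> and \<open>y\<^sup>k\<close>.\<close>

definition dz :: "'n::finite \<Rightarrow> (complex^'n \<Rightarrow> complex) \<Rightarrow> complex^'n \<Rightarrow> complex" where
  "dz k f x =
     (frechet_derivative f (at x) (axis k 1) - \<i> * frechet_derivative f (at x) (axis k \<i>)) / 2"

definition dzbar :: "'n::finite \<Rightarrow> (complex^'n \<Rightarrow> complex) \<Rightarrow> complex^'n \<Rightarrow> complex" where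
  "dzbar k f x =
     (frechet_derivative f (at x) (axis k 1) + \<i> * frechet_derivative f (at x) (axis k \<i>)) / 2"

definition coords :: "'n::finite list" where
  "coords = (SOME ks. distinct ks \<and> set ks = UNIV)"

lemma coords: "distinct (coords :: 'n::finite list)" "set (coords :: 'n list) = UNIV"
proof -
  have "\<exists>ks::'n list. distinct ks \<and> set ks = UNIV"
    using finite_distinct_list[of "UNIV :: 'n set"] by auto
  then have "distinct (coords :: 'n list) \<and> set (coords :: 'n list) = UNIV"
    unfolding coords_def by (rule someI_ex)
  then show "distinct (coords :: 'n list)" "set (coords :: 'n list) = UNIV" by auto
qed

text \<open>\<open>wderiv R S f\<close> is \<open>\<partial>\<^bsup>|R|+|S|\<^esup> f / \<partial>z\<^sup>R \<partial>zbar\<^sup>S\<close>. The coordinates are processed in an unspecified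
  order; it does not matter for smooth functions, to which alone the operator is applied.\<close>

definition wderiv ::
  "nat^'n::finite \<Rightarrow> nat^'n \<Rightarrow> (complex^'n \<Rightarrow> complex) \<Rightarrow> complex^'n \<Rightarrow> complex" where
  "wderiv R S f =
     foldr (\<lambda>k. dz k ^^ (R $ k)) coords (foldr (\<lambda>k. dzbar k ^^ (S $ k)) coords f)"

definition poisson ::
  "(complex^'n::finite \<Rightarrow> complex) \<Rightarrow> (complex^'n \<Rightarrow> complex) \<Rightarrow> complex^'n \<Rightarrow> complex" where
  "poisson f g x = 2 / \<i> * (\<Sum>k\<in>UNIV. dz k f x * dzbar k g x - dzbar k f x * dz k g x)"


section \<open>Multiindices\<close>

text \<open>Multiindices are elements of \<open>nat^'n\<close>; addition and \<open>\<le>\<close> on this type are componentwise.\<close>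

definition mabs :: "nat^'n::finite \<Rightarrow> nat" where
  "mabs N = (\<Sum>k\<in>UNIV. N $ k)"

definition mfact :: "nat^'n::finite \<Rightarrow> nat" where
  "mfact N = (\<Prod>k\<in>UNIV. fact (N $ k))"

definition mbinom :: "nat^'n::finite \<Rightarrow> nat^'n \<Rightarrow> nat" where
  "mbinom R I = (\<Prod>k\<in>UNIV. (R $ k) choose (I $ k))"

lemma finite_atMost_multiindex: "finite {..R :: nat^'n::finite}"
proof -
  have "{..R} \<subseteq> vec_lambda ` (\<Pi>\<^sub>E k\<in>UNIV. {..R $ k})"
  proof
    fix I assume "I \<in> {..R}"
    then have "vec_nth I \<in> (\<Pi>\<^sub>E k\<in>UNIV. {..R $ k})"
      by (auto simp: less_eq_vec_def)
    then show "I \<in> vec_lambda ` (\<Pi>\<^sub>E k\<in>UNIV. {..R $ k})"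
      by (metis image_eqI vec_nth_inverse)
  qed
  then show ?thesis
    by (rule finite_subset) (auto intro!: finite_imageI finite_PiE)
qed


section \<open>The seminorms\<close>

text \<open>Values in \<open>[0,+\<infinity>]\<close>; in the recursion \<open>m \<mapsto> m + 1\<close>, \<open>l div 2\<close> is \<open>l/2\<close> for even and
  \<open>(l - 1)/2\<close> for odd \<open>l\<close>. Only \<open>l < 2^m\<close> is used.\<close>

primrec h :: "complex^'n::finite \<Rightarrow> real \<Rightarrow> nat \<Rightarrow> nat \<Rightarrow> nat^'n \<Rightarrow> nat^'n
    \<Rightarrow> (complex^'n \<Rightarrow> complex) \<Rightarrow> ennreal" where
  "h p hbar 0 l R S f =
     (\<Sum>\<^sub>\<infinity>N\<in>UNIV. ennreal ((2 * hbar) ^ (mabs R + mabs S + mabs N) / real (mfact N)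
                        * (norm (wderiv R (N + S) f p))\<^sup>2))"
| "h p hbar (Suc m) l R S f =
     (if even l then
        (\<Sum>\<^sub>\<infinity>N\<in>UNIV. ennreal (1 / real (mfact N)) *
           (\<Sum>I\<le>R. \<Sum>J\<le>N + S. of_nat (mbinom R I) * of_nat (mbinom (N + S) J)
              * h p hbar m (l div 2) I J f)\<^sup>2)
      else
        (\<Sum>\<^sub>\<infinity>N\<in>UNIV. ennreal (1 / real (mfact N)) *
           (\<Sum>I\<le>R. \<Sum>J\<le>N + S. of_nat (mbinom R I) * of_nat (mbinom (N + S) J)
              * h p hbar m (l div 2) J I f)\<^sup>2))"

text \<open>\<open>snorm\<close> is meaningful where \<open>h\<close> is finite, that is, on \<open>A_tilde\<close>.\<close>

definition snorm :: "complex^'n::finite \<Rightarrow> real \<Rightarrow> nat \<Rightarrow> nat \<Rightarrow> nat^'n \<Rightarrow> nat^'n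
    \<Rightarrow> (complex^'n \<Rightarrow> complex) \<Rightarrow> real" where
  "snorm p hbar m l R S f = enn2real (h p hbar m l R S f) powr (1 / 2 ^ (m + 1))"

definition A_tilde :: "complex^'n::finite \<Rightarrow> real \<Rightarrow> (complex^'n \<Rightarrow> complex) set" where
  "A_tilde p hbar = {f. smooth f \<and> (\<forall>m. \<forall>l<2^m. \<forall>R S. h p hbar m l R S f < \<infinity>)}"


section \<open>The quotient by the functions with vanishing jet\<close>

definition jet_null :: "complex^'n::finite \<Rightarrow> (complex^'n \<Rightarrow> complex) set" where
  "jet_null p = {f. smooth f \<and> (\<forall>R S. wderiv R S f p = 0)}"

definition jet_class ::
  "complex^'n::finite \<Rightarrow> (complex^'n \<Rightarrow> complex) \<Rightarrow> (complex^'n \<Rightarrow> complex) set" where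
  "jet_class p f = {\<lambda>x. f x + u x | u. u \<in> jet_null p}"

text \<open>
  Operations on classes are induced by operations on functions through arbitrary representatives
  (in particular the real-analytic ones). The unions below range over all choices of
  representatives. Since \<open>jet_class p k\<close> is never empty, such a union is a single class only if the
  class of the result is independent of the choice.
\<close>

definition lift1 :: "complex^'n::finite \<Rightarrow> ((complex^'n \<Rightarrow> complex) \<Rightarrow> complex^'n \<Rightarrow> complex)
    \<Rightarrow> (complex^'n \<Rightarrow> complex) set \<Rightarrow> (complex^'n \<Rightarrow> complex) set" where
  "lift1 p F a = (\<Union>f\<in>a. jet_class p (F f))"

definition lift2 :: "complex^'n::finite
    \<Rightarrow> ((complex^'n \<Rightarrow> complex) \<Rightarrow> (complex^'n \<Rightarrow> complex) \<Rightarrow> complex^'n \<Rightarrow> complex)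
    \<Rightarrow> (complex^'n \<Rightarrow> complex) set \<Rightarrow> (complex^'n \<Rightarrow> complex) set
    \<Rightarrow> (complex^'n \<Rightarrow> complex) set" where
  "lift2 p F a b = (\<Union>f\<in>a. \<Union>g\<in>b. jet_class p (F f g))"

definition A_alg :: "complex^'n::finite \<Rightarrow> real
    \<Rightarrow> (complex, (complex^'n \<Rightarrow> complex) set) module" where
  "A_alg p hbar =
     \<lparr>carrier = jet_class p ` A_tilde p hbar,
      monoid.mult = lift2 p (\<lambda>f g x. f x * g x),
      one = jet_class p (\<lambda>x. 1),
      ring.zero = jet_class p (\<lambda>x. 0),
      add = lift2 p (\<lambda>f g x. f x + g x),
      smult = (\<lambda>c. lift1 p (\<lambda>f x. c * f x))\<rparr>"

definition A_star :: "complex^'n::finite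
    \<Rightarrow> (complex^'n \<Rightarrow> complex) set \<Rightarrow> (complex^'n \<Rightarrow> complex) set" where
  "A_star p = lift1 p (\<lambda>f x. cnj (f x))"

definition A_bracket :: "complex^'n::finite \<Rightarrow> (complex^'n \<Rightarrow> complex) set
    \<Rightarrow> (complex^'n \<Rightarrow> complex) set \<Rightarrow> (complex^'n \<Rightarrow> complex) set" where
  "A_bracket p = lift2 p poisson"

text \<open>\<open>snorm p hbar m l R S\<close> depends only on the jet at \<open>p\<close>, so the image is a singleton.\<close>

definition A_snorm :: "complex^'n::finite \<Rightarrow> real \<Rightarrow> nat \<Rightarrow> nat \<Rightarrow> nat^'n \<Rightarrow> nat^'n
    \<Rightarrow> (complex^'n \<Rightarrow> complex) set \<Rightarrow> real" where
  "A_snorm p hbar m l R S a = the_elem (snorm p hbar m l R S ` a)"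

definition seminorm_topology :: "('k, 'v, 'z) module_scheme \<Rightarrow> ('v \<Rightarrow> real) set \<Rightarrow> 'v topology" where
  "seminorm_topology V Q = topology_generated_by
     {{y \<in> carrier V. q (y \<ominus>\<^bsub>V\<^esub> x) < e} | q x e. q \<in> Q \<and> x \<in> carrier V \<and> 0 < e}"

definition A_topology :: "complex^'n::finite \<Rightarrow> real \<Rightarrow> (complex^'n \<Rightarrow> complex) set topology" where
  "A_topology p hbar =
     seminorm_topology (A_alg p hbar) {A_snorm p hbar m l R S | m l R S. l < 2^m}"


section \<open>Frechet-Poisson *-algebras\<close>

text \<open>A Frechet space is a complex locally convex topological vector space whose topology is induced
  by a complete translation-invariant metric.\<close>

definition frechet_space :: "(complex, 'v, 'z) module_scheme \<Rightarrow> 'v topology \<Rightarrow> bool" where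
  "frechet_space V T \<longleftrightarrow>
     module ring_of_type_algebra V \<and>
     topspace T = carrier V \<and>
     continuous_map (prod_topology T T) T (\<lambda>(x, y). x \<oplus>\<^bsub>V\<^esub> y) \<and>
     continuous_map (prod_topology euclidean T) T (\<lambda>(c, x). c \<odot>\<^bsub>V\<^esub> x) \<and>
     (\<forall>U. openin T U \<and> \<zero>\<^bsub>V\<^esub> \<in> U \<longrightarrow>
        (\<exists>W. openin T W \<and> \<zero>\<^bsub>V\<^esub> \<in> W \<and> W \<subseteq> U \<and>
           (\<forall>x\<in>W. \<forall>y\<in>W. \<forall>t\<in>{0..1}.
              complex_of_real (1 - t) \<odot>\<^bsub>V\<^esub> x \<oplus>\<^bsub>V\<^esub> complex_of_real t \<odot>\<^bsub>V\<^esub> y \<in> W))) \<and>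
     (\<exists>d. Metric_space (carrier V) d \<and>
        Metric_space.mtopology (carrier V) d = T \<and>
        Metric_space.mcomplete (carrier V) d \<and>
        (\<forall>x\<in>carrier V. \<forall>y\<in>carrier V. \<forall>z\<in>carrier V.
           d (x \<oplus>\<^bsub>V\<^esub> z) (y \<oplus>\<^bsub>V\<^esub> z) = d x y))"

text \<open>The product need not be commutative or unital; the \<open>one\<close> field of the record plays no role.\<close>

definition frechet_star_algebra ::
  "(complex, 'v, 'z) module_scheme \<Rightarrow> 'v topology \<Rightarrow> ('v \<Rightarrow> 'v) \<Rightarrow> bool" where
  "frechet_star_algebra V T star \<longleftrightarrow>
     frechet_space V T \<and>
     (\<forall>x\<in>carrier V. \<forall>y\<in>carrier V. x \<otimes>\<^bsub>V\<^esub> y \<in> carrier V) \<and>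
     (\<forall>x\<in>carrier V. \<forall>y\<in>carrier V. \<forall>z\<in>carrier V.
        (x \<otimes>\<^bsub>V\<^esub> y) \<otimes>\<^bsub>V\<^esub> z = x \<otimes>\<^bsub>V\<^esub> (y \<otimes>\<^bsub>V\<^esub> z) \<and>
        (x \<oplus>\<^bsub>V\<^esub> y) \<otimes>\<^bsub>V\<^esub> z = x \<otimes>\<^bsub>V\<^esub> z \<oplus>\<^bsub>V\<^esub> y \<otimes>\<^bsub>V\<^esub> z \<and>
        x \<otimes>\<^bsub>V\<^esub> (y \<oplus>\<^bsub>V\<^esub> z) = x \<otimes>\<^bsub>V\<^esub> y \<oplus>\<^bsub>V\<^esub> x \<otimes>\<^bsub>V\<^esub> z) \<and>
     (\<forall>c. \<forall>x\<in>carrier V. \<forall>y\<in>carrier V.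
        (c \<odot>\<^bsub>V\<^esub> x) \<otimes>\<^bsub>V\<^esub> y = c \<odot>\<^bsub>V\<^esub> (x \<otimes>\<^bsub>V\<^esub> y) \<and>
        x \<otimes>\<^bsub>V\<^esub> (c \<odot>\<^bsub>V\<^esub> y) = c \<odot>\<^bsub>V\<^esub> (x \<otimes>\<^bsub>V\<^esub> y)) \<and>
     continuous_map (prod_topology T T) T (\<lambda>(x, y). x \<otimes>\<^bsub>V\<^esub> y) \<and>
     (\<forall>x\<in>carrier V. star x \<in> carrier V \<and> star (star x) = x) \<and>
     (\<forall>c. \<forall>x\<in>carrier V. star (c \<odot>\<^bsub>V\<^esub> x) = cnj c \<odot>\<^bsub>V\<^esub> star x) \<and>
     (\<forall>x\<in>carrier V. \<forall>y\<in>carrier V.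
        star (x \<oplus>\<^bsub>V\<^esub> y) = star x \<oplus>\<^bsub>V\<^esub> star y \<and>
        star (x \<otimes>\<^bsub>V\<^esub> y) = star y \<otimes>\<^bsub>V\<^esub> star x) \<and>
     continuous_map T T star"

end

theory Submission
  imports Defs
begin

text \<open>
  Everything is read off the array \<open>a R S\<close> of Wirtinger derivatives at \<open>p\<close>. The recursion defining
  \<open>h\<close> iterates \<open>A \<mapsto> \<Sum>\<^sub>N (B A)\<^sup>2 / N!\<close>, where \<open>B\<close> is the binomial sum, with an optional transposition in between; these
  operations are monotone, preserve inequalities \<open>A\<^sup>2 \<le> A\<^sub>1 A\<^sub>2\<close> by Cauchy-Schwarz, and commute with
  increasing suprema. Together with the Leibniz rule this gives
  \<open>h\<^sub>m\<^sub>,\<^sub>l(f g)\<^sup>2 \<le> h\<^sub>m\<^sub>+\<^sub>1\<^sub>,\<^sub>l(f) h\<^sub>m\<^sub>+\<^sub>1\<^sub>,\<^sub>l(g)\<close>. In the same way \<open>h\<^sub>m\<^sub>,\<^sub>l\<close> of the conjugate of \<open>f\<close> is controlled by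
  \<open>h\<^sub>m\<^sub>+\<^sub>1\<^sub>,\<^sub>l\<^sub>+\<^sub>2\<^sup>m(f)\<close>, since one more transposition exchanges the two kinds of derivatives, and a derivative
  of \<open>f\<close> costs a shift of \<open>R\<close> or \<open>S\<close> by a unit. The triangle inequality follows from convexity and
  homogeneity of \<open>h\<close>. For completeness, a coefficientwise limit of a Cauchy sequence has finite seminorms
  by Fatou, and finiteness of \<open>h\<^sub>1\<^sub>,\<^sub>1\<close> alone makes the Taylor series converge everywhere, so that the limit
  is the jet of a smooth function.
\<close>

text \<open>In binary, the last digit of \<open>l\<close> decides the transposition in the outermost
  step of the recursion, and the digit of weight \<open>2 ^ (m - 1)\<close> the innermost one. Hence
  going from \<open>m\<close> to \<open>Suc m\<close> with the same \<open>l\<close> inserts an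
  untransposed step at the innermost place, and with \<open>l + 2 ^ m\<close> a transposed one. This
  explains the indices in the estimates for products and conjugates: the new step is used up once,
  at the weighted coefficients, and the resulting inequality is carried outwards by steps that agree
  on both sides. The innermost sum runs over the second index alone, so level 0 bounds the
  coefficients by a constant that may depend on the first index in any way. The transposed step at
  level 1 sums over the first index too and gives a bound uniform in both, hence a convergent Taylor
  series. Its sum is needed even apart from completeness: an operation on classes is a union over
  representatives, and only the existence of representatives makes that union the expected
  class.\<close>

unbundle no fps_syntax

section \<open>Preliminaries: infinite values and multiindex combinatorics\<close>

section \<open>Sums of extended nonnegative reals\<close>

text \<open>Every family in [0,+\<infinity>] is summable, so the facts below reduce to finite
  subsets without any convergence hypothesis.\<close>

lemma infsum_ennreal_eq_SUP:
  fixes f :: "'a \<Rightarrow> ennreal"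
  shows "infsum f UNIV = (SUP F\<in>{F. finite F}. sum f F)"
  using nonneg_infsum_complete[of UNIV f] by simp

lemma infsum_ennreal_le:
  fixes f :: "'a \<Rightarrow> ennreal"
  assumes "\<And>F. finite F \<Longrightarrow> sum f F \<le> C"
  shows "infsum f UNIV \<le> C"
  unfolding infsum_ennreal_eq_SUP using assms by (auto intro: SUP_least)

lemma sum_le_infsum_ennreal:
  fixes f :: "'a \<Rightarrow> ennreal"
  assumes "finite F" shows "sum f F \<le> infsum f UNIV"
  unfolding infsum_ennreal_eq_SUP using assms by (auto intro: SUP_upper)

lemma term_le_infsum_ennreal:
  fixes f :: "'a \<Rightarrow> ennreal"
  shows "f x \<le> infsum f UNIV"
  using sum_le_infsum_ennreal[of "{x}" f] by simp

lemma infsum_mono_ennreal: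
  fixes f g :: "'a \<Rightarrow> ennreal"
  assumes "\<And>x. f x \<le> g x" shows "infsum f UNIV \<le> infsum g UNIV"
  by (intro infsum_mono nonneg_summable_on_complete assms) auto

lemma infsum_cmult_ennreal:
  fixes f :: "'a \<Rightarrow> ennreal"
  shows "(\<Sum>\<^sub>\<infinity>x\<in>UNIV. c * f x) = c * infsum f UNIV"
  unfolding infsum_ennreal_eq_SUP SUP_mult_left_ennreal by (simp add: sum_distrib_left)

lemma infsum_SUP_ennreal:
  fixes f :: "nat \<Rightarrow> 'a \<Rightarrow> ennreal"
  assumes "\<And>x. incseq (\<lambda>i. f i x)"
  shows "(\<Sum>\<^sub>\<infinity>x\<in>UNIV. SUP i. f i x) = (SUP i. infsum (f i) UNIV)"
  unfolding infsum_ennreal_eq_SUP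
  by (subst SUP_commute) (simp add: ennreal_SUP_sum assms)

text \<open>Monotonicity of both sequences puts the mixed product \<open>f i * g j\<close> below the
  diagonal term at \<open>max i j\<close>. With \<open>f = g\<close> this makes squaring commute
  with increasing suprema.\<close>

lemma ennreal_SUP_mult_incseq:
  fixes f g :: "nat \<Rightarrow> ennreal"
  assumes "incseq f" "incseq g"
  shows "(SUP i. f i) * (SUP i. g i) = (SUP i. f i * g i)"
proof (rule antisym)
  have "f i * g j \<le> (SUP i. f i * g i)" for i j
  proof -
    have "f i * g j \<le> f (max i j) * g (max i j)"
      using assms by (intro mult_mono) (auto simp: incseq_def)
    then show ?thesis by (rule SUP_upper2[rotated]) simp
  qed
  then show "(SUP i. f i) * (SUP i. g i) \<le> (SUP i. f i * g i)"
    by (subst mult.commute, subst SUP_mult_left_ennreal, intro SUP_least, subst mult.commute,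
        subst SUP_mult_left_ennreal, intro SUP_least)
  show "(SUP i. f i * g i) \<le> (SUP i. f i) * (SUP i. g i)"
    by (intro SUP_least mult_mono SUP_upper) auto
qed

lemma ennreal_mono_power2_iff: "(x::ennreal)\<^sup>2 \<le> y\<^sup>2 \<longleftrightarrow> x \<le> y"
proof
  assume "x\<^sup>2 \<le> y\<^sup>2"
  then show "x \<le> y"
    by (cases x; cases y) (auto simp: ennreal_power power_eq_top_ennreal abs_le_square_iff[symmetric] top_unique)
qed (rule power_mono, auto)

text \<open>The arithmetic-geometric mean inequality with the root of \<open>a * b\<close> replaced
  by a witness \<open>x\<close>, from (a + b)^2 = (a - b)^2 + 4 a b. An infinite \<open>a\<close> or
  \<open>b\<close> makes the right-hand side infinite.\<close>

lemma ennreal_two_times_sqrt_le: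
  fixes x a b :: ennreal
  assumes "x\<^sup>2 \<le> a * b" shows "2 * x \<le> a + b"
proof (cases "a = \<infinity> \<or> b = \<infinity>")
  case False
  then obtain a' b' where ab: "a = ennreal a'" "b = ennreal b'" "0 \<le> a'" "0 \<le> b'"
    by (cases a; cases b) auto
  have "x \<noteq> \<infinity>" using assms ab by (auto simp: ennreal_mult[symmetric] top_unique)
  then obtain x' where x: "x = ennreal x'" "0 \<le> x'" by (cases x) auto
  have "x'\<^sup>2 \<le> a' * b'" using assms ab x by (simp add: ennreal_power ennreal_mult[symmetric])
  moreover have "(2 * x')\<^sup>2 = 4 * x'\<^sup>2" by (simp add: power_mult_distrib)
  moreover have "(a' + b')\<^sup>2 = (a' - b')\<^sup>2 + 4 * (a' * b')" by (simp add: power2_eq_square field_simps)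
  moreover have "0 \<le> (a' - b')\<^sup>2" by simp
  ultimately have "(2 * x')\<^sup>2 \<le> (a' + b')\<^sup>2" by linarith
  then have "2 * x' \<le> a' + b'" by (rule power2_le_imp_le) (simp add: ab)
  then have "ennreal (2 * x') \<le> ennreal (a' + b')" by (rule ennreal_leI)
  then show ?thesis using ab x by (simp add: ennreal_mult)
qed auto

lemma ennreal_mult_le_cancel_two: "2 * (x::ennreal) \<le> 2 * y \<longleftrightarrow> x \<le> y"
  by (simp add: ennreal_mult_le_mult_iff)

text \<open>Cauchy-Schwarz in the form that can be iterated without extracting square roots; the double
  sum over \<open>i, j\<close> reduces it to \<open>2 x\<^sub>i x\<^sub>j \<le> y\<^sub>i z\<^sub>j + y\<^sub>j z\<^sub>i\<close>.\<close>

lemma sum_Cauchy_Schwarz_ennreal: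
  fixes x y z :: "'a \<Rightarrow> ennreal"
  assumes "\<And>i. i \<in> F \<Longrightarrow> (x i)\<^sup>2 \<le> y i * z i"
  shows "(sum x F)\<^sup>2 \<le> sum y F * sum z F"
proof -
  have "2 * (sum x F)\<^sup>2 = (\<Sum>i\<in>F. \<Sum>j\<in>F. 2 * (x i * x j))"
    unfolding power2_eq_square sum_product by (simp add: sum_distrib_left)
  also have "\<dots> \<le> (\<Sum>i\<in>F. \<Sum>j\<in>F. y i * z j + y j * z i)"
  proof (intro sum_mono ennreal_two_times_sqrt_le)
    fix i j assume "i \<in> F" "j \<in> F"
    then have "(x i)\<^sup>2 * (x j)\<^sup>2 \<le> (y i * z i) * (y j * z j)"
      by (intro mult_mono assms) auto
    then show "(x i * x j)\<^sup>2 \<le> y i * z j * (y j * z i)"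
      by (simp add: power_mult_distrib mult_ac)
  qed
  also have "\<dots> = 2 * (sum y F * sum z F)"
  proof -
    have "(\<Sum>i\<in>F. \<Sum>j\<in>F. y j * z i) = sum y F * sum z F"
      by (subst sum.swap) (simp add: sum_product)
    then show ?thesis by (simp add: sum.distrib sum_product[symmetric] mult_2)
  qed
  finally show ?thesis by (simp add: ennreal_mult_le_cancel_two)
qed

text \<open>The square of the supremum on the left runs over pairs \<open>F\<close>,
  \<open>G\<close> of finite sets; both sums are dominated by the one over
  \<open>F \<union> G\<close>, where the finite inequality applies.\<close>

lemma infsum_Cauchy_Schwarz_ennreal:
  fixes x y z :: "'a \<Rightarrow> ennreal"
  assumes "\<And>i. (x i)\<^sup>2 \<le> y i * z i"
  shows "(infsum x UNIV)\<^sup>2 \<le> infsum y UNIV * infsum z UNIV"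
proof -
  have fin: "(sum x F)\<^sup>2 \<le> infsum y UNIV * infsum z UNIV" if "finite F" for F
    using sum_Cauchy_Schwarz_ennreal[of F x y z, OF assms]
    by (rule order_trans) (auto intro!: mult_mono sum_le_infsum_ennreal that)
  have "sum x F * sum x G \<le> infsum y UNIV * infsum z UNIV" if "finite F" "finite G" for F G
  proof -
    have "sum x F * sum x G \<le> sum x (F \<union> G) * sum x (F \<union> G)"
      using that by (intro mult_mono sum_mono2) auto
    also have "\<dots> \<le> infsum y UNIV * infsum z UNIV"
      using fin[of "F \<union> G"] that by (simp add: power2_eq_square)
    finally show ?thesis .
  qed
  then show ?thesis
    unfolding power2_eq_square infsum_ennreal_eq_SUP[of x]
    by (subst SUP_mult_left_ennreal, intro SUP_least, subst mult.commute,
        subst SUP_mult_left_ennreal, intro SUP_least) auto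
qed

text \<open>Cauchy-Schwarz over a two-point index set: (s x)^2 is the product of s and s x^2, and
  the weights add up to 1.\<close>

lemma convex_power2_ennreal:
  fixes x y :: ennreal and s t :: real
  assumes "0 \<le> s" "0 \<le> t" "s + t = 1"
  shows "(ennreal s * x + ennreal t * y)\<^sup>2 \<le> ennreal s * x\<^sup>2 + ennreal t * y\<^sup>2"
proof -
  have st: "ennreal s + ennreal t = 1" using assms by (simp add: ennreal_plus[symmetric] del: ennreal_plus)
  have "(sum (\<lambda>b. if b then ennreal s * x else ennreal t * y) UNIV)\<^sup>2
      \<le> sum (\<lambda>b. if b then ennreal s else ennreal t) UNIV *
        sum (\<lambda>b. if b then ennreal s * x\<^sup>2 else ennreal t * y\<^sup>2) UNIV"
    by (rule sum_Cauchy_Schwarz_ennreal) (auto simp: power2_eq_square mult_ac)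
  then show ?thesis using st by (simp add: UNIV_bool add.commute)
qed

lemma prod_mono_ennreal:
  fixes f g :: "'a \<Rightarrow> ennreal"
  assumes "\<And>i. i \<in> F \<Longrightarrow> f i \<le> g i"
  shows "prod f F \<le> prod g F"
  using assms by (induction F rule: infinite_finite_induct) (auto intro: mult_mono)

section \<open>Multiindices\<close>

text \<open>A box of multiindices is a product of intervals, so the sum factors by
  distributivity.\<close>

lemma sum_prod_atMost_multiindex:
  fixes g :: "'n::finite \<Rightarrow> nat \<Rightarrow> 'a::comm_semiring_1"
  shows "(\<Sum>I\<le>R. \<Prod>k\<in>UNIV. g k (I $ k)) = (\<Prod>k\<in>UNIV. \<Sum>i\<le>R $ k. g k i)"
proof -
  have bij: "bij_betw vec_lambda (\<Pi>\<^sub>E k\<in>UNIV. {..R $ k}) {..R}"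
    by (rule bij_betwI[of _ _ _ vec_nth]) (auto simp: less_eq_vec_def PiE_iff)
  show ?thesis
    by (simp add: prod_sum_PiE sum.reindex_bij_betw[OF bij, symmetric])
qed

lemma finite_multiindex_bounded:
  fixes F :: "(nat^'n::finite) set"
  assumes "finite F" shows "\<exists>R. \<forall>N\<in>F. N \<le> R"
proof -
  define R :: "nat^'n" where "R = (\<chi> k. Max (insert 0 ((\<lambda>N. N $ k) ` F)))"
  have "N \<le> R" if "N \<in> F" for N
    using that assms by (auto simp: R_def less_eq_vec_def intro!: Max_ge)
  then show ?thesis by blast
qed

text \<open>Each finite set of multiindices lies in a box, where the sum factors.\<close>

lemma infsum_prod_multiindex_le:
  fixes g :: "'n::finite \<Rightarrow> nat \<Rightarrow> ennreal"
  shows "(\<Sum>\<^sub>\<infinity>N\<in>UNIV. \<Prod>k\<in>UNIV. g k (N $ k)) \<le> (\<Prod>k\<in>UNIV. \<Sum>\<^sub>\<infinity>i\<in>UNIV. g k i)"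
proof (rule infsum_ennreal_le)
  fix F :: "(nat^'n) set" assume "finite F"
  then obtain R where "\<And>N. N \<in> F \<Longrightarrow> N \<le> R" using finite_multiindex_bounded by blast
  then have "(\<Sum>N\<in>F. \<Prod>k\<in>UNIV. g k (N $ k)) \<le> (\<Sum>N\<le>R. \<Prod>k\<in>UNIV. g k (N $ k))"
    by (intro sum_mono2 finite_atMost_multiindex) auto
  also have "\<dots> = (\<Prod>k\<in>UNIV. \<Sum>i\<le>R $ k. g k i)" by (rule sum_prod_atMost_multiindex)
  also have "\<dots> \<le> (\<Prod>k\<in>UNIV. \<Sum>\<^sub>\<infinity>i\<in>UNIV. g k i)"
    by (intro prod_mono_ennreal sum_le_infsum_ennreal) simp
  finally show "(\<Sum>N\<in>F. \<Prod>k\<in>UNIV. g k (N $ k)) \<le> (\<Prod>k\<in>UNIV. \<Sum>\<^sub>\<infinity>i\<in>UNIV. g k i)" .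
qed

lemma mfact_pos: "0 < mfact N"
  by (simp add: mfact_def prod_pos)

lemma mfact_0 [simp]: "mfact 0 = 1"
  by (simp add: mfact_def)

lemma mabs_0 [simp]: "mabs 0 = 0"
  by (simp add: mabs_def)

lemma mabs_add [simp]: "mabs (M + N) = mabs M + mabs N"
  by (simp add: mabs_def sum.distrib)

lemma mbinom_same [simp]: "mbinom R R = 1"
  by (simp add: mbinom_def)

lemma power_mabs: "(c::'a::comm_semiring_1) ^ mabs N = (\<Prod>k\<in>UNIV. c ^ (N $ k))"
  by (simp add: mabs_def power_sum)

text \<open>The binomial theorem in each coordinate. It is the reason why \<open>binsum\<close>
  changes the base of an exponential bound from \<open>d\<close> to \<open>1 + d\<close>.\<close>

lemma sum_mbinom_power: 
  fixes d :: "'a::comm_semiring_1"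
  shows "(\<Sum>I\<le>R. of_nat (mbinom R I) * d ^ mabs I) = (1 + d) ^ mabs R"
proof -
  have "(\<Sum>I\<le>R. of_nat (mbinom R I) * d ^ mabs I)
      = (\<Sum>I\<le>R. \<Prod>k\<in>UNIV. of_nat ((R $ k) choose (I $ k)) * d ^ (I $ k))"
    by (simp add: mbinom_def power_mabs prod.distrib)
  also have "\<dots> = (\<Prod>k\<in>UNIV. \<Sum>i\<le>R $ k. of_nat ((R $ k) choose i) * d ^ i)"
    by (rule sum_prod_atMost_multiindex)
  also have "\<dots> = (\<Prod>k\<in>UNIV. (1 + d) ^ (R $ k))"
    by (intro prod.cong refl) (simp add: binomial_ring[of d 1, simplified] add.commute[of 1])
  finally show ?thesis by (simp add: power_mabs)
qed

lemma choose_le_choose_add: "n choose k \<le> (n + e) choose (k + e)"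
  by (induction e) (auto intro: le_trans)

lemma mbinom_le_mbinom_add: "mbinom R I \<le> mbinom (R + e) (I + e)"
  unfolding mbinom_def by (intro prod_mono) (auto simp: choose_le_choose_add)

lemma mbinom_symmetric: "I \<le> R \<Longrightarrow> mbinom R (R - I) = mbinom R I"
  unfolding mbinom_def by (intro prod.cong) (auto simp: less_eq_vec_def binomial_symmetric[symmetric])

section \<open>Estimates for the recursion, on arrays of coefficients\<close>

section \<open>The seminorms in terms of Taylor coefficients\<close>

type_synonym ('n, 'b) array = "nat^'n \<Rightarrow> nat^'n \<Rightarrow> 'b"

definition binsum :: "('n::finite, ennreal) array \<Rightarrow> ('n, ennreal) array" where
  "binsum A R S = (\<Sum>I\<le>R. \<Sum>J\<le>S. of_nat (mbinom R I) * of_nat (mbinom S J) * A I J)"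

text \<open>Only the second index is summed over, the first stays fixed; this asymmetry gives the
  transposition in the recursion its effect.\<close>

definition fsum :: "('n::finite, ennreal) array \<Rightarrow> ('n, ennreal) array" where
  "fsum A R S = (\<Sum>\<^sub>\<infinity>N\<in>UNIV. ennreal (1 / real (mfact N)) * A R (N + S))"

text \<open>Merges the even and odd branches of the recursion, so that one argument treats
  both.\<close>

definition transp_if :: "bool \<Rightarrow> ('n::finite, 'b) array \<Rightarrow> ('n, 'b) array" where
  "transp_if c A = (if c then (\<lambda>R S. A S R) else A)"

text \<open>The exponent involves the total order alone, so the power of \<open>2 * hbar\<close> in
  \<open>h\<close> at level 0 is the weight at the shifted position
  \<open>(R, N + S)\<close>.\<close>

definition wt :: "real \<Rightarrow> ('n::finite, complex) array \<Rightarrow> ('n, ennreal) array" where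
  "wt hbar a R S = ennreal ((2 * hbar) ^ (mabs R + mabs S) * (norm (a R S))\<^sup>2)"

primrec hc :: "real \<Rightarrow> nat \<Rightarrow> nat \<Rightarrow> ('n::finite, complex) array \<Rightarrow> ('n, ennreal) array" where
  "hc hbar 0 l a = fsum (wt hbar a)"
| "hc hbar (Suc m) l a = fsum (\<lambda>R S. (binsum (transp_if (odd l) (hc hbar m (l div 2) a)) R S)\<^sup>2)"

text \<open>Separates the estimates from functions: they are proved for arrays, and so apply to a
  limit not yet known to be a jet.\<close>

lemma h_eq_hc:
  assumes "0 < hbar"
  shows "h p hbar m l R S f = hc hbar m l (\<lambda>R S. wderiv R S f p) R S"
proof (induction m arbitrary: l R S)
  case 0
  have "ennreal ((2 * hbar) ^ (mabs R + mabs S + mabs N) / real (mfact N) * (norm (wderiv R (N + S) f p))\<^sup>2)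
      = ennreal (1 / real (mfact N)) * wt hbar (\<lambda>R S. wderiv R S f p) R (N + S)" for N
    using assms by (simp add: wt_def ennreal_mult[symmetric] add_ac)
  then show ?case by (simp add: fsum_def)
next
  case (Suc m)
  show ?case by (simp add: Suc fsum_def binsum_def transp_if_def)
qed

lemma binsum_mono:
  assumes "\<And>R S. A R S \<le> B R S" shows "binsum A R S \<le> binsum B R S"
  unfolding binsum_def using assms by (intro sum_mono mult_left_mono) auto

lemma fsum_mono:
  assumes "\<And>R S. A R S \<le> B R S" shows "fsum A R S \<le> fsum B R S"
  unfolding fsum_def using assms by (intro infsum_mono_ennreal mult_left_mono) auto

text \<open>Keeps only the term \<open>I = R\<close>, \<open>J = S\<close>, whose binomial
  coefficients are 1.\<close>

lemma le_binsum: "A R S \<le> binsum A R S"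
proof -
  have "A R S \<le> (\<Sum>J\<le>S. of_nat (mbinom R R) * of_nat (mbinom S J) * A R J)"
    using sum_nonneg_leq_bound[of "{..S}" "\<lambda>J. of_nat (mbinom R R) * of_nat (mbinom S J) * A R J" _ S]
      finite_atMost_multiindex[of S] by simp
  also have "\<dots> \<le> binsum A R S"
    unfolding binsum_def using finite_atMost_multiindex[of R]
    by (intro member_le_sum) auto
  finally show ?thesis .
qed

lemma fsum_term_le: "ennreal (1 / real (mfact N)) * A R (N + S) \<le> fsum A R S"
  unfolding fsum_def by (rule term_le_infsum_ennreal[where x = N])

lemma le_fsum: "A R S \<le> fsum A R S"
  using fsum_term_le[of 0] by simp

lemma binsum_Cauchy_Schwarz:
  assumes "\<And>R S. (A R S)\<^sup>2 \<le> B R S * C R S"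
  shows "(binsum A R S)\<^sup>2 \<le> binsum B R S * binsum C R S"
proof -
  have eq: "binsum A R S = (\<Sum>(I,J)\<in>{..R}\<times>{..S}. of_nat (mbinom R I) * of_nat (mbinom S J) * A I J)" for A
    by (simp add: binsum_def sum.cartesian_product)
  show ?thesis
    unfolding eq
  proof (rule sum_Cauchy_Schwarz_ennreal, clarify)
    fix I J
    have "(of_nat (mbinom R I) * of_nat (mbinom S J))\<^sup>2 * (A I J)\<^sup>2
        \<le> (of_nat (mbinom R I) * of_nat (mbinom S J))\<^sup>2 * (B I J * C I J)"
      by (intro mult_left_mono assms) auto
    then show "(of_nat (mbinom R I) * of_nat (mbinom S J) * A I J)\<^sup>2 \<le>
        of_nat (mbinom R I) * of_nat (mbinom S J) * B I J * (of_nat (mbinom R I) * of_nat (mbinom S J) * C I J)"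
      by (simp add: power2_eq_square mult_ac)
  qed
qed

lemma fsum_Cauchy_Schwarz:
  assumes "\<And>R S. (A R S)\<^sup>2 \<le> B R S * C R S"
  shows "(fsum A R S)\<^sup>2 \<le> fsum B R S * fsum C R S"
  unfolding fsum_def
proof (rule infsum_Cauchy_Schwarz_ennreal)
  fix N :: "nat^'a"
  have "(ennreal (1 / real (mfact N)))\<^sup>2 * (A R (N + S))\<^sup>2
      \<le> (ennreal (1 / real (mfact N)))\<^sup>2 * (B R (N + S) * C R (N + S))"
    by (intro mult_left_mono assms) auto
  then show "(ennreal (1 / real (mfact N)) * A R (N + S))\<^sup>2
      \<le> ennreal (1 / real (mfact N)) * B R (N + S) * (ennreal (1 / real (mfact N)) * C R (N + S))"
    by (simp add: power2_eq_square mult_ac)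
qed

section \<open>Products\<close>

text \<open>The Leibniz rule on the level of jets.\<close>

definition conv :: "('n::finite, complex) array \<Rightarrow> ('n, complex) array \<Rightarrow> ('n, complex) array" where
  "conv a b R S = (\<Sum>I\<le>R. \<Sum>J\<le>S. of_nat (mbinom R I) * of_nat (mbinom S J) * (a I J * b (R - I) (S - J)))"

lemma sum_mbinom_reflect:
  fixes R :: "nat^'n::finite"
  shows "(\<Sum>I\<le>R. of_nat (mbinom R I) * f (R - I)) = (\<Sum>I\<le>R. of_nat (mbinom R I) * f I)"
  by (rule sum.reindex_bij_witness[of _ "\<lambda>I. R - I" "\<lambda>I. R - I"])
    (auto simp: less_eq_vec_def vec_eq_iff mbinom_symmetric)

text \<open>Binomial coefficients are symmetric under \<open>I \<mapsto> R - I\<close>. This brings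
  the second factor of \<open>conv\<close>, which is evaluated at complementary indices, into the
  shape of \<open>binsum\<close>.\<close>

lemma binsum_reflect: "binsum A R S =
    (\<Sum>I\<le>R. \<Sum>J\<le>S. of_nat (mbinom R I) * of_nat (mbinom S J) * A (R - I) (S - J))"
proof -
  have "(\<Sum>I\<le>R. \<Sum>J\<le>S. of_nat (mbinom R I) * of_nat (mbinom S J) * A (R - I) (S - J))
      = (\<Sum>I\<le>R. of_nat (mbinom R I) * (\<Sum>J\<le>S. of_nat (mbinom S J) * A (R - I) (S - J)))"
    by (simp add: sum_distrib_left mult.assoc)
  also have "\<dots> = (\<Sum>I\<le>R. of_nat (mbinom R I) * (\<Sum>J\<le>S. of_nat (mbinom S J) * A (R - I) J))"
    by (simp only: sum_mbinom_reflect)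
  also have "\<dots> = (\<Sum>I\<le>R. of_nat (mbinom R I) * (\<Sum>J\<le>S. of_nat (mbinom S J) * A I J))"
    by (rule sum_mbinom_reflect)
  finally show ?thesis by (simp add: binsum_def sum_distrib_left mult.assoc)
qed

lemma mabs_diff: "I \<le> R \<Longrightarrow> mabs I + mabs (R - I) = mabs R"
  by (simp add: mabs_def sum.distrib[symmetric] less_eq_vec_def)

text \<open>Cauchy-Schwarz with the products of binomial coefficients as weights. The factor (2
  hbar)^(|R|+|S|) distributes over both arrays because |I| + |R - I| = |R|.\<close>

lemma wt_conv_le:
  assumes "0 < hbar"
  shows "wt hbar (conv a b) R S \<le> binsum (wt hbar a) R S * binsum (wt hbar b) R S"
proof -
  define \<beta> :: "(nat^'a) \<times> (nat^'a) \<Rightarrow> real" where "\<beta> = (\<lambda>(I,J). of_nat (mbinom R I) * of_nat (mbinom S J))"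
  \<comment> \<open>The root of the weight, so that \<open>s * norm (conv a b R S)\<close> squares
    to \<open>wt\<close>.\<close>
  define s where "s = sqrt ((2 * hbar) ^ (mabs R + mabs S))"
  define x where "x = (\<lambda>(I,J). ennreal (s * (\<beta> (I,J) * (norm (a I J) * norm (b (R - I) (S - J))))))"
  define y where "y = (\<lambda>(I,J). of_nat (mbinom R I) * of_nat (mbinom S J) * wt hbar a I J)"
  define z where "z = (\<lambda>(I,J). of_nat (mbinom R I) * of_nat (mbinom S J) * wt hbar b (R - I) (S - J))"
  have s: "0 \<le> s" "s\<^sup>2 = (2 * hbar) ^ (mabs R + mabs S)" using assms by (auto simp: s_def)
  have \<beta>: "0 \<le> \<beta> i" for i by (auto simp: \<beta>_def split: prod.split)
  have "norm (conv a b R S) \<le> (\<Sum>(I,J)\<in>{..R}\<times>{..S}. \<beta> (I,J) * (norm (a I J) * norm (b (R - I) (S - J))))"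
    unfolding conv_def sum.cartesian_product
    by (rule order_trans[OF norm_sum]) (auto intro!: sum_mono simp: norm_mult \<beta>_def)
  then have "s * norm (conv a b R S) \<le> s * (\<Sum>(I,J)\<in>{..R}\<times>{..S}. \<beta> (I,J) * (norm (a I J) * norm (b (R - I) (S - J))))"
    using s by (intro mult_left_mono) auto
  then have "ennreal (s * norm (conv a b R S)) \<le> sum x ({..R}\<times>{..S})"
    unfolding x_def case_prod_unfold using s \<beta>
    by (subst sum_ennreal) (auto simp: sum_distrib_left intro!: ennreal_leI)
  then have "(ennreal (s * norm (conv a b R S)))\<^sup>2 \<le> (sum x ({..R}\<times>{..S}))\<^sup>2"
    by (rule power_mono) simp
  also have "\<dots> \<le> sum y ({..R}\<times>{..S}) * sum z ({..R}\<times>{..S})"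
  proof (rule sum_Cauchy_Schwarz_ennreal, clarify)
    fix I J assume "I \<le> R" "J \<le> S"
    then have "mabs R + mabs S = (mabs I + mabs J) + (mabs (R - I) + mabs (S - J))"
      using mabs_diff[of I R] mabs_diff[of J S] by auto
    then have "s\<^sup>2 = (2 * hbar) ^ (mabs I + mabs J) * (2 * hbar) ^ (mabs (R - I) + mabs (S - J))"
      unfolding s by (simp add: power_add)
    then show "(x (I, J))\<^sup>2 \<le> y (I, J) * z (I, J)"
      using s \<beta> assms
      by (simp add: x_def y_def z_def wt_def \<beta>_def ennreal_mult[symmetric] ennreal_of_nat_eq_real_of_nat
          ennreal_power power_mult_distrib)
        (simp add: power2_eq_square mult_ac)
  qed
  also have "sum y ({..R}\<times>{..S}) = binsum (wt hbar a) R S"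
    by (simp add: y_def binsum_def sum.cartesian_product)
  also have "sum z ({..R}\<times>{..S}) = binsum (wt hbar b) R S"
    by (simp add: z_def binsum_reflect sum.cartesian_product)
  finally have "(ennreal (s * norm (conv a b R S)))\<^sup>2 \<le> binsum (wt hbar a) R S * binsum (wt hbar b) R S" .
  moreover have "(ennreal (s * norm (conv a b R S)))\<^sup>2 = wt hbar (conv a b) R S"
    using s by (simp add: wt_def ennreal_power power_mult_distrib)
  ultimately show ?thesis by simp
qed

text \<open>For \<open>m = 0\<close>, squaring the pointwise bound \<open>wt_conv_le\<close>
  produces the squares that level 1 contains, and \<open>le_fsum\<close> supplies its inner sum.
  Since \<open>l < 2 ^ m\<close>, the step added on the right is untransposed; all outer steps use
  the same digits of \<open>l\<close> on both sides.\<close>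

lemma hc_conv:
  assumes "0 < hbar" "l < 2 ^ m"
  shows "(hc hbar m l (conv a b) R S)\<^sup>2 \<le> hc hbar (Suc m) l a R S * hc hbar (Suc m) l b R S"
  using assms(2)
proof (induction m arbitrary: l R S)
  case 0
  then have l: "l = 0" by simp
  show ?case
    unfolding hc.simps l
  proof (rule fsum_Cauchy_Schwarz)
    fix R S :: "nat^'a"
    have "wt hbar (conv a b) R S \<le> binsum (wt hbar a) R S * binsum (wt hbar b) R S"
      by (rule wt_conv_le[OF assms(1)])
    also have "\<dots> \<le> binsum (fsum (wt hbar a)) R S * binsum (fsum (wt hbar b)) R S"
      by (intro mult_mono binsum_mono le_fsum) auto
    finally have "(wt hbar (conv a b) R S)\<^sup>2 \<le> (binsum (fsum (wt hbar a)) R S * binsum (fsum (wt hbar b)) R S)\<^sup>2"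
      by (rule power_mono) simp
    then show "(wt hbar (conv a b) R S)\<^sup>2 \<le>
        (binsum (transp_if (odd (0::nat)) (fsum (wt hbar a))) R S)\<^sup>2 *
        (binsum (transp_if (odd (0::nat)) (fsum (wt hbar b))) R S)\<^sup>2"
      by (simp add: transp_if_def power_mult_distrib)
  qed
next
  case (Suc m)
  then have l: "l div 2 < 2 ^ m" by auto
  have 1: "(transp_if (odd l) (hc hbar m (l div 2) (conv a b)) R S)\<^sup>2 \<le>
      transp_if (odd l) (hc hbar (Suc m) (l div 2) a) R S * transp_if (odd l) (hc hbar (Suc m) (l div 2) b) R S" for R S
    unfolding transp_if_def by (simp add: Suc.IH[OF l] del: hc.simps)
  show ?case
    unfolding hc.simps(2)[of hbar m l] hc.simps(2)[of hbar "Suc m" l]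
    by (rule fsum_Cauchy_Schwarz, subst power_mult_distrib[symmetric],
        rule power_mono[OF binsum_Cauchy_Schwarz[OF 1]]) simp
qed

section \<open>Complex conjugation\<close>

definition star :: "('n::finite, complex) array \<Rightarrow> ('n, complex) array" where
  "star a R S = cnj (a S R)"

text \<open>Exponential growth in the total order is stable under every step of the recursion; the
  constants in the conjugation estimate are arrays of this kind.\<close>

definition exp_bounded :: "('n::finite, ennreal) array \<Rightarrow> bool" where
  "exp_bounded A \<longleftrightarrow> (\<exists>c d :: real. 0 \<le> c \<and> 0 \<le> d \<and> (\<forall>R S. A R S \<le> ennreal (c * d ^ (mabs R + mabs S))))"

lemma exp_bounded_less_top: "exp_bounded A \<Longrightarrow> A R S < \<infinity>"
  unfolding exp_bounded_def infinity_ennreal_def by (meson ennreal_less_top le_less_trans)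

lemma exp_bounded_transp_if: "exp_bounded A \<Longrightarrow> exp_bounded (transp_if c A)"
  unfolding exp_bounded_def transp_if_def by (cases c) (simp_all, metis add.commute)

lemma exp_bounded_const: "0 \<le> c \<Longrightarrow> exp_bounded (\<lambda>R S. ennreal c)"
  unfolding exp_bounded_def by (rule exI[of _ c], rule exI[of _ 1]) simp

lemma exp_bounded_power2:
  assumes "exp_bounded A" shows "exp_bounded (\<lambda>R S. (A R S)\<^sup>2)"
proof -
  obtain c d where cd: "0 \<le> c" "0 \<le> d" "\<And>R S. A R S \<le> ennreal (c * d ^ (mabs R + mabs S))"
    using assms unfolding exp_bounded_def by blast
  have "(A R S)\<^sup>2 \<le> ennreal (c\<^sup>2 * (d\<^sup>2) ^ (mabs R + mabs S))" for R S
  proof -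
    have "(A R S)\<^sup>2 \<le> (ennreal (c * d ^ (mabs R + mabs S)))\<^sup>2" by (intro power_mono cd) simp
    also have "\<dots> = ennreal (c\<^sup>2 * (d\<^sup>2) ^ (mabs R + mabs S))"
      using cd by (simp add: ennreal_power power_mult_distrib power_mult[symmetric] mult.commute)
    finally show ?thesis .
  qed
  then show ?thesis using cd unfolding exp_bounded_def by (intro exI[of _ "c\<^sup>2"] exI[of _ "d\<^sup>2"]) auto
qed

lemma exp_bounded_binsum:
  assumes "exp_bounded A" shows "exp_bounded (binsum A)"
proof -
  obtain c d where cd: "0 \<le> c" "0 \<le> d" "\<And>R S. A R S \<le> ennreal (c * d ^ (mabs R + mabs S))"
    using assms unfolding exp_bounded_def by blast
  have "binsum A R S \<le> ennreal (c * (1 + d) ^ (mabs R + mabs S))" for R S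
  proof -
    have "binsum A R S \<le> binsum (\<lambda>R S. ennreal (c * d ^ (mabs R + mabs S))) R S"
      by (intro binsum_mono cd)
    also have "\<dots> = (\<Sum>I\<le>R. \<Sum>J\<le>S. ennreal (c * ((of_nat (mbinom R I) * d ^ mabs I) * (of_nat (mbinom S J) * d ^ mabs J))))"
      unfolding binsum_def using cd
      by (intro sum.cong refl) (simp add: ennreal_mult[symmetric] ennreal_of_nat_eq_real_of_nat power_add mult_ac)
    also have "\<dots> = ennreal (\<Sum>I\<le>R. \<Sum>J\<le>S. c * ((of_nat (mbinom R I) * d ^ mabs I) * (of_nat (mbinom S J) * d ^ mabs J)))"
      using cd by (simp add: sum_nonneg)
    also have "(\<Sum>I\<le>R. \<Sum>J\<le>S. c * ((of_nat (mbinom R I) * d ^ mabs I) * (of_nat (mbinom S J) * d ^ mabs J)))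
       = c * ((\<Sum>I\<le>R. of_nat (mbinom R I) * d ^ mabs I) * (\<Sum>J\<le>S. of_nat (mbinom S J) * d ^ mabs J))"
      by (simp add: sum_product sum_distrib_left[symmetric])
    also have "\<dots> = c * (1 + d) ^ (mabs R + mabs S)"
      by (simp add: sum_mbinom_power power_add)
    finally show ?thesis .
  qed
  then show ?thesis using cd unfolding exp_bounded_def by (intro exI[of _ c] exI[of _ "1 + d"]) auto
qed

text \<open>The sum factors over the coordinates into exponential series, so it is at most
  \<open>exp d\<close> to the power of the dimension.\<close>

lemma infsum_power_div_mfact_less_top:
  assumes "0 \<le> d" shows "(\<Sum>\<^sub>\<infinity>N\<in>UNIV. ennreal (d ^ mabs (N :: nat^'n::finite) / real (mfact N))) < \<infinity>"
proof -
  have "(\<Sum>\<^sub>\<infinity>N\<in>UNIV. ennreal (d ^ mabs (N :: nat^'n) / real (mfact N)))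
      = (\<Sum>\<^sub>\<infinity>N\<in>UNIV. \<Prod>k\<in>UNIV. ennreal (d ^ (N $ (k::'n)) / fact (N $ k)))"
    using assms by (simp add: prod_ennreal power_mabs mfact_def prod_dividef)
  also have "\<dots> \<le> (\<Prod>k\<in>(UNIV::'n set). \<Sum>\<^sub>\<infinity>i\<in>UNIV. ennreal (d ^ i / fact i))"
    by (rule infsum_prod_multiindex_le)
  also have "\<dots> \<le> (\<Prod>k\<in>(UNIV::'n set). ennreal (exp d))"
  proof (intro prod_mono_ennreal infsum_ennreal_le)
    fix F :: "nat set" assume "finite F"
    have sums: "(\<lambda>i. d ^ i / fact i) sums exp d"
      using exp_converges[of d] by (simp add: field_simps)
    have "(\<Sum>i\<in>F. d ^ i / fact i) \<le> exp d"
      using sum_le_suminf[OF sums_summable[OF sums] \<open>finite F\<close>] assms sums_unique[OF sums] by simp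
    then show "(\<Sum>i\<in>F. ennreal (d ^ i / fact i)) \<le> ennreal (exp d)"
      using assms by (subst sum_ennreal) (auto intro: ennreal_leI)
  qed
  also have "\<dots> < \<infinity>" by (simp add: power_less_top_ennreal)
  finally show ?thesis .
qed

lemma exp_bounded_fsum:
  fixes A :: "('n::finite, ennreal) array"
  assumes "exp_bounded A" shows "exp_bounded (fsum A)"
proof -
  obtain c d where cd: "0 \<le> c" "0 \<le> d" "\<And>R S. A R S \<le> ennreal (c * d ^ (mabs R + mabs S))"
    using assms unfolding exp_bounded_def by blast
  \<comment> \<open>The powers belonging to \<open>R\<close> and \<open>S\<close> split off from the
    sum over \<open>N\<close>, which leaves a constant independent of both.\<close>
  define K where "K = (\<Sum>\<^sub>\<infinity>N\<in>UNIV. ennreal (d ^ mabs (N :: nat^'n::finite) / real (mfact N)))"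
  have K: "K < \<infinity>" unfolding K_def by (rule infsum_power_div_mfact_less_top[OF cd(2)])
  have "fsum A R S \<le> ennreal (enn2real K * c * d ^ (mabs R + mabs S))" for R S
  proof -
    have "fsum A R S \<le> fsum (\<lambda>R S. ennreal (c * d ^ (mabs R + mabs S))) R S"
      by (intro fsum_mono cd)
    also have "\<dots> = (\<Sum>\<^sub>\<infinity>N\<in>UNIV. ennreal (c * d ^ (mabs R + mabs S)) * ennreal (d ^ mabs (N :: nat^'n::finite) / real (mfact N)))"
      unfolding fsum_def using cd by (simp add: ennreal_mult[symmetric] power_add mult_ac)
    also have "\<dots> = ennreal (c * d ^ (mabs R + mabs S)) * K"
      by (simp add: infsum_cmult_ennreal K_def)
    also have "\<dots> = ennreal (c * d ^ (mabs R + mabs S)) * ennreal (enn2real K)" using K by simp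
    also have "\<dots> = ennreal (enn2real K * c * d ^ (mabs R + mabs S))"
      using cd by (simp add: ennreal_mult[symmetric] mult_ac)
    finally show ?thesis .
  qed
  then show ?thesis using cd unfolding exp_bounded_def by (intro exI[of _ "enn2real K * c"] exI[of _ d]) auto
qed

text \<open>Conjugation exchanges the two indices of a weighted coefficient, and one transposed
  innermost step exchanges them back. That step comes with a square inside the sum which the
  left-hand side lacks, so Cauchy-Schwarz is applied against the constant 1. \<open>K\<close> is the
  recursion started from that constant and is the same for all \<open>a\<close>.\<close>

lemma hc_star:
  "l < 2 ^ m \<Longrightarrow> \<exists>K. exp_bounded K \<and>
    (\<forall>(a :: ('n::finite, complex) array) R S. (hc hbar m l (star a) R S)\<^sup>2 \<le> K R S * hc hbar (Suc m) (l + 2 ^ m) a R S)"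
proof (induction m arbitrary: l)
  case 0
  then have l: "l = 0" by simp
  let ?K = "fsum (\<lambda>R S. 1) :: ('n, ennreal) array"
  have "(hc hbar 0 l (star a) R S)\<^sup>2 \<le> ?K R S * hc hbar (Suc 0) (l + 2 ^ 0) a R S" for a :: "('n, complex) array" and R S
    unfolding hc.simps l
  proof (rule fsum_Cauchy_Schwarz)
    fix R S :: "nat^'n"
    have "wt hbar (star a) R S = wt hbar a S R" by (simp add: wt_def star_def add.commute)
    also have "\<dots> \<le> transp_if True (fsum (wt hbar a)) R S" by (simp add: transp_if_def le_fsum)
    also have "\<dots> \<le> binsum (transp_if True (fsum (wt hbar a))) R S" by (rule le_binsum)
    finally have "(wt hbar (star a) R S)\<^sup>2 \<le> (binsum (transp_if True (fsum (wt hbar a))) R S)\<^sup>2"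
      by (rule power_mono) simp
    then show "(wt hbar (star a) R S)\<^sup>2 \<le> 1 * (binsum (transp_if (odd (0 + 2 ^ 0 :: nat)) (fsum (wt hbar a))) R S)\<^sup>2"
      by simp
  qed
  moreover have "exp_bounded ?K" by (intro exp_bounded_fsum) (use exp_bounded_const[of 1] in simp)
  ultimately show ?case by blast
next
  case (Suc m)
  then have "l div 2 < 2 ^ m" by auto
  then obtain K where K: "exp_bounded K"
    "\<And>(a :: ('n, complex) array) R S. (hc hbar m (l div 2) (star a) R S)\<^sup>2 \<le> K R S * hc hbar (Suc m) (l div 2 + 2 ^ m) a R S"
    using Suc.IH by blast
  have l: "(l + 2 ^ Suc m) div 2 = l div 2 + 2 ^ m" "odd (l + 2 ^ Suc m) = odd l" by auto
  let ?K = "fsum (\<lambda>R S. (binsum (transp_if (odd l) K) R S)\<^sup>2)"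
  have "(hc hbar (Suc m) l (star a) R S)\<^sup>2 \<le> ?K R S * hc hbar (Suc (Suc m)) (l + 2 ^ Suc m) a R S" for a :: "('n, complex) array" and R S
  proof -
    have 1: "(transp_if (odd l) (hc hbar m (l div 2) (star a)) R S)\<^sup>2 \<le>
      transp_if (odd l) K R S * transp_if (odd l) (hc hbar (Suc m) (l div 2 + 2 ^ m) a) R S" for R S
      unfolding transp_if_def by (simp add: K(2) del: hc.simps)
    show ?thesis
      unfolding hc.simps(2)[of hbar m l] hc.simps(2)[of hbar "Suc m" "l + 2 ^ Suc m"] l
      by (rule fsum_Cauchy_Schwarz, subst power_mult_distrib[symmetric],
          rule power_mono[OF binsum_Cauchy_Schwarz[OF 1]]) simp
  qed
  moreover have "exp_bounded ?K"
    by (intro exp_bounded_fsum exp_bounded_power2 exp_bounded_binsum exp_bounded_transp_if K)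
  ultimately show ?case by blast
qed

section \<open>Derivatives\<close>

text \<open>Transposition turns a shift of the first index into one of the second, hence the
  disjunction. Neither the constant nor the kind of shift may depend on \<open>a\<close>,
  \<open>R\<close> and \<open>S\<close>.\<close>

definition shift_le :: "nat^'n::finite \<Rightarrow> ('a \<Rightarrow> ('n, ennreal) array) \<Rightarrow> ('a \<Rightarrow> ('n, ennreal) array) \<Rightarrow> bool" where
  "shift_le e F G \<longleftrightarrow> (\<exists>c. c < \<infinity> \<and>
     ((\<forall>a R S. F a R S \<le> c * G a (R + e) S) \<or> (\<forall>a R S. F a R S \<le> c * G a R (S + e))))"

lemma shift_le_transp_if: "shift_le e F G \<Longrightarrow> shift_le e (\<lambda>a. transp_if b (F a)) (\<lambda>a. transp_if b (G a))"
  unfolding shift_le_def transp_if_def by (cases b) auto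

lemma shift_le_power2:
  assumes "shift_le e F G" shows "shift_le e (\<lambda>a R S. (F a R S)\<^sup>2) (\<lambda>a R S. (G a R S)\<^sup>2)"
proof -
  obtain c where c: "c < \<infinity>"
    "(\<forall>a R S. F a R S \<le> c * G a (R + e) S) \<or> (\<forall>a R S. F a R S \<le> c * G a R (S + e))"
    using assms unfolding shift_le_def by blast
  have "x\<^sup>2 \<le> c\<^sup>2 * y\<^sup>2" if "x \<le> c * y" for x y
    using power_mono[OF that, of 2] by (simp add: power_mult_distrib)
  then show ?thesis using c unfolding shift_le_def by (intro exI[of _ "c\<^sup>2"]) (auto simp: power_less_top_ennreal)
qed

text \<open>Reindexing by \<open>I \<mapsto> I + e\<close> does not decrease the binomial
  coefficients when \<open>R\<close> is shifted too, and the terms left out are nonnegative.\<close>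

lemma sum_mbinom_shift_le:
  fixes g :: "nat^'n::finite \<Rightarrow> ennreal"
  shows "(\<Sum>I\<le>R. of_nat (mbinom R I) * g (I + e)) \<le> (\<Sum>I\<le>R + e. of_nat (mbinom (R + e) I) * g I)"
proof -
  have "(\<Sum>I\<le>R. of_nat (mbinom R I) * g (I + e)) \<le> (\<Sum>I\<le>R. of_nat (mbinom (R + e) (I + e)) * g (I + e))"
    by (intro sum_mono mult_right_mono) (auto simp: mbinom_le_mbinom_add)
  also have "\<dots> = (\<Sum>I\<in>(\<lambda>I. I + e) ` {..R}. of_nat (mbinom (R + e) I) * g I)"
    by (subst sum.reindex) (auto intro: inj_onI)
  also have "\<dots> \<le> (\<Sum>I\<le>R + e. of_nat (mbinom (R + e) I) * g I)"
    by (intro sum_mono2 finite_atMost_multiindex) (auto simp: less_eq_vec_def)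
  finally show ?thesis .
qed

lemma binsum_swap: "binsum A R S = binsum (\<lambda>R S. A S R) S R"
  unfolding binsum_def by (subst sum.swap) (simp add: mult_ac)

lemma binsum_shift_le: "binsum (\<lambda>R S. A (R + e) S) R S \<le> binsum A (R + e) S"
proof -
  have "binsum (\<lambda>R S. A (R + e) S) R S = (\<Sum>I\<le>R. of_nat (mbinom R I) * (\<Sum>J\<le>S. of_nat (mbinom S J) * A (I + e) J))"
    by (simp add: binsum_def sum_distrib_left mult_ac)
  also have "\<dots> \<le> (\<Sum>I\<le>R + e. of_nat (mbinom (R + e) I) * (\<Sum>J\<le>S. of_nat (mbinom S J) * A I J))"
    by (rule sum_mbinom_shift_le)
  also have "\<dots> = binsum A (R + e) S"
    by (simp add: binsum_def sum_distrib_left mult_ac)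
  finally show ?thesis .
qed

lemma binsum_cmult: "binsum (\<lambda>R S. c * A R S) R S = c * binsum A R S"
  by (simp add: binsum_def sum_distrib_left mult_ac)

lemma fsum_cmult: "fsum (\<lambda>R S. c * A R S) R S = c * fsum A R S"
  by (simp add: fsum_def infsum_cmult_ennreal[symmetric] mult_ac)

text \<open>Common to \<open>binsum\<close> and \<open>fsum\<close>. Squaring is not homogeneous of
  degree 1 and is treated separately in \<open>shift_le_power2\<close>.\<close>

lemma shift_le_map:
  fixes \<Phi> :: "('n::finite, ennreal) array \<Rightarrow> ('n, ennreal) array"
  assumes le: "shift_le e F G"
    and mono: "\<And>A B R S. (\<And>R S. A R S \<le> B R S) \<Longrightarrow> \<Phi> A R S \<le> \<Phi> B R S"
    and cmult: "\<And>c A R S. \<Phi> (\<lambda>R S. c * A R S) R S = c * \<Phi> A R S"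
    and left: "\<And>A R S. \<Phi> (\<lambda>R S. A (R + e) S) R S \<le> \<Phi> A (R + e) S"
    and right: "\<And>A R S. \<Phi> (\<lambda>R S. A R (S + e)) R S \<le> \<Phi> A R (S + e)"
  shows "shift_le e (\<lambda>a. \<Phi> (F a)) (\<lambda>a. \<Phi> (G a))"
proof -
  obtain c where c: "c < \<infinity>"
    "(\<forall>a R S. F a R S \<le> c * G a (R + e) S) \<or> (\<forall>a R S. F a R S \<le> c * G a R (S + e))"
    using le unfolding shift_le_def by blast
  have "\<Phi> (F a) R S \<le> c * \<Phi> (G a) (R + e) S" if "\<forall>a R S. F a R S \<le> c * G a (R + e) S" for a R S
  proof -
    have "\<Phi> (F a) R S \<le> \<Phi> (\<lambda>R S. c * G a (R + e) S) R S" using that by (intro mono) auto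
    also have "\<dots> \<le> c * \<Phi> (G a) (R + e) S" unfolding cmult by (intro mult_left_mono left) simp
    finally show ?thesis .
  qed
  moreover have "\<Phi> (F a) R S \<le> c * \<Phi> (G a) R (S + e)" if "\<forall>a R S. F a R S \<le> c * G a R (S + e)" for a R S
  proof -
    have "\<Phi> (F a) R S \<le> \<Phi> (\<lambda>R S. c * G a R (S + e)) R S" using that by (intro mono) auto
    also have "\<dots> \<le> c * \<Phi> (G a) R (S + e)" unfolding cmult by (intro mult_left_mono right) simp
    finally show ?thesis .
  qed
  ultimately show ?thesis using c unfolding shift_le_def by blast
qed

lemma shift_le_binsum: "shift_le e F G \<Longrightarrow> shift_le e (\<lambda>a. binsum (F a)) (\<lambda>a. binsum (G a))"
  by (erule shift_le_map) (auto intro: binsum_mono binsum_shift_le simp: binsum_cmult binsum_swap[of _ _ "_ + e"]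
      binsum_swap[of "\<lambda>R S. _ R (S + e)"])

lemma shift_le_fsum: "shift_le e F G \<Longrightarrow> shift_le e (\<lambda>a. fsum (F a)) (\<lambda>a. fsum (G a))"
  by (erule shift_le_map) (auto intro: fsum_mono simp: fsum_cmult, simp_all add: fsum_def add.assoc)

lemma shift_le_hc:
  assumes "shift_le e (\<lambda>a. wt hbar (D a)) (wt hbar)"
  shows "shift_le e (\<lambda>a. hc hbar m l (D a)) (hc hbar m l)"
proof (induction m arbitrary: l)
  case 0
  then show ?case using shift_le_fsum[OF assms] by simp
next
  case (Suc m)
  then show ?case by (simp add: shift_le_fsum shift_le_power2 shift_le_binsum shift_le_transp_if)
qed

text \<open>The constant is the reciprocal of the weight (2 hbar)^|e| that the additional
  derivatives bring along.\<close>

lemma wt_shift_le: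
  assumes "0 < hbar"
  shows "shift_le e (\<lambda>a. wt hbar (\<lambda>R S. a (R + e) S)) (wt hbar)"
    and "shift_le e (\<lambda>a. wt hbar (\<lambda>R S. a R (S + e))) (wt hbar)"
proof -
  let ?c = "ennreal (1 / (2 * hbar) ^ mabs e)"
  have "wt hbar (\<lambda>R S. a (R + e) S) R S \<le> ?c * wt hbar a (R + e) S"
       "wt hbar (\<lambda>R S. a R (S + e)) R S \<le> ?c * wt hbar a R (S + e)" for a R S
    using assms by (simp_all add: wt_def ennreal_mult[symmetric] power_add)
  moreover have "?c < \<infinity>" by simp
  ultimately show "shift_le e (\<lambda>a. wt hbar (\<lambda>R S. a (R + e) S)) (wt hbar)"
    "shift_le e (\<lambda>a. wt hbar (\<lambda>R S. a R (S + e))) (wt hbar)"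
    unfolding shift_le_def by blast+
qed

section \<open>Convexity and homogeneity\<close>

lemma binsum_add: "binsum (\<lambda>R S. A R S + B R S) R S = binsum A R S + binsum B R S"
  by (simp add: binsum_def distrib_left sum.distrib)

lemma fsum_add: "fsum (\<lambda>R S. A R S + B R S) R S = fsum A R S + fsum B R S"
  unfolding fsum_def distrib_left
  by (intro infsum_add nonneg_summable_on_complete) auto

text \<open>The triangle inequality for the root does not pass through the recursion directly, while
  convexity does: \<open>fsum\<close> and \<open>binsum\<close> are linear, and squaring is
  increasing and convex.\<close>

lemma hc_convex:
  assumes st: "0 \<le> s" "0 \<le> t" "s + t = (1::real)" and hbar: "0 < hbar"
  shows "hc hbar m l (\<lambda>R S. of_real s * a R S + of_real t * b R S) R S
      \<le> ennreal s * hc hbar m l a R S + ennreal t * hc hbar m l b R S"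
proof (induction m arbitrary: l R S)
  case 0
  have "wt hbar (\<lambda>R S. of_real s * a R S + of_real t * b R S) R S
      \<le> ennreal s * wt hbar a R S + ennreal t * wt hbar b R S" for R S
  proof -
    have "ennreal (norm (of_real s * a R S + of_real t * b R S))
        \<le> ennreal s * ennreal (norm (a R S)) + ennreal t * ennreal (norm (b R S))"
      using st norm_triangle_ineq[of "of_real s * a R S" "of_real t * b R S"]
      by (simp add: norm_mult ennreal_mult[symmetric] ennreal_plus[symmetric] ennreal_leI del: ennreal_plus)
    then have "(ennreal (norm (of_real s * a R S + of_real t * b R S)))\<^sup>2
        \<le> (ennreal s * ennreal (norm (a R S)) + ennreal t * ennreal (norm (b R S)))\<^sup>2"
      by (rule power_mono) simp
    also have "\<dots> \<le> ennreal s * (ennreal (norm (a R S)))\<^sup>2 + ennreal t * (ennreal (norm (b R S)))\<^sup>2"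
      by (rule convex_power2_ennreal[OF st])
    finally have "ennreal ((2 * hbar) ^ (mabs R + mabs S)) * (ennreal (norm (of_real s * a R S + of_real t * b R S)))\<^sup>2
        \<le> ennreal ((2 * hbar) ^ (mabs R + mabs S)) * (ennreal s * (ennreal (norm (a R S)))\<^sup>2 + ennreal t * (ennreal (norm (b R S)))\<^sup>2)"
      by (rule mult_left_mono) simp
    then show ?thesis using hbar
      by (simp add: wt_def ennreal_mult ennreal_power distrib_left mult_ac)
  qed
  then have "fsum (wt hbar (\<lambda>R S. of_real s * a R S + of_real t * b R S)) R S
      \<le> fsum (\<lambda>R S. ennreal s * wt hbar a R S + ennreal t * wt hbar b R S) R S" by (rule fsum_mono)
  then show ?case by (simp add: fsum_add fsum_cmult)
next
  case (Suc m)
  define A where "A = transp_if (odd l) (hc hbar m (l div 2) a)"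
  define B where "B = transp_if (odd l) (hc hbar m (l div 2) b)"
  define C where "C = transp_if (odd l) (hc hbar m (l div 2) (\<lambda>R S. of_real s * a R S + of_real t * b R S))"
  have "C R S \<le> ennreal s * A R S + ennreal t * B R S" for R S
    unfolding A_def B_def C_def transp_if_def by (simp add: Suc)
  then have 1: "binsum C R S \<le> ennreal s * binsum A R S + ennreal t * binsum B R S" for R S
    using binsum_mono[of C "\<lambda>R S. ennreal s * A R S + ennreal t * B R S" R S]
    by (simp add: binsum_add binsum_cmult)
  have "(binsum C R S)\<^sup>2 \<le> ennreal s * (binsum A R S)\<^sup>2 + ennreal t * (binsum B R S)\<^sup>2" for R S
    by (rule order_trans[OF power_mono[OF 1] convex_power2_ennreal[OF st]]) simp
  then have "fsum (\<lambda>R S. (binsum C R S)\<^sup>2) R S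
      \<le> fsum (\<lambda>R S. ennreal s * (binsum A R S)\<^sup>2 + ennreal t * (binsum B R S)\<^sup>2) R S" by (rule fsum_mono)
  then show ?case by (simp add: fsum_add fsum_cmult A_def B_def C_def)
qed

text \<open>The degree starts at 2 and doubles with every square, which is where the root of order
  \<open>2 ^ (m + 1)\<close> in the seminorms comes from.\<close>

lemma hc_scale:
  "hc hbar m l (\<lambda>R S. c * a R S) R S = ennreal (norm c ^ (2 ^ (m + 1))) * hc hbar m l a R S"
proof (induction m arbitrary: l R S)
  case 0
  have "wt hbar (\<lambda>R S. c * a R S) = (\<lambda>R S. ennreal ((norm c)\<^sup>2) * wt hbar a R S)"
    by (intro ext) (simp add: wt_def ennreal_mult'[symmetric] norm_mult power_mult_distrib mult_ac)
  then show ?case by (simp add: fsum_cmult)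
next
  case (Suc m)
  have 1: "transp_if (odd l) (hc hbar m (l div 2) (\<lambda>R S. c * a R S))
      = (\<lambda>R S. ennreal (norm c ^ (2 ^ (m + 1))) * transp_if (odd l) (hc hbar m (l div 2) a) R S)"
    by (intro ext) (simp add: transp_if_def Suc)
  have "(ennreal (norm c ^ 2 ^ (m + 1)))\<^sup>2 = ennreal (norm c ^ 2 ^ (Suc m + 1))"
    by (simp add: ennreal_power power_mult[symmetric] mult.commute)
  then show ?case unfolding hc.simps 1 binsum_cmult power_mult_distrib fsum_cmult by simp
qed

section \<open>Lower semicontinuity\<close>

text \<open>The lower limit is written out because the infima over tails increase with
  \<open>i\<close>, the form in which continuity along increasing suprema applies.\<close>

definition le_liminf :: "('n::finite, ennreal) array \<Rightarrow> (nat \<Rightarrow> ('n, ennreal) array) \<Rightarrow> bool" where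
  "le_liminf A As \<longleftrightarrow> (\<forall>R S. A R S \<le> (SUP i. INF j\<in>{i..}. As j R S))"

text \<open>An abstract Fatou lemma: monotonicity handles the infima over tails, and the supremum of
  these is increasing.\<close>

lemma le_liminf_map:
  assumes le: "le_liminf A As"
    and mono: "\<And>A B R S. (\<And>R S. A R S \<le> B R S) \<Longrightarrow> \<Phi> A R S \<le> \<Phi> B R S"
    and cont: "\<And>As R S. (\<And>R S. incseq (\<lambda>i. As i R S)) \<Longrightarrow>
       \<Phi> (\<lambda>R S. SUP i. As i R S) R S \<le> (SUP i. \<Phi> (As i) R S)"
  shows "le_liminf (\<Phi> A) (\<lambda>i. \<Phi> (As i))"
  unfolding le_liminf_def
proof (intro allI)
  fix R S
  let ?I = "\<lambda>i R S. INF j\<in>{i..}. As j R S"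
  have "\<Phi> A R S \<le> \<Phi> (\<lambda>R S. SUP i. ?I i R S) R S"
    by (rule mono) (use le in \<open>simp add: le_liminf_def\<close>)
  also have "\<dots> \<le> (SUP i. \<Phi> (?I i) R S)"
    by (rule cont) (auto simp: incseq_def intro!: INF_superset_mono)
  also have "\<dots> \<le> (SUP i. INF j\<in>{i..}. \<Phi> (As j) R S)"
    by (intro SUP_mono' INF_greatest mono INF_lower) auto
  finally show "\<Phi> A R S \<le> (SUP i. INF j\<in>{i..}. \<Phi> (As j) R S)" .
qed

lemma binsum_SUP:
  assumes "\<And>R S. incseq (\<lambda>i. As i R S)"
  shows "binsum (\<lambda>R S. SUP i. As i R S) R S = (SUP i. binsum (As i) R S)"
proof -
  have inc: "incseq (\<lambda>i. of_nat a * of_nat b * As i I J)" for a b I J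
    using assms by (auto simp: incseq_def intro!: mult_left_mono)
  show ?thesis
    unfolding binsum_def SUP_mult_left_ennreal
    by (subst ennreal_SUP_sum[symmetric], rule inc, subst ennreal_SUP_sum[symmetric])
      (auto intro!: incseq_sumI2 inc)
qed

lemma fsum_SUP:
  assumes "\<And>R S. incseq (\<lambda>i. As i R S)"
  shows "fsum (\<lambda>R S. SUP i. As i R S) R S = (SUP i. fsum (As i) R S)"
  unfolding fsum_def SUP_mult_left_ennreal
  by (rule infsum_SUP_ennreal) (use assms in \<open>auto simp: incseq_def intro!: mult_left_mono\<close>)

lemma le_liminf_fsum: "le_liminf A As \<Longrightarrow> le_liminf (fsum A) (\<lambda>i. fsum (As i))"
  by (erule le_liminf_map) (auto intro: fsum_mono simp: fsum_SUP)

lemma le_liminf_binsum: "le_liminf A As \<Longrightarrow> le_liminf (binsum A) (\<lambda>i. binsum (As i))"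
  by (erule le_liminf_map) (auto intro: binsum_mono simp: binsum_SUP)

lemma le_liminf_power2: "le_liminf A As \<Longrightarrow> le_liminf (\<lambda>R S. (A R S)\<^sup>2) (\<lambda>i R S. (As i R S)\<^sup>2)"
  by (erule le_liminf_map[where \<Phi> = "\<lambda>A R S. (A R S)\<^sup>2"])
    (auto intro: mult_mono simp: power2_eq_square ennreal_SUP_mult_incseq)

lemma le_liminf_transp_if: "le_liminf A As \<Longrightarrow> le_liminf (transp_if c A) (\<lambda>i. transp_if c (As i))"
  unfolding le_liminf_def transp_if_def by (cases c) auto

text \<open>Convergence enters at level 0 alone; all further steps preserve lower
  semicontinuity.\<close>

lemma le_liminf_hc:
  assumes "\<And>R S. (\<lambda>i. as i R S) \<longlonglongrightarrow> a R S"
  shows "le_liminf (hc hbar m l a) (\<lambda>i. hc hbar m l (as i))"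
proof (induction m arbitrary: l)
  case 0
  have "le_liminf (wt hbar a) (\<lambda>i. wt hbar (as i))"
    unfolding le_liminf_def
  proof (intro allI)
    fix R S
    have "(\<lambda>i. wt hbar (as i) R S) \<longlonglongrightarrow> wt hbar a R S"
      unfolding wt_def by (intro tendsto_ennrealI tendsto_intros assms)
    then have "liminf (\<lambda>i. wt hbar (as i) R S) = wt hbar a R S" by (intro lim_imp_Liminf) auto
    then show "wt hbar a R S \<le> (SUP i. INF j\<in>{i..}. wt hbar (as j) R S)" by (simp add: liminf_SUP_INF)
  qed
  then show ?case by (simp add: le_liminf_fsum)
next
  case (Suc m)
  then show ?case by (simp add: le_liminf_fsum le_liminf_power2 le_liminf_binsum le_liminf_transp_if)
qed

lemma hc_limit_le:
  assumes lim: "\<And>R S. (\<lambda>i. as i R S) \<longlonglongrightarrow> a R S"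
    and bound: "\<And>i. K \<le> i \<Longrightarrow> hc hbar m l (as i) R S \<le> C"
  shows "hc hbar m l a R S \<le> C"
proof -
  have "hc hbar m l a R S \<le> (SUP i. INF j\<in>{i..}. hc hbar m l (as j) R S)"
    using le_liminf_hc[of as a, OF lim, of hbar m l] unfolding le_liminf_def by blast
  also have "\<dots> \<le> C"
  proof (rule SUP_least)
    fix i show "(INF j\<in>{i..}. hc hbar m l (as j) R S) \<le> C"
      by (rule INF_lower2[of "max i K"]) (auto intro: bound)
  qed
  finally show ?thesis .
qed

section \<open>Growth of the coefficients\<close>

text \<open>From \<open>hc hbar 1 1 a 0 0\<close> keep the single outer term \<open>J\<close> and,
  inside it, the single term \<open>N\<close>. The transposition places \<open>J\<close> in the
  first index of the coefficient, so one constant serves all \<open>J\<close> and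
  \<open>N\<close>.\<close>

lemma hc_growth:
  assumes hbar: "0 < hbar" and fin: "hc hbar 1 1 a 0 0 < \<infinity>"
  shows "\<exists>C\<ge>0. \<forall>J N. (2 * hbar) ^ (mabs J + mabs N) * (norm (a J N))\<^sup>2 \<le> C * real (mfact J) * real (mfact N)"
proof -
  define M where "M = enn2real (hc hbar 1 1 a 0 0)"
  have M: "0 \<le> M" "hc hbar 1 1 a 0 0 = ennreal M" using fin by (auto simp: M_def)
  have "(2 * hbar) ^ (mabs J + mabs N) * (norm (a J N))\<^sup>2 \<le> sqrt M * real (mfact J) * real (mfact N)" for J N
  proof -
    let ?jf = "real (mfact J)" and ?nf = "real (mfact N)" and ?w = "(2 * hbar) ^ (mabs J + mabs N) * (norm (a J N))\<^sup>2"
    have pos: "0 < ?jf" "0 < ?nf" using mfact_pos by auto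
    have w: "0 \<le> ?w" using hbar by simp
    have "ennreal (1 / ?nf) * wt hbar a J (N + 0) \<le> fsum (wt hbar a) J 0" by (rule fsum_term_le)
    also have "\<dots> \<le> binsum (transp_if True (fsum (wt hbar a))) 0 J"
      using le_binsum[of "transp_if True (fsum (wt hbar a))" 0 J] by (simp add: transp_if_def)
    finally have "(ennreal (1 / ?nf) * wt hbar a J N)\<^sup>2 \<le> (binsum (transp_if True (fsum (wt hbar a))) 0 J)\<^sup>2"
      by (intro power_mono) auto
    then have "ennreal (1 / ?jf) * (ennreal (1 / ?nf) * wt hbar a J N)\<^sup>2
        \<le> ennreal (1 / ?jf) * (binsum (transp_if True (fsum (wt hbar a))) 0 (J + 0))\<^sup>2"
      by (intro mult_left_mono) auto
    also have "\<dots> \<le> hc hbar 1 1 a 0 0"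
      using fsum_term_le[of J "\<lambda>R S. (binsum (transp_if True (fsum (wt hbar a))) R S)\<^sup>2" 0 0] by simp
    finally have "ennreal (1 / ?jf * (1 / ?nf * ?w)\<^sup>2) \<le> ennreal M"
      using pos w M by (simp add: wt_def ennreal_mult[symmetric] ennreal_power del: times_divide_eq_left times_divide_eq_right)
    then have "1 / ?jf * (1 / ?nf * ?w)\<^sup>2 \<le> M" using M by simp
    then have "?w\<^sup>2 \<le> M * ?jf * ?nf\<^sup>2" using pos by (simp add: field_simps)
    \<comment> \<open>Enlarging J! to its square makes the bound a perfect square, whose root is
      taken next.\<close>
    also have "\<dots> \<le> M * ?jf\<^sup>2 * ?nf\<^sup>2"
    proof -
      have "1 \<le> ?jf" using mfact_pos[of J] by linarith
      then have "?jf * 1 \<le> ?jf * ?jf" using pos by (intro mult_left_mono) auto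
      then show ?thesis using M by (intro mult_right_mono mult_left_mono) (auto simp: power2_eq_square)
    qed
    also have "\<dots> = (sqrt M * ?jf * ?nf)\<^sup>2" using M by (simp add: power_mult_distrib)
    finally show ?thesis by (rule power2_le_imp_le) (use M in auto)
  qed
  then show ?thesis using M by (intro exI[of _ "sqrt M"]) auto
qed

section \<open>Calculus of smooth functions: symmetry of derivatives and the Leibniz rule\<close>

section \<open>Directional derivatives of smooth functions\<close>

definition dird :: "'a::real_normed_vector \<Rightarrow> ('a \<Rightarrow> 'b::real_normed_vector) \<Rightarrow> 'a \<Rightarrow> 'b" where
  "dird v f x = frechet_derivative f (at x) v"

lemma dird_eqI: "(f has_derivative f') (at x) \<Longrightarrow> dird v f x = f' v"
  unfolding dird_def using frechet_derivative_at[of f f' x] by simp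

lemma has_derivative_dird: "f differentiable (at x) \<Longrightarrow> (f has_derivative (\<lambda>v. dird v f x)) (at x)"
  unfolding dird_def by (simp add: frechet_derivative_works)

lemma C_class_Suc_dird:
  "C_class (Suc k) f \<longleftrightarrow> (\<forall>x. f differentiable (at x)) \<and> (\<forall>v. C_class k (dird v f))"
  by (simp add: dird_def[abs_def])

lemma C_class_0_differentiable: "(\<And>x. f differentiable (at x)) \<Longrightarrow> C_class 0 f"
  by (simp add: differentiable_imp_continuous_within continuous_at_imp_continuous_on)

lemma C_class_SucD: "C_class (Suc k) f \<Longrightarrow> C_class k f"
proof (induction k arbitrary: f)
  case 0
  then show ?case by (metis C_class_0_differentiable C_class_Suc_dird)
next
  case (Suc k)
  then show ?case unfolding C_class_Suc_dird[of "Suc k" f] C_class_Suc_dird[of k f] by blast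
qed

lemma smooth_differentiable: "smooth f \<Longrightarrow> f differentiable (at x)"
  unfolding smooth_def using C_class_Suc_dird[of 0 f] by blast

lemma smooth_dird: "smooth f \<Longrightarrow> smooth (dird v f)"
  unfolding smooth_def using C_class_Suc_dird by blast

text \<open>Replaces induction on the order of differentiability: it suffices to name a class of
  differentiable functions closed under directional derivatives.\<close>

lemma smooth_coinduct:
  assumes "P f"
    and "\<And>f x. P f \<Longrightarrow> f differentiable (at x)"
    and "\<And>f v. P f \<Longrightarrow> P (dird v f)"
  shows "smooth f"
proof -
  have "C_class k f" if "P f" for k f
    using that
  proof (induction k arbitrary: f)
    case 0
    then show ?case using assms(2) C_class_0_differentiable by blast
  next
    case (Suc k)
    then show ?case using assms(2,3) C_class_Suc_dird by blast
  qed
  then show ?thesis using assms(1) by (simp add: smooth_def)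
qed

lemma dird_bounded_linear:
  assumes "bounded_linear L" "f differentiable (at x)"
  shows "dird v (\<lambda>x. L (f x)) x = L (dird v f x)"
  by (rule dird_eqI[OF bounded_linear.has_derivative[OF assms(1) has_derivative_dird[OF assms(2)]]])

lemma smooth_bounded_linear:
  assumes L: "bounded_linear L" and f: "smooth f"
  shows "smooth (\<lambda>x. L (f x))"
proof (rule smooth_coinduct[where P = "\<lambda>h. \<exists>f. smooth f \<and> h = (\<lambda>x. L (f x))"])
  show "\<exists>f'. smooth f' \<and> (\<lambda>x. L (f x)) = (\<lambda>x. L (f' x))" using f by blast
next
  fix h :: "'c \<Rightarrow> 'b" and x assume "\<exists>f. smooth f \<and> h = (\<lambda>x. L (f x))"
  then obtain f where f: "smooth f" "h = (\<lambda>x. L (f x))" by blast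
  show "h differentiable (at x)"
    unfolding f differentiable_def
    using bounded_linear.has_derivative[OF L has_derivative_dird[OF smooth_differentiable[OF f(1)]]] by blast
next
  fix h :: "'c \<Rightarrow> 'b" and v assume "\<exists>f. smooth f \<and> h = (\<lambda>x. L (f x))"
  then obtain f where f: "smooth f" "h = (\<lambda>x. L (f x))" by blast
  then have "dird v h = (\<lambda>x. L (dird v f x))"
    by (auto simp: dird_bounded_linear[OF L smooth_differentiable])
  then show "\<exists>f. smooth f \<and> dird v h = (\<lambda>x. L (f x))" using smooth_dird[OF f(1)] by blast
qed

lemma dird_add:
  "f differentiable (at x) \<Longrightarrow> g differentiable (at x) \<Longrightarrow> dird v (\<lambda>x. f x + g x) x = dird v f x + dird v g x"
  by (rule dird_eqI) (intro derivative_intros has_derivative_dird)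

lemma dird_mult:
  fixes f g :: "'a::real_normed_vector \<Rightarrow> 'b::real_normed_algebra"
  shows "f differentiable (at x) \<Longrightarrow> g differentiable (at x) \<Longrightarrow>
    dird v (\<lambda>x. f x * g x) x = f x * dird v g x + dird v f x * g x"
  by (rule dird_eqI) (intro has_derivative_mult has_derivative_dird)

lemma C_class_add: "C_class k f \<Longrightarrow> C_class k g \<Longrightarrow> C_class k (\<lambda>x. f x + g x)"
proof (induction k arbitrary: f g)
  case 0
  then show ?case by (auto intro: continuous_on_add)
next
  case (Suc k)
  then have d: "f differentiable (at x)" "g differentiable (at x)" for x
    unfolding C_class_Suc_dird by blast+
  then have "dird v (\<lambda>x. f x + g x) = (\<lambda>x. dird v f x + dird v g x)" for v by (auto simp: dird_add)
  then show ?case using Suc d unfolding C_class_Suc_dird by auto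
qed

lemma C_class_mult:
  fixes f g :: "'a::real_normed_vector \<Rightarrow> 'b::real_normed_algebra"
  shows "C_class k f \<Longrightarrow> C_class k g \<Longrightarrow> C_class k (\<lambda>x. f x * g x)"
proof (induction k arbitrary: f g)
  case 0
  then show ?case by (auto intro: continuous_on_mult)
next
  case (Suc k)
  then have d: "f differentiable (at x)" "g differentiable (at x)" for x
    unfolding C_class_Suc_dird by blast+
  then have "dird v (\<lambda>x. f x * g x) = (\<lambda>x. f x * dird v g x + dird v f x * g x)" for v by (auto simp: dird_mult)
  moreover have "C_class k (\<lambda>x. f x * dird v g x + dird v f x * g x)" for v
    using Suc.prems[unfolded C_class_Suc_dird] C_class_SucD[OF Suc.prems(1)] C_class_SucD[OF Suc.prems(2)]
    by (intro C_class_add Suc.IH) blast+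
  ultimately show ?case using d unfolding C_class_Suc_dird by auto
qed

lemma smooth_add: "smooth f \<Longrightarrow> smooth g \<Longrightarrow> smooth (\<lambda>x. f x + g x)"
  unfolding smooth_def using C_class_add by blast

lemma smooth_mult:
  fixes f g :: "'a::real_normed_vector \<Rightarrow> 'b::real_normed_algebra"
  shows "smooth f \<Longrightarrow> smooth g \<Longrightarrow> smooth (\<lambda>x. f x * g x)"
  unfolding smooth_def using C_class_mult by blast

lemma dird_const: "dird v (\<lambda>x. c) = (\<lambda>x. 0)"
  by (intro ext dird_eqI[OF has_derivative_const])

lemma smooth_const: "smooth (\<lambda>x. c)"
  by (rule smooth_coinduct[where P = "\<lambda>h. \<exists>c. h = (\<lambda>x. c)"]) (auto simp: dird_const)

lemma smooth_cmult:
  fixes f :: "'a::real_normed_vector \<Rightarrow> 'b::real_normed_algebra"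
  shows "smooth f \<Longrightarrow> smooth (\<lambda>x. c * f x)"
  by (rule smooth_mult[OF smooth_const])

lemma smooth_cnj: "smooth f \<Longrightarrow> smooth (\<lambda>x. cnj (f x))"
  by (rule smooth_bounded_linear[OF bounded_linear_cnj])

lemma smooth_sum: "(\<And>i. i \<in> F \<Longrightarrow> smooth (f i)) \<Longrightarrow> smooth (\<lambda>x. \<Sum>i\<in>F. f i x)"
  by (induction F rule: infinite_finite_induct) (auto intro: smooth_const smooth_add)

text \<open>The second difference is symmetric in \<open>v\<close> and \<open>w\<close>, so this
  estimate and its mirror image yield the symmetry of second derivatives. It rests on the
  differentiability of \<open>dird v f\<close> at \<open>x\<close> and the mean value inequality
  along \<open>v\<close>.\<close>

lemma second_difference_bound:
  fixes f :: "'a::real_normed_vector \<Rightarrow> 'b::real_normed_vector"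
  assumes f: "smooth f" and e: "0 < e"
  shows "\<exists>\<delta>>0. \<forall>h. 0 < h \<and> h < \<delta> \<longrightarrow>
    norm (f (x + h *\<^sub>R v + h *\<^sub>R w) - f (x + h *\<^sub>R v) - f (x + h *\<^sub>R w) + f x - h\<^sup>2 *\<^sub>R dird w (dird v f) x)
      \<le> e * (2 * norm v + norm w) * h\<^sup>2"
proof -
  let ?g = "dird v f"
  have "(?g has_derivative (\<lambda>y. dird y ?g x)) (at x)"
    by (intro has_derivative_dird smooth_differentiable smooth_dird f)
  then obtain d where d: "0 < d" and dg: "\<And>y. norm (y - x) < d \<Longrightarrow> norm (?g y - ?g x - dird (y - x) ?g x) \<le> e * norm (y - x)"
    and lin: "bounded_linear (\<lambda>y. dird y ?g x)"
    using e unfolding has_derivative_at_alt by blast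
  interpret L: bounded_linear "\<lambda>y. dird y ?g x" by (rule lin)
  \<comment> \<open>Keeps all points x + s v + h w and x + s v with 0 \<le> s \<le> h within
    distance \<open>d\<close> of \<open>x\<close>; the summand 1 avoids a zero denominator.\<close>
  define \<delta> where "\<delta> = d / (norm v + norm w + 1)"
  have nn: "0 < norm v + norm w + 1" by (simp add: add_nonneg_pos)
  have \<delta>: "0 < \<delta>" using d nn by (simp add: \<delta>_def)
  have "norm (f (x + h *\<^sub>R v + h *\<^sub>R w) - f (x + h *\<^sub>R v) - f (x + h *\<^sub>R w) + f x - h\<^sup>2 *\<^sub>R dird w ?g x)
      \<le> e * (2 * norm v + norm w) * h\<^sup>2" if h: "0 < h" "h < \<delta>" for h
  proof -
    \<comment> \<open>The difference \<open>\<phi> h - \<phi> 0\<close> is the quantity to bound and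
      \<open>\<psi>\<close> is the derivative of \<open>\<phi>\<close>; subtracting the linear term
      makes \<open>\<psi>\<close> small.\<close>
    define \<phi> where "\<phi> s = f (x + s *\<^sub>R v + h *\<^sub>R w) - f (x + s *\<^sub>R v) - (s * h) *\<^sub>R dird w ?g x" for s
    define \<psi> where "\<psi> s = ?g (x + s *\<^sub>R v + h *\<^sub>R w) - ?g (x + s *\<^sub>R v) - h *\<^sub>R dird w ?g x" for s
    have lin_f: "dird (t *\<^sub>R v) f y = t *\<^sub>R dird v f y" for t y
      using linear_scale[OF has_derivative_linear[OF has_derivative_dird[OF smooth_differentiable[OF f]]], of t v y] by simp
    have deriv: "(\<phi> has_derivative (\<lambda>t. t *\<^sub>R \<psi> s)) (at s within {0..h})" for s
    proof -
      have 1: "((\<lambda>s. f (x + s *\<^sub>R v + h *\<^sub>R w)) has_derivative (\<lambda>t. dird (t *\<^sub>R v) f (x + s *\<^sub>R v + h *\<^sub>R w))) (at s within {0..h})"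
        by (rule has_derivative_compose[OF _ has_derivative_dird[OF smooth_differentiable[OF f]]])
          (auto intro!: derivative_eq_intros)
      have 2: "((\<lambda>s. f (x + s *\<^sub>R v)) has_derivative (\<lambda>t. dird (t *\<^sub>R v) f (x + s *\<^sub>R v))) (at s within {0..h})"
        by (rule has_derivative_compose[OF _ has_derivative_dird[OF smooth_differentiable[OF f]]])
          (auto intro!: derivative_eq_intros)
      have 3: "((\<lambda>s. (s * h) *\<^sub>R dird w ?g x) has_derivative (\<lambda>t. (t * h) *\<^sub>R dird w ?g x)) (at s within {0..h})"
        by (auto intro!: derivative_eq_intros)
      show ?thesis
        unfolding \<phi>_def[abs_def] \<psi>_def
        using has_derivative_diff[OF has_derivative_diff[OF 1 2] 3]
        by (simp add: lin_f scaleR_diff_right)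
    qed
    have bound: "norm (\<psi> s) \<le> e * (2 * norm v + norm w) * h" if s: "s \<in> {0..h}" for s
    proof -
      have hd: "h * (norm v + norm w) < d"
      proof -
        have "h * (norm v + norm w) \<le> h * (norm v + norm w + 1)" using h by simp
        also have "\<dots> < \<delta> * (norm v + norm w + 1)" using h nn by (intro mult_strict_right_mono) auto
        also have "\<dots> = d" using nn by (simp add: \<delta>_def)
        finally show ?thesis .
      qed
      have sv: "norm (s *\<^sub>R v) \<le> h * norm v" using s by (auto intro: mult_right_mono)
      have n1: "norm (s *\<^sub>R v + h *\<^sub>R w) \<le> h * (norm v + norm w)"
        using norm_triangle_ineq[of "s *\<^sub>R v" "h *\<^sub>R w"] sv h by (simp add: distrib_left)
      have hv: "h * norm v \<le> h * (norm v + norm w)" using h by simp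
      have "norm (?g (x + s *\<^sub>R v + h *\<^sub>R w) - ?g x - dird (s *\<^sub>R v + h *\<^sub>R w) ?g x) \<le> e * norm (s *\<^sub>R v + h *\<^sub>R w)"
        using dg[of "x + s *\<^sub>R v + h *\<^sub>R w"] n1 hd by (simp add: add.assoc)
      also have "\<dots> \<le> e * (h * (norm v + norm w))" using n1 e by (intro mult_left_mono) auto
      finally have A: "norm (?g (x + s *\<^sub>R v + h *\<^sub>R w) - ?g x - dird (s *\<^sub>R v + h *\<^sub>R w) ?g x) \<le> e * (h * (norm v + norm w))" .
      have "norm (?g (x + s *\<^sub>R v) - ?g x - dird (s *\<^sub>R v) ?g x) \<le> e * norm (s *\<^sub>R v)"
        using dg[of "x + s *\<^sub>R v"] sv hv hd by (simp del: norm_scaleR)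
      also have "\<dots> \<le> e * (h * norm v)" using sv e by (intro mult_left_mono) auto
      finally have B: "norm (?g (x + s *\<^sub>R v) - ?g x - dird (s *\<^sub>R v) ?g x) \<le> e * (h * norm v)" .
      have "\<psi> s = (?g (x + s *\<^sub>R v + h *\<^sub>R w) - ?g x - dird (s *\<^sub>R v + h *\<^sub>R w) ?g x)
          - (?g (x + s *\<^sub>R v) - ?g x - dird (s *\<^sub>R v) ?g x)"
        by (simp add: \<psi>_def L.add L.scaleR)
      then have "norm (\<psi> s) \<le> e * (h * (norm v + norm w)) + e * (h * norm v)"
        by (simp only:) (rule order_trans[OF norm_triangle_ineq4 add_mono[OF A B]])
      also have "\<dots> = e * (2 * norm v + norm w) * h" by (simp add: algebra_simps)
      finally show ?thesis .
    qed
    have "norm (\<phi> h - \<phi> 0) \<le> e * (2 * norm v + norm w) * h * norm (h - 0)"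
    proof (rule differentiable_bound[of "{0..h}" \<phi> "\<lambda>s t. t *\<^sub>R \<psi> s"])
      fix s assume s: "s \<in> {0..h}"
      show "onorm (\<lambda>t. t *\<^sub>R \<psi> s) \<le> e * (2 * norm v + norm w) * h"
      proof (rule onorm_le)
        fix t :: real
        show "norm (t *\<^sub>R \<psi> s) \<le> e * (2 * norm v + norm w) * h * norm t"
          using mult_right_mono[OF bound[OF s], of "norm t"] by (simp add: mult.commute)
      qed
    qed (use h deriv in auto)
    moreover have "\<phi> h - \<phi> 0 = f (x + h *\<^sub>R v + h *\<^sub>R w) - f (x + h *\<^sub>R v) - f (x + h *\<^sub>R w) + f x - h\<^sup>2 *\<^sub>R dird w ?g x"
      by (simp add: \<phi>_def power2_eq_square)
    ultimately show ?thesis using h by (simp add: power2_eq_square mult.assoc)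
  qed
  then show ?thesis using \<delta> by blast
qed

lemma dird_commute:
  fixes f :: "'a::real_normed_vector \<Rightarrow> 'b::real_normed_vector"
  assumes f: "smooth f"
  shows "dird v (dird w f) = dird w (dird v f)"
proof
  fix x
  \<comment> \<open>The sum of the error constants \<open>2 * norm v + norm w\<close> and
    \<open>2 * norm w + norm v\<close>.\<close>
  define C where "C = 3 * (norm v + norm w)"
  have "norm (dird v (dird w f) x - dird w (dird v f) x) \<le> 0 + e" if e: "0 < e" for e
  proof -
    define e' where "e' = e / (C + 1)"
    have C: "0 \<le> C" by (simp add: C_def)
    have e': "0 < e'" using e C by (simp add: e'_def)
    let ?\<Delta> = "\<lambda>h. f (x + h *\<^sub>R v + h *\<^sub>R w) - f (x + h *\<^sub>R v) - f (x + h *\<^sub>R w) + f x"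
    obtain \<delta>1 where \<delta>1: "0 < \<delta>1" "\<And>h. 0 < h \<Longrightarrow> h < \<delta>1 \<Longrightarrow> norm (?\<Delta> h - h\<^sup>2 *\<^sub>R dird w (dird v f) x) \<le> e' * (2 * norm v + norm w) * h\<^sup>2"
      using second_difference_bound[OF f e', of x v w] by blast
    obtain \<delta>2 where \<delta>2: "0 < \<delta>2" "\<And>h. 0 < h \<Longrightarrow> h < \<delta>2 \<Longrightarrow> norm (f (x + h *\<^sub>R w + h *\<^sub>R v) - f (x + h *\<^sub>R w) - f (x + h *\<^sub>R v) + f x - h\<^sup>2 *\<^sub>R dird v (dird w f) x) \<le> e' * (2 * norm w + norm v) * h\<^sup>2"
      using second_difference_bound[OF f e', of x w v] by blast
    define h where "h = min \<delta>1 \<delta>2 / 2"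
    have h: "0 < h" "h < \<delta>1" "h < \<delta>2" using \<delta>1(1) \<delta>2(1) by (auto simp: h_def)
    have \<Delta>2: "f (x + h *\<^sub>R w + h *\<^sub>R v) - f (x + h *\<^sub>R w) - f (x + h *\<^sub>R v) + f x = ?\<Delta> h"
      by (simp add: algebra_simps)
    have "h\<^sup>2 * norm (dird v (dird w f) x - dird w (dird v f) x)
       = norm ((?\<Delta> h - h\<^sup>2 *\<^sub>R dird w (dird v f) x) - (?\<Delta> h - h\<^sup>2 *\<^sub>R dird v (dird w f) x))"
      by (simp add: scaleR_diff_right[symmetric])
    also have "\<dots> \<le> e' * (2 * norm v + norm w) * h\<^sup>2 + e' * (2 * norm w + norm v) * h\<^sup>2"
      by (rule order_trans[OF norm_triangle_ineq4 add_mono[OF \<delta>1(2)[OF h(1,2)] \<delta>2(2)[OF h(1,3), unfolded \<Delta>2]]])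
    also have "\<dots> = h\<^sup>2 * (e' * C)" by (simp add: C_def algebra_simps)
    finally have "norm (dird v (dird w f) x - dird w (dird v f) x) \<le> e' * C" using h by simp
    also have "\<dots> \<le> e" using e C by (simp add: e'_def field_simps)
    finally show ?thesis by simp
  qed
  then have "norm (dird v (dird w f) x - dird w (dird v f) x) \<le> 0" by (rule field_le_epsilon)
  then show "dird v (dird w f) x = dird w (dird v f) x" by simp
qed

section \<open>Wirtinger derivatives\<close>

lemma dz_dird: "dz k f = (\<lambda>x. (1/2) * (dird (axis k 1) f x + (- \<i>) * dird (axis k \<i>) f x))"
  by (auto simp: dz_def dird_def)

lemma dzbar_dird: "dzbar k f = (\<lambda>x. (1/2) * (dird (axis k 1) f x + \<i> * dird (axis k \<i>) f x))"
  by (auto simp: dzbar_def dird_def)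

text \<open>\<open>dz k\<close> and \<open>dzbar k\<close> differ only in \<open>c\<close>, which is
  \<open>- \<i>\<close> or \<open>\<i>\<close>; commutation and product rules are proved once for
  both.\<close>

definition cdird :: "'a::real_normed_vector \<Rightarrow> complex \<Rightarrow> 'a \<Rightarrow> ('a \<Rightarrow> complex) \<Rightarrow> 'a \<Rightarrow> complex" where
  "cdird v c w f = (\<lambda>x. (1/2) * (dird v f x + c * dird w f x))"

lemma dz_eq_cdird: "dz k = cdird (axis k 1) (- \<i>) (axis k \<i>)"
  by (intro ext) (simp add: dz_dird cdird_def)

lemma dzbar_eq_cdird: "dzbar k = cdird (axis k 1) \<i> (axis k \<i>)"
  by (intro ext) (simp add: dzbar_dird cdird_def)

lemma smooth_cdird: "smooth f \<Longrightarrow> smooth (cdird v c w f)"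
  unfolding cdird_def by (intro smooth_cmult smooth_add smooth_dird)

lemma dird_cmult:
  fixes f :: "'a::real_normed_vector \<Rightarrow> complex"
  shows "f differentiable (at x) \<Longrightarrow> dird v (\<lambda>x. c * f x) x = c * dird v f x"
  by (rule dird_bounded_linear[OF bounded_linear_mult_right])

lemma dird_cdird: "smooth f \<Longrightarrow> dird u (cdird v c w f) = cdird v c w (dird u f)"
  by (intro ext, unfold cdird_def)
    (simp only: dird_cmult dird_add dird_commute[of f u] smooth_differentiable smooth_dird smooth_add smooth_cmult)

lemma cdird_commute: "smooth f \<Longrightarrow> cdird v c w (cdird v' c' w' f) = cdird v' c' w' (cdird v c w f)"
  unfolding cdird_def[of v c w "cdird v' c' w' f"] cdird_def[of v' c' w' "cdird v c w f"]
  by (simp add: dird_cdird, simp add: cdird_def dird_commute[of f v v'] dird_commute[of f v w']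
      dird_commute[of f w v'] dird_commute[of f w w'] algebra_simps)

lemma cdird_add:
  "smooth f \<Longrightarrow> smooth g \<Longrightarrow> cdird v c w (\<lambda>x. f x + g x) = (\<lambda>x. cdird v c w f x + cdird v c w g x)"
  by (intro ext) (simp add: cdird_def dird_add smooth_differentiable algebra_simps)

lemma cdird_cmult: "smooth f \<Longrightarrow> cdird v c w (\<lambda>x. b * f x) = (\<lambda>x. b * cdird v c w f x)"
  by (intro ext) (simp add: cdird_def dird_cmult smooth_differentiable algebra_simps)

lemma cdird_mult:
  "smooth f \<Longrightarrow> smooth g \<Longrightarrow> cdird v c w (\<lambda>x. f x * g x) = (\<lambda>x. f x * cdird v c w g x + cdird v c w f x * g x)"
  by (intro ext) (simp add: cdird_def dird_mult smooth_differentiable algebra_simps)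

text \<open>Conjugating \<open>c\<close> exchanges \<open>dz\<close> and
  \<open>dzbar\<close>.\<close>

lemma cdird_cnj:
  assumes "smooth f"
  shows "cdird v c w (\<lambda>x. cnj (f x)) = (\<lambda>x. cnj (cdird v (cnj c) w f x))"
  by (intro ext) (simp add: cdird_def dird_bounded_linear[OF bounded_linear_cnj smooth_differentiable[OF assms]])

section \<open>Iterated derivations\<close>

definition mder :: "('n::finite \<Rightarrow> 'f \<Rightarrow> 'f) \<Rightarrow> nat^'n \<Rightarrow> 'f \<Rightarrow> 'f" where
  "mder d R = foldr (\<lambda>k. d k ^^ (R $ k)) coords"

lemma wderiv_eq_mder: "wderiv R S f = mder dz R (mder dzbar S f)"
  by (simp add: wderiv_def mder_def)

lemma mder_0 [simp]:
  fixes d :: "'n::finite \<Rightarrow> 'f \<Rightarrow> 'f"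
  shows "mder d 0 f = f"
proof -
  have "foldr (\<lambda>k. d k ^^ ((0 :: nat^'n) $ k)) ks f = f" for ks by (induction ks) auto
  then show ?thesis by (simp add: mder_def)
qed

definition unit_index :: "'n::finite \<Rightarrow> nat^'n" where
  "unit_index k = axis k 1"

lemma unit_index_nth [simp]: "unit_index k $ j = (if j = k then 1 else 0)"
  by (simp add: unit_index_def axis_def)

text \<open>Induction on the total order; it matches iterated derivatives, which gain one derivative
  at a time.\<close>

lemma multiindex_induct [case_names zero add_unit]:
  fixes R :: "nat^'n::finite"
  assumes "P 0" and "\<And>R k. P R \<Longrightarrow> P (R + unit_index k)"
  shows "P R"
proof (induction "mabs R" arbitrary: R)
  case 0
  then have "R = 0" by (simp add: mabs_def vec_eq_iff)
  then show ?case using assms(1) by simp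
next
  case (Suc m)
  then obtain k where k: "0 < R $ k" unfolding mabs_def by (metis gr0I sum.neutral nat.distinct(1))
  define R' where "R' = R - unit_index k"
  have R: "R = R' + unit_index k" using k by (auto simp: R'_def vec_eq_iff)
  have "mabs (unit_index k :: nat^'n) = 1" by (simp add: mabs_def)
  then have "m = mabs R'" using Suc(2) by (simp add: R)
  then show ?case using assms(2) Suc(1) R by blast
qed

text \<open>Pascal's rule in coordinate \<open>k\<close>; in the other coordinates the factors of
  \<open>mbinom\<close> are unchanged.\<close>

lemma sum_mbinom_Pascal:
  fixes \<phi> :: "nat^'n::finite \<Rightarrow> 'a::comm_semiring_1"
  shows "(\<Sum>I\<le>R + unit_index k. of_nat (mbinom (R + unit_index k) I) * \<phi> I)
      = (\<Sum>I\<le>R. of_nat (mbinom R I) * (\<phi> (I + unit_index k) + \<phi> I))"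
proof -
  let ?e = "unit_index k :: nat^'n"
  let ?U = "{..R + ?e}"
  have fin: "finite ?U" by (rule finite_atMost_multiindex)
  \<comment> \<open>For \<open>I $ k = 0\<close> truncated subtraction would return \<open>I\<close>
    itself, so this case is separated.\<close>
  have split: "mbinom (R + ?e) I = (if 0 < I $ k then mbinom R (I - ?e) else 0) + mbinom R I" for I
  proof -
    have prod_k: "prod g UNIV = g k * prod g (UNIV - {k})" for g :: "'n \<Rightarrow> nat"
      by (rule prod.remove) auto
    have rest: "(\<Prod>j\<in>UNIV - {k}. (R + ?e) $ j choose I $ j) = (\<Prod>j\<in>UNIV - {k}. R $ j choose I $ j)"
      "(\<Prod>j\<in>UNIV - {k}. R $ j choose (I - ?e) $ j) = (\<Prod>j\<in>UNIV - {k}. R $ j choose I $ j)"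
      by (auto intro!: prod.cong)
    show ?thesis
      unfolding mbinom_def prod_k rest
      by (cases "I $ k") (auto simp: algebra_simps)
  qed
  have "(\<Sum>I\<in>?U. of_nat (mbinom (R + ?e) I) * \<phi> I)
     = (\<Sum>I\<in>?U. if 0 < I $ k then of_nat (mbinom R (I - ?e)) * \<phi> I else 0) + (\<Sum>I\<in>?U. of_nat (mbinom R I) * \<phi> I)"
    unfolding split sum.distrib[symmetric] by (intro sum.cong) (auto simp: distrib_right)
  also have "(\<Sum>I\<in>?U. if 0 < I $ k then of_nat (mbinom R (I - ?e)) * \<phi> I else 0)
     = (\<Sum>I\<in>{I \<in> ?U. 0 < I $ k}. of_nat (mbinom R (I - ?e)) * \<phi> I)"
    by (rule sum.inter_filter[OF fin, symmetric])
  also have "\<dots> = (\<Sum>I\<le>R. of_nat (mbinom R I) * \<phi> (I + ?e))"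
  proof (rule sum.reindex_bij_witness[of _ "\<lambda>I. I + ?e" "\<lambda>I. I - ?e"], goal_cases)
    case (2 I)
    have "(I - ?e) $ j \<le> R $ j" for j
    proof -
      have "I $ j \<le> (R + ?e) $ j" using 2 by (simp add: less_eq_vec_def)
      then show ?thesis by (auto split: if_splits)
    qed
    then show ?case by (simp add: less_eq_vec_def)
  next
    case (5 I)
    then have "I - ?e + ?e = I" by (auto simp: vec_eq_iff)
    then show ?case by simp
  qed (auto simp: vec_eq_iff less_eq_vec_def)
  \<comment> \<open>Outside the smaller box some coordinate of \<open>I\<close> exceeds that of
    \<open>R\<close>, so the coefficient vanishes.\<close>
  also have "(\<Sum>I\<in>?U. of_nat (mbinom R I) * \<phi> I) = (\<Sum>I\<le>R. of_nat (mbinom R I) * \<phi> I)"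
  proof (rule sum.mono_neutral_right[OF fin])
    show "{..R} \<subseteq> ?U" by (auto simp: less_eq_vec_def intro: trans_le_add1)
    show "\<forall>I\<in>?U - {..R}. of_nat (mbinom R I) * \<phi> I = 0"
    proof
      fix I assume "I \<in> ?U - {..R}"
      then obtain j where "R $ j < I $ j" by (auto simp: less_eq_vec_def not_le)
      then have "mbinom R I = 0" unfolding mbinom_def by (intro prod_zero) auto
      then show "of_nat (mbinom R I) * \<phi> I = 0" by simp
    qed
  qed
  finally show ?thesis by (simp add: distrib_left sum.distrib)
qed

text \<open>The properties shared by \<open>dz\<close> and \<open>dzbar\<close> on smooth functions.
  Commutation is what removes the effect of the order fixed by \<open>coords\<close>.\<close>

locale commuting_derivations =
  fixes d :: "'n::finite \<Rightarrow> ('a::real_normed_vector \<Rightarrow> complex) \<Rightarrow> 'a \<Rightarrow> complex"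
  assumes smooth_d: "smooth f \<Longrightarrow> smooth (d k f)"
    and d_add: "smooth f \<Longrightarrow> smooth g \<Longrightarrow> d k (\<lambda>x. f x + g x) = (\<lambda>x. d k f x + d k g x)"
    and d_cmult: "smooth f \<Longrightarrow> d k (\<lambda>x. b * f x) = (\<lambda>x. b * d k f x)"
    and d_mult: "smooth f \<Longrightarrow> smooth g \<Longrightarrow> d k (\<lambda>x. f x * g x) = (\<lambda>x. f x * d k g x + d k f x * g x)"
    and d_commute: "smooth f \<Longrightarrow> d j (d k f) = d k (d j f)"
begin

lemma smooth_funpow: "smooth f \<Longrightarrow> smooth ((d k ^^ n) f)"
  by (induction n) (auto intro: smooth_d)

lemma funpow_intertwine:
  assumes "\<And>f. smooth f \<Longrightarrow> \<Theta> (d k f) = \<delta> (\<Theta> f)"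
  shows "smooth f \<Longrightarrow> \<Theta> ((d k ^^ n) f) = (\<delta> ^^ n) (\<Theta> f)"
  by (induction n) (auto simp: assms smooth_funpow)

lemma smooth_foldr: "smooth f \<Longrightarrow> smooth (foldr (\<lambda>k. d k ^^ (R $ k)) ks f)"
  by (induction ks) (auto intro: smooth_funpow)

lemma foldr_intertwine:
  assumes "\<And>f k. smooth f \<Longrightarrow> \<Theta> (d k f) = \<delta> k (\<Theta> f)" and "smooth f"
  shows "\<Theta> (foldr (\<lambda>k. d k ^^ (R $ k)) ks f) = foldr (\<lambda>k. \<delta> k ^^ (R $ k)) ks (\<Theta> f)"
proof (induction ks)
  case (Cons k ks)
  then show ?case using funpow_intertwine[of \<Theta> k "\<delta> k"] assms smooth_foldr by simp
qed simp

lemma smooth_mder: "smooth f \<Longrightarrow> smooth (mder d R f)"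
  unfolding mder_def by (rule smooth_foldr)

text \<open>\<open>\<Theta>\<close> is either an operator commuting with all \<open>d k\<close>,
  with \<open>\<delta> = d\<close>, or complex conjugation, which turns \<open>dz\<close> into
  \<open>dzbar\<close> and conversely.\<close>

lemma mder_intertwine:
  assumes "\<And>f k. smooth f \<Longrightarrow> \<Theta> (d k f) = \<delta> k (\<Theta> f)" and "smooth f"
  shows "\<Theta> (mder d R f) = mder \<delta> R (\<Theta> f)"
  unfolding mder_def by (rule foldr_intertwine[where \<Theta> = \<Theta> and \<delta> = \<delta>, OF assms])

lemma mder_d: "smooth f \<Longrightarrow> mder d R (d k f) = d k (mder d R f)"
  using mder_intertwine[of "d k" d f R] d_commute by metis

text \<open>In a list without repetitions the coordinate \<open>k\<close> occurs at most once; from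
  there the additional \<open>d k\<close> is commuted to the front.\<close>

lemma mder_add_unit: 
  assumes f: "smooth f"
  shows "mder d (R + unit_index k) f = d k (mder d R f)"
proof -
  have "distinct ks \<Longrightarrow> foldr (\<lambda>j. d j ^^ ((R + unit_index k) $ j)) ks f
      = (if k \<in> set ks then d k else id) (foldr (\<lambda>j. d j ^^ (R $ j)) ks f)" for ks
  proof (induction ks)
    case (Cons j ks)
    show ?case
    proof (cases "j = k")
      case True
      then show ?thesis using Cons by simp
    next
      case False
      have "(d j ^^ n) (d k g) = d k ((d j ^^ n) g)" if "smooth g" for n g
        using funpow_intertwine[of "d k" j "d j" g n] d_commute that by metis
      then show ?thesis using Cons False smooth_foldr[OF f] by auto
    qed
  qed simp
  from this[OF coords(1)] show ?thesis by (simp add: mder_def coords(2))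
qed

lemma d_sum:
  assumes "finite F" "\<And>i. i \<in> F \<Longrightarrow> smooth (f i)"
  shows "d k (\<lambda>x. \<Sum>i\<in>F. f i x) = (\<lambda>x. \<Sum>i\<in>F. d k (f i) x)"
  using assms
proof (induction F rule: finite_induct)
  case empty
  then show ?case using d_cmult[OF smooth_const[of 0], of k 0] by simp
next
  case (insert i F)
  then show ?case by (simp add: d_add smooth_sum)
qed

lemma mder_add: "smooth f \<Longrightarrow> smooth g \<Longrightarrow> mder d R (\<lambda>x. f x + g x) = (\<lambda>x. mder d R f x + mder d R g x)"
  by (induction R rule: multiindex_induct) (simp_all add: mder_add_unit smooth_add d_add smooth_mder)

lemma mder_cmult: "smooth f \<Longrightarrow> mder d R (\<lambda>x. b * f x) = (\<lambda>x. b * mder d R f x)"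
  by (induction R rule: multiindex_induct) (simp_all add: mder_add_unit smooth_cmult d_cmult smooth_mder)

lemma mder_sum:
  assumes "finite F" "\<And>i. i \<in> F \<Longrightarrow> smooth (f i)"
  shows "mder d R (\<lambda>x. \<Sum>i\<in>F. f i x) = (\<lambda>x. \<Sum>i\<in>F. mder d R (f i) x)"
  by (induction R rule: multiindex_induct) (simp_all add: mder_add_unit smooth_sum assms d_sum smooth_mder)

lemma mder_mult:
  assumes f: "smooth f" and g: "smooth g"
  shows "mder d R (\<lambda>x. f x * g x) = (\<lambda>x. \<Sum>I\<le>R. of_nat (mbinom R I) * (mder d I f x * mder d (R - I) g x))"
proof (induction R rule: multiindex_induct)
  case zero
  have "{..0 :: nat^'n} = {0}" by (auto simp: less_eq_vec_def vec_eq_iff)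
  then show ?case by simp
next
  case (add_unit R k)
  let ?e = "unit_index k :: nat^'n"
  have sm: "smooth (\<lambda>x. mder d I f x * mder d (R - I) g x)" for I
    by (intro smooth_mult smooth_mder f g)
  have "mder d (R + ?e) (\<lambda>x. f x * g x)
      = (\<lambda>x. \<Sum>I\<le>R. of_nat (mbinom R I) * d k (\<lambda>x. mder d I f x * mder d (R - I) g x) x)"
    by (simp add: mder_add_unit smooth_mult f g add_unit d_sum finite_atMost_multiindex smooth_cmult sm d_cmult)
  also have "\<dots> = (\<lambda>x. \<Sum>I\<le>R. of_nat (mbinom R I) *
      (mder d (I + ?e) f x * mder d (R - I) g x + mder d I f x * mder d (R + ?e - I) g x))"
  proof (intro ext sum.cong refl arg_cong2[where f = "(*)"])
    fix x I assume "I \<in> {..R}"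
    then have "R + ?e - I = (R - I) + ?e" by (auto simp: vec_eq_iff less_eq_vec_def)
    then show "d k (\<lambda>x. mder d I f x * mder d (R - I) g x) x =
      mder d (I + ?e) f x * mder d (R - I) g x + mder d I f x * mder d (R + ?e - I) g x"
      by (simp add: d_mult smooth_mder f g mder_add_unit)
  qed
  also have "\<dots> = (\<lambda>x. \<Sum>I\<le>R + ?e. of_nat (mbinom (R + ?e) I) * (mder d I f x * mder d (R + ?e - I) g x))"
    by (simp add: sum_mbinom_Pascal add.commute)
  finally show ?case .
qed

end

interpretation dz: commuting_derivations dz
  by unfold_locales (simp_all add: dz_eq_cdird smooth_cdird cdird_add cdird_cmult cdird_mult cdird_commute)

interpretation dzbar: commuting_derivations dzbar
  by unfold_locales (simp_all add: dzbar_eq_cdird smooth_cdird cdird_add cdird_cmult cdird_mult cdird_commute)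

lemma dz_dzbar_commute: "smooth f \<Longrightarrow> dz j (dzbar k f) = dzbar k (dz j f)"
  by (simp add: dz_eq_cdird dzbar_eq_cdird cdird_commute)

lemma wderiv_add: "smooth f \<Longrightarrow> smooth g \<Longrightarrow> wderiv R S (\<lambda>x. f x + g x) = (\<lambda>x. wderiv R S f x + wderiv R S g x)"
  by (simp add: wderiv_eq_mder dz.mder_add dzbar.mder_add dzbar.smooth_mder)

lemma wderiv_cmult: "smooth f \<Longrightarrow> wderiv R S (\<lambda>x. c * f x) = (\<lambda>x. c * wderiv R S f x)"
  by (simp add: wderiv_eq_mder dz.mder_cmult dzbar.mder_cmult dzbar.smooth_mder)

lemma mder_dzbar_dz: "smooth f \<Longrightarrow> mder dzbar S (dz k f) = dz k (mder dzbar S f)"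
  using dzbar.mder_intertwine[of "dz k" dzbar f S] dz_dzbar_commute by metis

lemma mder_dz_mder_dzbar: "smooth f \<Longrightarrow> mder dz R (mder dzbar S f) = mder dzbar S (mder dz R f)"
  using dz.mder_intertwine[of "mder dzbar S" dz f R] mder_dzbar_dz by metis

lemma wderiv_dz: "smooth f \<Longrightarrow> wderiv R S (dz k f) = wderiv (R + unit_index k) S f"
  by (simp add: wderiv_eq_mder mder_dzbar_dz dz.mder_d dz.mder_add_unit dzbar.smooth_mder)

lemma wderiv_dzbar: "smooth f \<Longrightarrow> wderiv R S (dzbar k f) = wderiv R (S + unit_index k) f"
  by (simp add: wderiv_eq_mder dzbar.mder_d dzbar.mder_add_unit)

lemma wderiv_mult:
  assumes f: "smooth f" and g: "smooth g"
  shows "wderiv R S (\<lambda>x. f x * g x) x =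
    (\<Sum>I\<le>R. \<Sum>J\<le>S. of_nat (mbinom R I) * of_nat (mbinom S J) * (wderiv I J f x * wderiv (R - I) (S - J) g x))"
proof -
  have sm: "smooth (mder dzbar J f)" "smooth (mder dzbar J g)" for J
    using dzbar.smooth_mder f g by auto
  have "wderiv R S (\<lambda>x. f x * g x) x = (\<Sum>J\<le>S. of_nat (mbinom S J) *
      (\<Sum>I\<le>R. of_nat (mbinom R I) * (wderiv I J f x * wderiv (R - I) (S - J) g x)))"
    by (simp add: wderiv_eq_mder dzbar.mder_mult f g dz.mder_sum finite_atMost_multiindex
        smooth_cmult smooth_mult sm dz.mder_cmult dz.mder_mult)
  also have "\<dots> = (\<Sum>I\<le>R. \<Sum>J\<le>S. of_nat (mbinom R I) * of_nat (mbinom S J) * (wderiv I J f x * wderiv (R - I) (S - J) g x))"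
    unfolding sum_distrib_left by (subst sum.swap) (simp add: mult_ac)
  finally show ?thesis .
qed

lemma wderiv_cnj:
  assumes f: "smooth f"
  shows "wderiv R S (\<lambda>x. cnj (f x)) x = cnj (wderiv S R f x)"
proof -
  let ?\<Theta> = "\<lambda>f :: complex^'a \<Rightarrow> complex. \<lambda>x. cnj (f x)"
  have 1: "?\<Theta> (dz k f) = dzbar k (?\<Theta> f)" "?\<Theta> (dzbar k f) = dz k (?\<Theta> f)" if "smooth f" for k f
    by (simp_all add: dz_eq_cdird dzbar_eq_cdird cdird_cnj that)
  have "mder dzbar S (?\<Theta> f) = ?\<Theta> (mder dz S f)"
    using dz.mder_intertwine[of ?\<Theta> dzbar f S] 1 f by simp
  then have "wderiv R S (?\<Theta> f) = mder dz R (?\<Theta> (mder dz S f))" by (simp add: wderiv_eq_mder)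
  also have "\<dots> = ?\<Theta> (mder dzbar R (mder dz S f))"
    using dzbar.mder_intertwine[of ?\<Theta> dz "mder dz S f" R] 1 dz.smooth_mder[OF f] by simp
  also have "\<dots> = ?\<Theta> (wderiv S R f)" by (simp add: wderiv_eq_mder mder_dz_mder_dzbar f)
  finally show ?thesis by simp
qed

section \<open>Realising arrays as jets of entire series\<close>

section \<open>Everywhere convergent power series in \<open>z\<close> and its conjugate\<close>

text \<open>The summable bound makes the derivative series converge uniformly on \<open>S\<close>.
  Termwise differentiation then yields the derivative of some limit function \<open>G\<close>, which
  agrees with \<open>g\<close> on \<open>S\<close> by uniqueness of sums.\<close>

lemma has_derivative_suminf_M_test:
  fixes f :: "nat \<Rightarrow> 'a::real_normed_vector \<Rightarrow> 'b::banach"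
  assumes S: "convex S" and x: "x \<in> S"
    and deriv: "\<And>n x. x \<in> S \<Longrightarrow> (f n has_derivative f' n x) (at x within S)"
    and bound: "\<And>n x h. x \<in> S \<Longrightarrow> norm (f' n x h) \<le> M n * norm h" and M: "summable M"
    and g': "\<And>x h. x \<in> S \<Longrightarrow> (\<lambda>n. f' n x h) sums g' x h"
    and g: "\<And>x. x \<in> S \<Longrightarrow> (\<lambda>n. f n x) sums g x"
  shows "(g has_derivative g' x) (at x within S)"
proof -
  have "\<forall>\<^sub>F n in sequentially. \<forall>x\<in>S. \<forall>h. norm (sum (\<lambda>i. f' i x h) {..<n} - g' x h) \<le> e * norm h"
    if e: "0 < e" for e
  proof -
    have "(\<lambda>n. suminf M - sum M {..<n}) \<longlonglongrightarrow> suminf M - suminf M"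
      by (intro tendsto_intros summable_LIMSEQ M)
    then have "\<forall>\<^sub>F n in sequentially. suminf M - sum M {..<n} < e"
      using e by (intro order_tendstoD(2)[where a = e]) auto
    then show ?thesis
    proof (rule eventually_mono, intro ballI allI)
      fix n x and h :: 'a assume n: "suminf M - sum M {..<n} < e" and x: "x \<in> S"
      have Mh: "summable (\<lambda>i. M i * norm h)" using M by (rule summable_mult2)
      have s: "(\<lambda>i. f' i x h) sums g' x h" by (rule g'[OF x])
      have "g' x h - sum (\<lambda>i. f' i x h) {..<n} = (\<Sum>i. f' (i + n) x h)"
        using suminf_minus_initial_segment[OF sums_summable[OF s], of n] sums_unique[OF s] by simp
      then have "norm (sum (\<lambda>i. f' i x h) {..<n} - g' x h) = norm (\<Sum>i. f' (i + n) x h)"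
        by (simp add: norm_minus_commute)
      also have "\<dots> \<le> (\<Sum>i. M (i + n) * norm h)"
        by (rule norm_suminf_le[OF bound[OF x]]) (use summable_ignore_initial_segment[OF Mh, of n] in simp)
      also have "\<dots> = (suminf M - sum M {..<n}) * norm h"
        using suminf_mult2[OF summable_ignore_initial_segment[OF M], of n "norm h"]
          suminf_minus_initial_segment[OF M, of n] by simp
      also have "\<dots> \<le> e * norm h" using n by (intro mult_right_mono) auto
      finally show "norm (sum (\<lambda>i. f' i x h) {..<n} - g' x h) \<le> e * norm h" .
    qed
  qed
  from has_derivative_series[OF S deriv this x g[OF x]]
  obtain G where G: "\<And>x. x \<in> S \<Longrightarrow> (\<lambda>n. f n x) sums G x \<and> (G has_derivative g' x) (at x within S)"
    by blast
  have "g y = G y" if "y \<in> S" for y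
    using sums_unique2[OF g[OF that] conjunct1[OF G[OF that]]] .
  then show ?thesis by (rule has_derivative_transform[OF x _ conjunct2[OF G[OF x]]])
qed

lemma has_sum_sum_family:
  fixes f :: "'k \<Rightarrow> 'i \<Rightarrow> 'b::topological_comm_monoid_add"
  assumes "\<And>k. k \<in> F \<Longrightarrow> (f k has_sum s k) A"
  shows "((\<lambda>i. \<Sum>k\<in>F. f k i) has_sum (\<Sum>k\<in>F. s k)) A"
  using assms by (induction F rule: infinite_finite_induct) (auto intro: has_sum_add)

definition cmonom :: "nat^'n::finite \<Rightarrow> nat^'n \<Rightarrow> complex^'n \<Rightarrow> complex" where
  "cmonom R S z = (\<Prod>k\<in>UNIV. (z $ k) ^ (R $ k) * cnj (z $ k) ^ (S $ k))"

lemma norm_cmonom_le: "norm (cmonom R S z) \<le> norm z ^ (mabs R + mabs S)"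
proof -
  have "norm (cmonom R S z) = (\<Prod>k\<in>UNIV. norm (z $ k) ^ (R $ k + S $ k))"
    by (simp add: cmonom_def prod_norm[symmetric] norm_mult norm_power power_add)
  also have "\<dots> \<le> (\<Prod>k\<in>UNIV. norm z ^ (R $ k + S $ k))"
    by (intro prod_mono conjI power_mono) (auto simp: Finite_Cartesian_Product.norm_nth_le)
  also have "\<dots> = norm z ^ (mabs R + mabs S)"
    by (simp add: power_add power_mabs prod.distrib)
  finally show ?thesis .
qed

text \<open>Where an exponent is 0, truncated subtraction leaves the monomial unchanged, but then
  the factor \<open>of_nat (R $ k)\<close> or \<open>of_nat (S $ k)\<close> vanishes.\<close>

lemma has_derivative_cmonom:
  "((\<lambda>z. cmonom R S (z - p)) has_derivative
     (\<lambda>h. \<Sum>k\<in>UNIV. h $ k * (of_nat (R $ k) * cmonom (R - unit_index k) S (x - p))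
         + cnj (h $ k) * (of_nat (S $ k) * cmonom R (S - unit_index k) (x - p)))) (at x within A)"
proof -
  let ?f = "\<lambda>k z. ((z - p) $ k) ^ (R $ k) * cnj ((z - p) $ k) ^ (S $ k)"
  let ?f' = "\<lambda>k h. ((x - p) $ k) ^ (R $ k) * (of_nat (S $ k) * (cnj (h $ k) * cnj ((x - p) $ k) ^ (S $ k - 1)))
        + of_nat (R $ k) * (h $ k * ((x - p) $ k) ^ (R $ k - 1)) * cnj ((x - p) $ k) ^ (S $ k)"
  have comp: "((\<lambda>z. (z - p) $ k) has_derivative (\<lambda>h. h $ k)) (at x within A)" for k
    by (auto intro!: derivative_eq_intros bounded_linear.has_derivative[OF bounded_linear_vec_nth])
  have "(?f k has_derivative ?f' k) (at x within A)" for k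
    using has_derivative_mult[OF has_derivative_power[OF comp, where n = "R $ k"]
        has_derivative_power[OF bounded_linear.has_derivative[OF bounded_linear_cnj comp], where n = "S $ k"]]
    by (simp add: mult_ac)
  then have "((\<lambda>z. \<Prod>k\<in>UNIV. ?f k z) has_derivative (\<lambda>h. \<Sum>k\<in>UNIV. ?f' k h * (\<Prod>j\<in>UNIV - {k}. ?f j x))) (at x within A)"
    by (intro has_derivative_prod)
  moreover have "?f' k h * (\<Prod>j\<in>UNIV - {k}. ?f j x)
      = h $ k * (of_nat (R $ k) * cmonom (R - unit_index k) S (x - p))
         + cnj (h $ k) * (of_nat (S $ k) * cmonom R (S - unit_index k) (x - p))" for k h
  proof -
    have rem: "cmonom R S z = ((z $ k) ^ (R $ k) * cnj (z $ k) ^ (S $ k)) *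
        (\<Prod>j\<in>UNIV - {k}. (z $ j) ^ (R $ j) * cnj (z $ j) ^ (S $ j))" for R S z
      unfolding cmonom_def by (rule prod.remove) auto
    have 1: "(\<Prod>j\<in>UNIV - {k}. (z $ j) ^ ((R - unit_index k) $ j) * cnj (z $ j) ^ (S $ j))
        = (\<Prod>j\<in>UNIV - {k}. (z $ j) ^ (R $ j) * cnj (z $ j) ^ (S $ j))"
      "(\<Prod>j\<in>UNIV - {k}. (z $ j) ^ (R $ j) * cnj (z $ j) ^ ((S - unit_index k) $ j))
        = (\<Prod>j\<in>UNIV - {k}. (z $ j) ^ (R $ j) * cnj (z $ j) ^ (S $ j))" for z :: "complex^'a"
      by (auto intro!: prod.cong)
    show ?thesis unfolding rem 1 by (simp add: algebra_simps)
  qed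
  ultimately show ?thesis by (simp add: cmonom_def)
qed

text \<open>Absolute convergence of the Taylor series for every radius. Quantifying over all
  \<open>t\<close> makes the condition stable under shifts, that is, under differentiation.\<close>

definition entire_coeffs :: "('n::finite, complex) array \<Rightarrow> bool" where
  "entire_coeffs a \<longleftrightarrow> (\<forall>t\<ge>0. (\<lambda>(R,S). norm (a R S) / (real (mfact R) * real (mfact S)) * t ^ (mabs R + mabs S)) summable_on UNIV)"

definition cterm :: "('n::finite, complex) array \<Rightarrow> complex^'n \<Rightarrow> (nat^'n) \<times> (nat^'n) \<Rightarrow> complex^'n \<Rightarrow> complex" where
  "cterm a p i z = (case i of (R,S) \<Rightarrow> a R S / (of_nat (mfact R) * of_nat (mfact S)) * cmonom R S (z - p))"

definition cseries :: "('n::finite, complex) array \<Rightarrow> complex^'n \<Rightarrow> complex^'n \<Rightarrow> complex" where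
  "cseries a p z = (\<Sum>\<^sub>\<infinity>i\<in>UNIV. cterm a p i z)"

lemma norm_cterm_le:
  "norm (cterm a p (R,S) z) \<le> norm (a R S) / (real (mfact R) * real (mfact S)) * norm (z - p) ^ (mabs R + mabs S)"
  using mult_left_mono[OF norm_cmonom_le[of R S "z - p"], of "norm (a R S) / (real (mfact R) * real (mfact S))"]
  by (simp add: cterm_def norm_mult norm_divide)

lemma cterm_has_sum:
  assumes "entire_coeffs a" shows "((\<lambda>i. cterm a p i z) has_sum cseries a p z) UNIV"
proof -
  have "(\<lambda>(R,S). norm (a R S) / (real (mfact R) * real (mfact S)) * norm (z - p) ^ (mabs R + mabs S)) summable_on UNIV"
    using assms unfolding entire_coeffs_def by simp
  then have "(\<lambda>i. norm (cterm a p i z)) summable_on UNIV"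
  proof (rule summable_on_comparison_test)
    show "norm (cterm a p i z) \<le> (case i of (R,S) \<Rightarrow> norm (a R S) / (real (mfact R) * real (mfact S)) * norm (z - p) ^ (mabs R + mabs S))" for i
      using norm_cterm_le[of a p _ _ z] by (cases i) simp
  qed simp
  then have "(\<lambda>i. cterm a p i z) summable_on UNIV" by (rule abs_summable_summable)
  then show ?thesis unfolding cseries_def by (rule has_sum_infsum)
qed

lemma mfact_add_unit: "mfact (R + unit_index k) = (R $ k + 1) * mfact R"
proof -
  have *: "mfact R = fact (R $ k) * (\<Prod>j\<in>UNIV - {k}. fact (R $ j))" for R :: "nat^'a"
    unfolding mfact_def by (rule prod.remove) auto
  have "(\<Prod>j\<in>UNIV - {k}. fact ((R + unit_index k) $ j)) = (\<Prod>j\<in>UNIV - {k}. fact (R $ j) :: nat)"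
    by (intro prod.cong) auto
  then show ?thesis unfolding *[of R] *[of "R + unit_index k"] by (simp add: algebra_simps)
qed

lemma of_nat_mfact_add_unit: 
  "(of_nat (mfact (R + unit_index k)) :: 'a::comm_semiring_1) = of_nat (Suc (R $ k)) * of_nat (mfact R)"
  by (simp only: mfact_add_unit of_nat_mult Suc_eq_plus1)

lemma mabs_unit [simp]: "mabs (unit_index k) = 1"
  by (simp add: mabs_def)

lemma nth_le_mabs: "R $ k \<le> mabs R"
  unfolding mabs_def by (rule member_le_sum) auto

text \<open>The factor \<open>R $ k + 1\<close> by which the factorials differ is at most 2^(n+1),
  with n the total order, and is absorbed into a larger radius.\<close>

lemma entire_coeffs_shift_left:
  assumes "entire_coeffs a" shows "entire_coeffs (\<lambda>R S. a (R + unit_index k) S)"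
  unfolding entire_coeffs_def
proof (intro allI impI)
  fix t :: real assume "0 \<le> t"
  \<comment> \<open>A radius of at least 1 allows the exponent to be raised by one.\<close>
  define u where "u = max 1 t"
  have u: "1 \<le> u" "t \<le> u" by (auto simp: u_def)
  let ?c = "\<lambda>(R,S). norm (a R S) / (real (mfact R) * real (mfact S)) * (2 * u) ^ (mabs R + mabs S)"
  have "?c summable_on range (\<lambda>(R,S). (R + unit_index k, S))"
  proof (rule summable_on_subset_banach)
    have "0 \<le> 2 * u" using u by simp
    then show "?c summable_on UNIV" using assms unfolding entire_coeffs_def by blast
  qed simp
  then have "(?c \<circ> (\<lambda>(R,S). (R + unit_index k, S))) summable_on UNIV"
    by (subst (asm) summable_on_reindex) (auto intro!: injI)
  then show "(\<lambda>(R,S). norm (a (R + unit_index k) S) / (real (mfact R) * real (mfact S)) * t ^ (mabs R + mabs S)) summable_on UNIV"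
  proof (rule summable_on_comparison_test, goal_cases)
    case (1 i)
    obtain R S where i: "i = (R,S)" by (cases i)
    let ?n = "mabs R + mabs S"
    have "real (Suc (R $ k)) \<le> 2 ^ Suc (R $ k)" by (rule less_imp_le[OF of_nat_less_two_power])
    also have "\<dots> \<le> (2::real) ^ (?n + 1)" using nth_le_mabs[of R k] by (intro power_increasing) auto
    finally have 1: "real (Suc (R $ k)) \<le> 2 ^ (?n + 1)" .
    have "t ^ ?n \<le> u ^ ?n" using u \<open>0 \<le> t\<close> by (intro power_mono) auto
    also have "\<dots> \<le> u ^ (?n + 1)" using u by (intro power_increasing) auto
    finally have "t ^ ?n * real (Suc (R $ k)) \<le> u ^ (?n + 1) * 2 ^ (?n + 1)"
      using 1 u by (intro mult_mono) auto
    then have 2: "t ^ ?n \<le> (2 * u) ^ (?n + 1) / real (Suc (R $ k))"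
      by (simp add: pos_le_divide_eq power_mult_distrib mult_ac del: of_nat_Suc power_Suc)
    have "norm (a (R + unit_index k) S) / (real (mfact R) * real (mfact S)) * t ^ ?n
        \<le> norm (a (R + unit_index k) S) / (real (mfact R) * real (mfact S)) * ((2 * u) ^ (?n + 1) / real (Suc (R $ k)))"
      by (intro mult_left_mono 2) auto
    also have "\<dots> = ?c (R + unit_index k, S)"
      by (simp add: of_nat_mfact_add_unit mult_ac del: of_nat_Suc)
    finally show ?case by (simp add: i)
  qed (use \<open>0 \<le> t\<close> in auto)
qed

lemma entire_coeffs_swap: "entire_coeffs a \<Longrightarrow> entire_coeffs (\<lambda>R S. a S R)"
proof -
  assume a: "entire_coeffs a"
  have "(\<lambda>(R,S). norm (a S R) / (real (mfact R) * real (mfact S)) * t ^ (mabs R + mabs S)) summable_on UNIV" if "0 \<le> t" for t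
  proof -
    let ?c = "\<lambda>(R,S). norm (a R S) / (real (mfact R) * real (mfact S)) * t ^ (mabs R + mabs S)"
    have "?c summable_on UNIV" using a that unfolding entire_coeffs_def by blast
    then have "?c summable_on range prod.swap" by simp
    then have "(?c \<circ> prod.swap) summable_on UNIV" by (subst (asm) summable_on_reindex) auto
    then show ?thesis by (simp add: o_def case_prod_unfold mult_ac add_ac)
  qed
  then show ?thesis unfolding entire_coeffs_def by blast
qed

lemma entire_coeffs_shift_right:
  assumes "entire_coeffs a" shows "entire_coeffs (\<lambda>R S. a R (S + unit_index k))"
  using entire_coeffs_swap[OF entire_coeffs_shift_left[OF entire_coeffs_swap[OF assms]]] .

lemma entire_coeffs_add:
  assumes "entire_coeffs a" "entire_coeffs b" shows "entire_coeffs (\<lambda>R S. a R S + b R S)"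
  unfolding entire_coeffs_def
proof (intro allI impI)
  fix t :: real assume t: "0 \<le> t"
  let ?c = "\<lambda>a (R,S). norm (a R S) / (real (mfact R) * real (mfact S)) * t ^ (mabs R + mabs S)"
  have "(\<lambda>i. ?c a i + ?c b i) summable_on UNIV"
    using assms t unfolding entire_coeffs_def by (intro summable_on_add) auto
  then show "?c (\<lambda>R S. a R S + b R S) summable_on UNIV"
  proof (rule summable_on_comparison_test, goal_cases)
    case (1 i)
    obtain R S where i: "i = (R,S)" by (cases i)
    have "norm (a R S + b R S) * (t ^ (mabs R + mabs S) / (real (mfact R) * real (mfact S)))
        \<le> (norm (a R S) + norm (b R S)) * (t ^ (mabs R + mabs S) / (real (mfact R) * real (mfact S)))"
      using t by (intro mult_right_mono norm_triangle_ineq) auto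
    then show ?case by (simp add: i add_divide_distrib[symmetric] distrib_right[symmetric])
  qed (use t in auto)
qed

lemma entire_coeffs_cmult:
  assumes "entire_coeffs a" shows "entire_coeffs (\<lambda>R S. c * a R S)"
  unfolding entire_coeffs_def
proof (intro allI impI)
  fix t :: real assume t: "0 \<le> t"
  let ?c = "\<lambda>a (R,S). norm (a R S) / (real (mfact R) * real (mfact S)) * t ^ (mabs R + mabs S)"
  have "(\<lambda>i. norm c * ?c a i) summable_on UNIV"
    using assms t unfolding entire_coeffs_def by (intro summable_on_cmult_right) auto
  then show "?c (\<lambda>R S. c * a R S) summable_on UNIV"
    by (simp add: case_prod_unfold norm_mult mult_ac)
qed

lemma entire_coeffs_sum:
  assumes "finite F" "F \<noteq> {}" "\<And>k. k \<in> F \<Longrightarrow> entire_coeffs (a k)"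
  shows "entire_coeffs (\<lambda>R S. \<Sum>k\<in>F. a k R S)"
  using assms by (induction F rule: finite_ne_induct) (auto intro: entire_coeffs_add)

lemma has_sum_reindex_neutral:
  fixes f :: "'b \<Rightarrow> 'c::{comm_monoid_add,topological_space}"
  assumes "inj g" "((f \<circ> g) has_sum s) UNIV" "\<And>i. i \<notin> range g \<Longrightarrow> f i = 0"
  shows "(f has_sum s) UNIV"
proof -
  have "(f has_sum s) (range g)" using assms(1,2) by (simp add: has_sum_reindex)
  then show ?thesis using assms(3) by (subst has_sum_cong_neutral[of "range g" UNIV f f]) auto
qed

text \<open>The derived terms with \<open>R $ k = 0\<close> vanish, so the series is supported on
  the indices \<open>(R + unit_index k, S)\<close>; after reindexing it is the series of the shifted
  array.\<close>

lemma has_sum_cterm_shift_left: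
  assumes a: "entire_coeffs a"
  shows "((\<lambda>(R,S). a R S / (of_nat (mfact R) * of_nat (mfact S)) * (of_nat (R $ k) * cmonom (R - unit_index k) S (x - p)))
     has_sum cseries (\<lambda>R S. a (R + unit_index k) S) p x) UNIV" (is "(?d has_sum ?s) UNIV")
proof -
  let ?g = "\<lambda>(R,S). (R + unit_index k, S)"
  have "((\<lambda>i. cterm (\<lambda>R S. a (R + unit_index k) S) p i x) has_sum ?s) UNIV"
    by (rule cterm_has_sum[OF entire_coeffs_shift_left[OF a]])
  moreover have "(\<lambda>i. cterm (\<lambda>R S. a (R + unit_index k) S) p i x) = ?d \<circ> ?g"
  proof
    fix i show "cterm (\<lambda>R S. a (R + unit_index k) S) p i x = (?d \<circ> ?g) i"
      by (cases i) (simp add: cterm_def of_nat_mfact_add_unit field_simps del: of_nat_Suc)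
  qed
  moreover have "?d i = 0" if "i \<notin> range ?g" for i
  proof -
    obtain R S where i: "i = (R,S)" by (cases i)
    have "R $ k = 0"
    proof (rule ccontr)
      assume "R $ k \<noteq> 0"
      then have "i = ?g (R - unit_index k, S)" by (auto simp: i vec_eq_iff)
      then show False using that by blast
    qed
    then show ?thesis by (simp add: i)
  qed
  ultimately show ?thesis
    by (intro has_sum_reindex_neutral[of ?g ?d]) (auto intro!: injI)
qed

lemma has_sum_cterm_shift_right:
  assumes a: "entire_coeffs a"
  shows "((\<lambda>(R,S). a R S / (of_nat (mfact R) * of_nat (mfact S)) * (of_nat (S $ k) * cmonom R (S - unit_index k) (x - p)))
     has_sum cseries (\<lambda>R S. a R (S + unit_index k)) p x) UNIV" (is "(?d has_sum ?s) UNIV")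
proof -
  let ?g = "\<lambda>(R,S). (R, S + unit_index k)"
  have "((\<lambda>i. cterm (\<lambda>R S. a R (S + unit_index k)) p i x) has_sum ?s) UNIV"
    by (rule cterm_has_sum[OF entire_coeffs_shift_right[OF a]])
  moreover have "(\<lambda>i. cterm (\<lambda>R S. a R (S + unit_index k)) p i x) = ?d \<circ> ?g"
  proof
    fix i show "cterm (\<lambda>R S. a R (S + unit_index k)) p i x = (?d \<circ> ?g) i"
      by (cases i) (simp add: cterm_def of_nat_mfact_add_unit field_simps del: of_nat_Suc)
  qed
  moreover have "?d i = 0" if "i \<notin> range ?g" for i
  proof -
    obtain R S where i: "i = (R,S)" by (cases i)
    have "S $ k = 0"
    proof (rule ccontr)
      assume "S $ k \<noteq> 0"
      then have "i = ?g (R, S - unit_index k)" by (auto simp: i vec_eq_iff)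
      then show False using that by blast
    qed
    then show ?thesis by (simp add: i)
  qed
  ultimately show ?thesis
    by (intro has_sum_reindex_neutral[of ?g ?d]) (auto intro!: injI)
qed

lemma has_derivative_cseries:
  fixes a :: "('n::finite, complex) array"
  assumes a: "entire_coeffs a"
  shows "(cseries a p has_derivative (\<lambda>h. \<Sum>k\<in>UNIV. h $ k * cseries (\<lambda>R S. a (R + unit_index k) S) p x
      + cnj (h $ k) * cseries (\<lambda>R S. a R (S + unit_index k)) p x)) (at x)"
    (is "(_ has_derivative ?g' x) _")
proof -
  \<comment> \<open>The ball of radius \<open>r\<close> about \<open>p\<close> contains
    \<open>x\<close>, and \<open>1 \<le> r\<close> lets lower powers be bounded by higher
    ones.\<close>
  define r where "r = norm (x - p) + 1"
  have r: "1 \<le> r" by (simp add: r_def)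
  let ?B = "ball p r"
  have xB: "x \<in> ?B" by (simp add: r_def dist_norm norm_minus_commute)
  define c :: "(nat^'n) \<times> (nat^'n) \<Rightarrow> complex" where "c = (\<lambda>(R,S). a R S / (of_nat (mfact R) * of_nat (mfact S)))"
  define d1 where "d1 k x = (\<lambda>(R,S). c (R,S) * (of_nat (R $ k) * cmonom (R - unit_index k) S (x - p)))" for k :: 'n and x
  define d2 where "d2 k x = (\<lambda>(R,S). c (R,S) * (of_nat (S $ k) * cmonom R (S - unit_index k) (x - p)))" for k :: 'n and x
  define f' where "f' i x h = (\<Sum>k\<in>UNIV. h $ k * d1 k x i + cnj (h $ k) * d2 k x i)" for i x and h :: "complex^'n"
  \<comment> \<open>Differentiation multiplies the bound for a term of order n by at most n, and n
    \<le> 2^n; the base \<open>2 * r\<close> absorbs this.\<close>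
  define M where "M = (\<lambda>(R,S). norm (a R S) / (real (mfact R) * real (mfact S)) * (2 * r) ^ (mabs R + mabs S))"
  have deriv: "((\<lambda>z. cterm a p i z) has_derivative f' i x) (at x within ?B)" for i x
  proof -
    obtain R S where i: "i = (R,S)" by (cases i)
    have "((\<lambda>z. c i * cmonom R S (z - p)) has_derivative
     (\<lambda>h. c i * (\<Sum>k\<in>UNIV. h $ k * (of_nat (R $ k) * cmonom (R - unit_index k) S (x - p))
         + cnj (h $ k) * (of_nat (S $ k) * cmonom R (S - unit_index k) (x - p))))) (at x within ?B)"
      by (intro has_derivative_mult_right has_derivative_cmonom)
    moreover have "c i * (\<Sum>k\<in>UNIV. h $ k * (of_nat (R $ k) * cmonom (R - unit_index k) S (x - p))
         + cnj (h $ k) * (of_nat (S $ k) * cmonom R (S - unit_index k) (x - p))) = f' i x h" for h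
      by (simp add: f'_def d1_def d2_def i sum_distrib_left algebra_simps)
    ultimately show ?thesis by (simp add: cterm_def c_def i)
  qed
  have bound: "norm (f' i x h) \<le> M i * norm h" if x: "x \<in> ?B" for i x h
  proof -
    obtain R S where i: "i = (R,S)" by (cases i)
    let ?n = "mabs R + mabs S"
    have nx: "norm (x - p) \<le> r" using x by (simp add: dist_norm norm_minus_commute)
    have mon: "norm (cmonom R' S' (x - p)) \<le> r ^ ?n" if "mabs R' + mabs S' \<le> ?n" for R' S' :: "nat^'n"
    proof -
      have "norm (cmonom R' S' (x - p)) \<le> norm (x - p) ^ (mabs R' + mabs S')" by (rule norm_cmonom_le)
      also have "\<dots> \<le> r ^ (mabs R' + mabs S')" using nx by (intro power_mono) auto
      also have "\<dots> \<le> r ^ ?n" using r that by (intro power_increasing)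
      finally show ?thesis .
    qed
    have le: "mabs (R - unit_index k) \<le> mabs R" for R :: "nat^'n" and k
      unfolding mabs_def by (intro sum_mono) auto
    have dR: "norm (d1 k x i) \<le> norm (c i) * (real (R $ k) * r ^ ?n)" for k
      unfolding d1_def i by (simp add: norm_mult) (intro mult_left_mono mon add_mono le, auto)
    have dS: "norm (d2 k x i) \<le> norm (c i) * (real (S $ k) * r ^ ?n)" for k
      unfolding d2_def i by (simp add: norm_mult) (intro mult_left_mono mon add_mono le, auto)
    have "norm (f' i x h) \<le> (\<Sum>k\<in>UNIV. norm (h $ k) * norm (d1 k x i) + norm (h $ k) * norm (d2 k x i))"
      unfolding f'_def
      by (rule order_trans[OF norm_sum], intro sum_mono, rule order_trans[OF norm_triangle_ineq]) (simp add: norm_mult)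
    also have "\<dots> \<le> (\<Sum>k\<in>UNIV. norm h * (norm (c i) * (real (R $ k) * r ^ ?n)) + norm h * (norm (c i) * (real (S $ k) * r ^ ?n)))"
      by (intro sum_mono add_mono mult_mono dR dS Finite_Cartesian_Product.norm_nth_le) auto
    also have "\<dots> = norm h * (norm (c i) * (real ?n * r ^ ?n))"
    proof -
      have "real ?n = (\<Sum>k\<in>UNIV. real (R $ k) + real (S $ k))" by (simp add: mabs_def sum.distrib)
      then show ?thesis by (simp add: sum_distrib_left sum_distrib_right algebra_simps)
    qed
    also have "\<dots> \<le> norm h * (norm (c i) * (2 ^ ?n * r ^ ?n))"
    proof -
      have "real ?n \<le> 2 ^ ?n" by (rule less_imp_le[OF of_nat_less_two_power])
      then show ?thesis using r by (intro mult_left_mono mult_right_mono) auto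
    qed
    also have "\<dots> = M i * norm h"
      by (simp add: M_def i c_def norm_divide norm_mult power_mult_distrib)
    finally show ?thesis .
  qed
  have "0 \<le> 2 * r" using r by simp
  then have M: "M summable_on UNIV" using a unfolding entire_coeffs_def M_def by blast
  have g': "((\<lambda>i. f' i x h) has_sum ?g' x h) UNIV" for x h
    unfolding f'_def
  proof (intro has_sum_sum_family has_sum_add has_sum_cmult_right)
    show "(d1 k x has_sum cseries (\<lambda>R S. a (R + unit_index k) S) p x) UNIV" for k
      using has_sum_cterm_shift_left[OF a, of k x p] by (simp add: d1_def c_def case_prod_unfold)
    show "(d2 k x has_sum cseries (\<lambda>R S. a R (S + unit_index k)) p x) UNIV" for k
      using has_sum_cterm_shift_right[OF a, of k x p] by (simp add: d2_def c_def case_prod_unfold)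
  qed
  have inf: "infinite (UNIV :: ((nat^'n) \<times> (nat^'n)) set)"
  proof -
    have "inj (\<lambda>m. (vec m :: nat^'n, 0 :: nat^'n))" by (rule injI) (simp add: vec_eq_iff)
    from range_inj_infinite[OF this] show ?thesis by (rule infinite_super[rotated]) simp
  qed
  \<comment> \<open>An enumeration of the pairs of multiindices turns the unordered sums into series
    indexed by numbers.\<close>
  define \<nu> where "\<nu> = from_nat_into (UNIV :: ((nat^'n) \<times> (nat^'n)) set)"
  have \<nu>: "bij_betw \<nu> UNIV UNIV" unfolding \<nu>_def using bij_betw_from_nat_into[OF _ inf] by simp
  have sums: "(\<lambda>m. f (\<nu> m)) sums s" if "(f has_sum s) UNIV" for f :: "_ \<Rightarrow> 'c::{comm_monoid_add,t2_space}" and s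
    using that has_sum_reindex_bij_betw[OF \<nu>, of f s] by (intro has_sum_imp_sums) simp
  have "(cseries a p has_derivative ?g' x) (at x within ?B)"
  proof (rule has_derivative_suminf_M_test[where f = "\<lambda>m. cterm a p (\<nu> m)" and f' = "\<lambda>m. f' (\<nu> m)" and M = "\<lambda>m. M (\<nu> m)"])
    show "summable (\<lambda>m. M (\<nu> m))" using sums[OF has_sum_infsum[OF M]] by (rule sums_summable)
  qed (use xB deriv bound sums[OF g'] sums[OF cterm_has_sum[OF a]] in auto)
  then show ?thesis using xB at_within_open[OF xB] by simp
qed

lemma dird_cseries:
  assumes "entire_coeffs a"
  shows "dird v (cseries a p) x = (\<Sum>k\<in>UNIV. v $ k * cseries (\<lambda>R S. a (R + unit_index k) S) p x
      + cnj (v $ k) * cseries (\<lambda>R S. a R (S + unit_index k)) p x)"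
  by (rule dird_eqI[OF has_derivative_cseries[OF assms]])

text \<open>Differentiating a series recombines shifts of its coefficients, so the series with
  entire coefficients form a class closed under directional derivatives.\<close>

lemma smooth_cseries:
  fixes a :: "('n::finite, complex) array"
  assumes "entire_coeffs a" shows "smooth (cseries a p)"
proof (rule smooth_coinduct[where P = "\<lambda>f. \<exists>a. entire_coeffs a \<and> f = cseries a p"])
  show "\<exists>a'. entire_coeffs a' \<and> cseries a p = cseries a' p" using assms by blast
next
  fix f x assume "\<exists>a. entire_coeffs a \<and> f = cseries a p"
  then show "f differentiable (at x)" using has_derivative_cseries unfolding differentiable_def by blast
next
  fix f :: "complex^'n \<Rightarrow> complex" and h assume "\<exists>a. entire_coeffs a \<and> f = cseries a p"
  then obtain a where a: "entire_coeffs a" "f = cseries a p" by blast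
  define b where "b R S = (\<Sum>k\<in>UNIV. h $ k * a (R + unit_index k) S + cnj (h $ k) * a R (S + unit_index k))" for R S
  have b: "entire_coeffs b"
    unfolding b_def[abs_def]
    by (intro entire_coeffs_sum entire_coeffs_add entire_coeffs_cmult entire_coeffs_shift_left entire_coeffs_shift_right a) auto
  have "dird h f = cseries b p"
  proof
    fix x
    have "((\<lambda>i. \<Sum>k\<in>UNIV. h $ k * cterm (\<lambda>R S. a (R + unit_index k) S) p i x + cnj (h $ k) * cterm (\<lambda>R S. a R (S + unit_index k)) p i x)
       has_sum dird h f x) UNIV"
      unfolding a(2) dird_cseries[OF a(1)]
      by (intro has_sum_sum_family has_sum_add has_sum_cmult_right cterm_has_sum entire_coeffs_shift_left entire_coeffs_shift_right a)
    moreover have "(\<lambda>i. \<Sum>k\<in>UNIV. h $ k * cterm (\<lambda>R S. a (R + unit_index k) S) p i x + cnj (h $ k) * cterm (\<lambda>R S. a R (S + unit_index k)) p i x)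
      = (\<lambda>i. cterm b p i x)"
      by (auto simp: fun_eq_iff cterm_def b_def sum_divide_distrib sum_distrib_right add_divide_distrib distrib_right mult.assoc intro!: sum.cong)
    ultimately show "dird h f x = cseries b p x"
      using has_sum_unique[OF _ cterm_has_sum[OF b]] by simp
  qed
  then show "\<exists>a. entire_coeffs a \<and> dird h f = cseries a p" using b by blast
qed

lemma dird_axis_cseries:
  assumes "entire_coeffs a"
  shows "dird (axis k c) (cseries a p) x = c * cseries (\<lambda>R S. a (R + unit_index k) S) p x
      + cnj c * cseries (\<lambda>R S. a R (S + unit_index k)) p x"
proof -
  have "dird (axis k c) (cseries a p) x = (\<Sum>j\<in>UNIV. if j = k then
      c * cseries (\<lambda>R S. a (R + unit_index k) S) p x + cnj c * cseries (\<lambda>R S. a R (S + unit_index k)) p x else 0)"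
    unfolding dird_cseries[OF assms] by (intro sum.cong) (auto simp: axis_def)
  then show ?thesis by simp
qed

lemma dz_cseries:
  assumes "entire_coeffs a" shows "dz k (cseries a p) = cseries (\<lambda>R S. a (R + unit_index k) S) p"
  by (rule ext) (simp add: dz_dird dird_axis_cseries[OF assms] algebra_simps)

lemma dzbar_cseries:
  assumes "entire_coeffs a" shows "dzbar k (cseries a p) = cseries (\<lambda>R S. a R (S + unit_index k)) p"
  by (rule ext) (simp add: dzbar_dird dird_axis_cseries[OF assms] algebra_simps)

lemma entire_coeffs_shift:
  assumes "entire_coeffs a" shows "entire_coeffs (\<lambda>I J. a (I + R) (J + S))"
proof -
  have 1: "entire_coeffs (\<lambda>I J. a I (J + S))"
  proof (induction S rule: multiindex_induct)
    case (add_unit S k)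
    then show ?case using entire_coeffs_shift_right[of "\<lambda>I J. a I (J + S)" k] by (simp add: add_ac)
  qed (use assms in simp)
  show ?thesis
  proof (induction R rule: multiindex_induct)
    case (add_unit R k)
    then show ?case using entire_coeffs_shift_left[of "\<lambda>I J. a (I + R) (J + S)" k] by (simp add: add_ac)
  qed (use 1 in simp)
qed

lemma wderiv_cseries:
  assumes a: "entire_coeffs a" shows "wderiv R S (cseries a p) = cseries (\<lambda>I J. a (I + R) (J + S)) p"
proof -
  have 1: "mder dzbar S (cseries a p) = cseries (\<lambda>I J. a I (J + S)) p"
  proof (induction S rule: multiindex_induct)
    case (add_unit S k)
    have "entire_coeffs (\<lambda>I J. a I (J + S))" using entire_coeffs_shift[OF a, of 0 S] by simp
    then show ?case by (simp add: dzbar.mder_add_unit smooth_cseries a add_unit dzbar_cseries add_ac)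
  qed simp
  have sm: "smooth (cseries (\<lambda>I J. a I (J + S)) p)"
    using smooth_cseries[OF entire_coeffs_shift[OF a, of 0 S]] by simp
  have "mder dz R (cseries (\<lambda>I J. a I (J + S)) p) = cseries (\<lambda>I J. a (I + R) (J + S)) p"
  proof (induction R rule: multiindex_induct)
    case (add_unit R k)
    then show ?case by (simp add: dz.mder_add_unit sm dz_cseries entire_coeffs_shift[OF a] add_ac)
  qed simp
  then show ?thesis by (simp add: wderiv_eq_mder 1)
qed

lemma cmonom_0: "cmonom R S 0 = (if R = 0 \<and> S = 0 then 1 else 0)"
proof (cases "R = 0 \<and> S = 0")
  case False
  then obtain k where "R $ k \<noteq> 0 \<or> S $ k \<noteq> 0" by (auto simp: vec_eq_iff)
  then have "((0::complex^'a) $ k) ^ (R $ k) * cnj ((0::complex^'a) $ k) ^ (S $ k) = 0" by auto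
  then have "cmonom R S 0 = 0" unfolding cmonom_def by (intro prod_zero) (auto intro!: bexI[of _ k])
  then show ?thesis using False by simp
qed (simp add: cmonom_def)

text \<open>At the centre only the constant monomial survives.\<close>

lemma cseries_center: "cseries a p p = a 0 0"
proof -
  have "cseries a p p = (\<Sum>\<^sub>\<infinity>i\<in>{(0,0)}. cterm a p i p)"
    unfolding cseries_def by (rule infsum_cong_neutral) (auto simp: cterm_def cmonom_0 split: if_splits)
  then show ?thesis by (simp add: cterm_def cmonom_0)
qed

lemma wderiv_cseries_center: "entire_coeffs a \<Longrightarrow> wderiv R S (cseries a p) p = a R S"
  by (simp add: wderiv_cseries cseries_center)

lemma summable_power_div_sqrt_fact: 
  assumes "0 \<le> u" shows "summable (\<lambda>i. u ^ i / sqrt (fact i))"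
proof -
  \<comment> \<open>From this index on the ratio \<open>u / sqrt (i + 1)\<close> is at most
    1/2.\<close>
  obtain K :: nat where K: "4 * u\<^sup>2 \<le> real K" using real_arch_simple by blast
  have "norm (u ^ Suc i / sqrt (fact (Suc i))) \<le> (1/2) * norm (u ^ i / sqrt (fact i))" if "i \<ge> K" for i
  proof -
    have "(2 * u)\<^sup>2 \<le> real (Suc i)" using K that by (simp add: power_mult_distrib)
    then have "2 * u \<le> sqrt (real (Suc i))" by (rule real_le_rsqrt)
    then have "u / sqrt (real (Suc i)) \<le> 1/2" by (simp add: field_simps)
    then have "u / sqrt (real (Suc i)) * (u ^ i / sqrt (fact i)) \<le> 1/2 * (u ^ i / sqrt (fact i))"
      using assms by (intro mult_right_mono) auto
    then show ?thesis using assms by (simp add: real_sqrt_mult mult_ac)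
  qed
  then show ?thesis by (intro summable_ratio_test[of "1/2" K]) auto
qed

text \<open>Roots in the growth bound leave sqrt(R! S!) against R! S! in the Taylor series, so the
  terms are dominated by products of the one-variable series of
  \<open>u ^ i / sqrt (fact i)\<close>.\<close>

lemma entire_coeffsI_growth:
  fixes a :: "('n::finite, complex) array"
  assumes hbar: "0 < hbar" and C: "0 \<le> C"
    and growth: "\<And>J N. (2 * hbar) ^ (mabs J + mabs N) * (norm (a J N))\<^sup>2 \<le> C * real (mfact J) * real (mfact N)"
  shows "entire_coeffs a"
  unfolding entire_coeffs_def
proof (intro allI impI)
  fix t :: real assume t: "0 \<le> t"
  \<comment> \<open>The rescaled radius absorbs the root of the weight (2 hbar)^n.\<close>
  define u where "u = t / sqrt (2 * hbar)"
  have u: "0 \<le> u" using t hbar by (simp add: u_def)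
  define \<phi> where "\<phi> N = u ^ mabs N / sqrt (real (mfact N))" for N :: "nat^'n"
  have \<phi>0: "0 \<le> \<phi> N" for N using u by (simp add: \<phi>_def)
  \<comment> \<open>One factor for each coordinate; the product bounds the sum of
    \<open>\<phi>\<close> over every box.\<close>
  define K where "K = (\<Sum>i. u ^ i / sqrt (fact i)) ^ CARD('n)"
  have \<phi>_sum: "(\<Sum>N\<le>R. \<phi> N) \<le> K" for R
  proof -
    have sqrt_prod: "sqrt (real (mfact N)) = (\<Prod>k\<in>UNIV. sqrt (fact (N $ k)))" for N :: "nat^'n"
    proof -
      have "sqrt (\<Prod>k\<in>F. fact (N $ k)) = (\<Prod>k\<in>F. sqrt (fact (N $ k)))" if "finite F" for F
        using that by (induction F rule: finite_induct) (auto simp: real_sqrt_mult)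
      then show ?thesis by (simp add: mfact_def)
    qed
    have "(\<Sum>N\<le>R. \<phi> N) = (\<Sum>N\<le>R. \<Prod>k\<in>UNIV. u ^ (N $ k) / sqrt (fact (N $ k)))"
      by (simp add: \<phi>_def power_mabs sqrt_prod prod_dividef)
    also have "\<dots> = (\<Prod>k\<in>UNIV. \<Sum>i\<le>R $ k. u ^ i / sqrt (fact i))" by (rule sum_prod_atMost_multiindex)
    also have "\<dots> \<le> (\<Prod>k\<in>(UNIV::'n set). \<Sum>i. u ^ i / sqrt (fact i))"
      using u by (intro prod_mono conjI sum_nonneg sum_le_suminf summable_power_div_sqrt_fact) auto
    finally show ?thesis by (simp add: K_def)
  qed
  let ?c = "\<lambda>(R,S). norm (a R S) / (real (mfact R) * real (mfact S)) * t ^ (mabs R + mabs S)"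
  have c_le: "?c (R,S) \<le> sqrt C * (\<phi> R * \<phi> S)" for R S
  proof -
    let ?n = "mabs R + mabs S" and ?m = "real (mfact R) * real (mfact S)"
    have m: "0 < ?m" using mfact_pos[of R] mfact_pos[of S] by simp
    have "(sqrt (2 * hbar) ^ ?n)\<^sup>2 = ((sqrt (2 * hbar))\<^sup>2) ^ ?n"
      by (simp only: power_mult[symmetric] mult.commute)
    also have "\<dots> = (2 * hbar) ^ ?n" using hbar by simp
    finally have "(norm (a R S) * sqrt (2 * hbar) ^ ?n)\<^sup>2 = (2 * hbar) ^ ?n * (norm (a R S))\<^sup>2"
      unfolding power_mult_distrib by (simp only: mult.commute)
    also have "\<dots> \<le> C * ?m" using growth[of R S] by (simp only: mult.assoc)
    also have "\<dots> = (sqrt C * sqrt ?m)\<^sup>2" using C m by (simp add: power_mult_distrib)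
    finally have "(norm (a R S) * sqrt (2 * hbar) ^ ?n)\<^sup>2 \<le> (sqrt C * sqrt ?m)\<^sup>2" .
    then have "norm (a R S) * sqrt (2 * hbar) ^ ?n \<le> sqrt C * sqrt ?m"
      by (rule power2_le_imp_le) (use C m in auto)
    then have "norm (a R S) * sqrt (2 * hbar) ^ ?n * u ^ ?n \<le> sqrt C * sqrt ?m * u ^ ?n"
      using u by (intro mult_right_mono) auto
    then have "norm (a R S) * t ^ ?n \<le> sqrt C * sqrt ?m * u ^ ?n"
      using hbar by (simp add: u_def power_divide mult.assoc)
    then have "norm (a R S) * t ^ ?n / ?m \<le> sqrt C * sqrt ?m * u ^ ?n / ?m"
      using m by (intro divide_right_mono) auto
    also have "\<dots> = sqrt C * (u ^ ?n / sqrt ?m)"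
    proof -
      have "A * q * U / (q * q) = A * (U / q)" if "0 < q" for A q U :: real
        using that by (simp add: field_simps)
      from this[of "sqrt ?m" "sqrt C" "u ^ ?n"] show ?thesis using m by (simp add: abs_of_pos)
    qed
    also have "\<dots> = sqrt C * (\<phi> R * \<phi> S)"
      by (simp add: \<phi>_def real_sqrt_mult power_add)
    finally show ?thesis by simp
  qed
  have "sum ?c F \<le> sqrt C * (K * K)" if F: "finite F" for F
  proof -
    obtain R where R: "\<And>N. N \<in> fst ` F \<Longrightarrow> N \<le> R" using finite_multiindex_bounded[of "fst ` F"] F by auto
    obtain S where S: "\<And>N. N \<in> snd ` F \<Longrightarrow> N \<le> S" using finite_multiindex_bounded[of "snd ` F"] F by auto
    have "sum ?c F \<le> sum ?c ({..R} \<times> {..S})"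
      using R S t by (intro sum_mono2 finite_cartesian_product finite_atMost_multiindex) force+
    also have "\<dots> \<le> (\<Sum>(R,S)\<in>{..R} \<times> {..S}. sqrt C * (\<phi> R * \<phi> S))"
      using c_le by (intro sum_mono) auto
    also have "\<dots> = sqrt C * ((\<Sum>N\<le>R. \<phi> N) * (\<Sum>N\<le>S. \<phi> N))"
      unfolding sum.cartesian_product[symmetric] by (simp add: sum_product sum_distrib_left[symmetric])
    also have "\<dots> \<le> sqrt C * (K * K)"
    proof -
      have "0 \<le> (\<Sum>N\<le>(0::nat^'n). \<phi> N)" by (intro sum_nonneg \<phi>0)
      then have "0 \<le> K" using \<phi>_sum[of 0] by linarith
      then show ?thesis using \<phi>_sum C by (intro mult_left_mono mult_mono sum_nonneg \<phi>0) auto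
    qed
    finally show ?thesis .
  qed
  then show "?c summable_on UNIV"
    using t by (intro nonneg_bdd_above_summable_on bdd_aboveI2[of _ _ "sqrt C * (K * K)"]) auto
qed

section \<open>Frechet spaces from countable families of seminorms\<close>

section \<open>Topologies generated by seminorms\<close>

text \<open>The seminorms are controlled on the carrier only. Nonemptiness of \<open>Q\<close> makes
  the generating balls cover the carrier.\<close>

locale seminormed_module = module "ring_of_type_algebra :: complex ring" V
  for V :: "(complex, 'v, 'z) module_scheme" (structure) +
  fixes Q :: "('v \<Rightarrow> real) set"
  assumes Q_nonempty: "Q \<noteq> {}"
    and Q_nonneg: "q \<in> Q \<Longrightarrow> x \<in> carrier V \<Longrightarrow> 0 \<le> q x"
    and Q_triangle: "q \<in> Q \<Longrightarrow> x \<in> carrier V \<Longrightarrow> y \<in> carrier V \<Longrightarrow> q (x \<oplus> y) \<le> q x + q y"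
    and Q_scale: "q \<in> Q \<Longrightarrow> x \<in> carrier V \<Longrightarrow> q (c \<odot> x) = cmod c * q x"
begin

abbreviation T where "T \<equiv> seminorm_topology V Q"

lemma scalar_simps [simp]:
  "carrier (ring_of_type_algebra :: complex ring) = UNIV"
  "\<one>\<^bsub>ring_of_type_algebra :: complex ring\<^esub> = 1"
  "\<zero>\<^bsub>ring_of_type_algebra :: complex ring\<^esub> = 0"
  "a \<oplus>\<^bsub>ring_of_type_algebra :: complex ring\<^esub> b = a + b"
  "a \<otimes>\<^bsub>ring_of_type_algebra :: complex ring\<^esub> b = a * b"
  by (simp_all add: ring_of_type_algebra_def)

lemma scale_closed [simp, intro]: "x \<in> carrier V \<Longrightarrow> c \<odot> x \<in> carrier V"
  using smult_closed[of c x] by simp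

lemma scale_add_left: "x \<in> carrier V \<Longrightarrow> (a + b) \<odot> x = a \<odot> x \<oplus> b \<odot> x"
  using smult_l_distr[of a b x] by simp

lemma scale_add_right:
  "x \<in> carrier V \<Longrightarrow> y \<in> carrier V \<Longrightarrow> c \<odot> (x \<oplus> y) = c \<odot> x \<oplus> c \<odot> y"
  using smult_r_distr[of c x y] by simp

lemma scale_zero [simp]: "x \<in> carrier V \<Longrightarrow> 0 \<odot> x = \<zero>"
  using smult_l_null[of x] by simp

lemma scale_minus_one: 
  assumes x: "x \<in> carrier V" shows "(-1) \<odot> x = \<ominus> x"
proof -
  have "(-1) \<odot> x \<oplus> x = (-1 + 1) \<odot> x"
    using scale_add_left[OF x, of "-1" 1] smult_one[OF x] by simp
  then show ?thesis
    using M.minus_equality[of "(-1) \<odot> x" x] x by simp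
qed

lemma Q_zero [simp]: "q \<in> Q \<Longrightarrow> q \<zero> = 0"
  using Q_scale[of q "\<zero>" 0] by simp

lemma Q_minus: "q \<in> Q \<Longrightarrow> x \<in> carrier V \<Longrightarrow> q (\<ominus> x) = q x"
  using Q_scale[of q x "-1"] by (simp add: scale_minus_one)

lemma diff_add: "x \<in> carrier V \<Longrightarrow> y \<in> carrier V \<Longrightarrow> (y \<ominus> x) \<oplus> x = y"
  by (simp add: a_minus_def M.a_assoc M.l_neg)

lemma diff_eqI: "x \<in> carrier V \<Longrightarrow> y \<in> carrier V \<Longrightarrow> z \<in> carrier V \<Longrightarrow> z \<oplus> x = y \<Longrightarrow> y \<ominus> x = z"
  by (metis M.add.inv_closed M.r_neg M.r_zero M.a_assoc a_minus_def)

lemma diff_self [simp]: "x \<in> carrier V \<Longrightarrow> x \<ominus> x = \<zero>"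
  by (simp add: a_minus_def M.r_neg)

lemma diff_commute:
  assumes "x \<in> carrier V" "y \<in> carrier V" shows "x \<ominus> y = \<ominus> (y \<ominus> x)"
  using assms by (simp add: a_minus_def M.minus_add M.a_comm)

lemma Q_diff_commute: "q \<in> Q \<Longrightarrow> x \<in> carrier V \<Longrightarrow> y \<in> carrier V \<Longrightarrow> q (x \<ominus> y) = q (y \<ominus> x)"
  by (subst diff_commute) (auto simp: Q_minus)

lemma diff_trans: 
  assumes "x \<in> carrier V" "y \<in> carrier V" "z \<in> carrier V"
  shows "(x \<ominus> y) \<oplus> (y \<ominus> z) = x \<ominus> z"
  by (rule diff_eqI[symmetric]) (use assms in \<open>simp_all add: M.a_assoc diff_add\<close>)

lemma Q_diff_trans: "q \<in> Q \<Longrightarrow> x \<in> carrier V \<Longrightarrow> y \<in> carrier V \<Longrightarrow> z \<in> carrier V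
    \<Longrightarrow> q (x \<ominus> z) \<le> q (x \<ominus> y) + q (y \<ominus> z)"
  using Q_triangle[of q "x \<ominus> y" "y \<ominus> z"] by (simp add: diff_trans)

lemma add_diff_add: 
  assumes "x \<in> carrier V" "y \<in> carrier V" "x' \<in> carrier V" "y' \<in> carrier V"
  shows "(y \<oplus> y') \<ominus> (x \<oplus> x') = (y \<ominus> x) \<oplus> (y' \<ominus> x')"
  using assms by (simp add: a_minus_def M.minus_add M.a_ac)

lemma topspace_T [simp]: "topspace T = carrier V"
proof -
  have "(\<Union>{{y \<in> carrier V. q (y \<ominus> x) < e} | q x e. q \<in> Q \<and> x \<in> carrier V \<and> 0 < e}) = carrier V"
  proof (rule antisym)
    obtain q where q: "q \<in> Q" using Q_nonempty by blast
    show "carrier V \<subseteq> \<Union>{{y \<in> carrier V. q (y \<ominus> x) < e} | q x e. q \<in> Q \<and> x \<in> carrier V \<and> 0 < e}"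
    proof
      fix x assume "x \<in> carrier V"
      then have "x \<in> {y \<in> carrier V. q (y \<ominus> x) < 1}" using q by simp
      then show "x \<in> \<Union>{{y \<in> carrier V. q (y \<ominus> x) < e} | q x e. q \<in> Q \<and> x \<in> carrier V \<and> 0 < e}"
      proof (rule UnionI[rotated])
        show "{y \<in> carrier V. q (y \<ominus> x) < 1} \<in>
            {{y \<in> carrier V. q (y \<ominus> x) < e} | q x e. q \<in> Q \<and> x \<in> carrier V \<and> 0 < e}"
          using q \<open>x \<in> carrier V\<close> zero_less_one by blast
      qed
    qed
  qed blast
  then show ?thesis by (simp add: seminorm_topology_def)
qed

lemma openin_seminorm_ball:
  "q \<in> Q \<Longrightarrow> x \<in> carrier V \<Longrightarrow> 0 < e \<Longrightarrow> openin T {y \<in> carrier V. q (y \<ominus> x) < e}"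
  unfolding seminorm_topology_def by (rule topology_generated_by_Basis) blast

lemma openin_finite_ball:
  assumes "finite F" "F \<subseteq> Q" "x \<in> carrier V" "0 < e"
  shows "openin T {y \<in> carrier V. \<forall>q\<in>F. q (y \<ominus> x) < e}"
proof (cases "F = {}")
  case True
  then show ?thesis using openin_topspace[of T] by simp
next
  case False
  then have "{y \<in> carrier V. \<forall>q\<in>F. q (y \<ominus> x) < e} = (\<Inter>q\<in>F. {y \<in> carrier V. q (y \<ominus> x) < e})"
    by auto
  then show ?thesis using assms False
    by (auto intro!: openin_INT2 openin_seminorm_ball)
qed

text \<open>Generating balls may be centred at any \<open>z\<close>; around a point
  \<open>f x\<close> of such a ball the triangle inequality leaves the radius
  \<open>e - q (f x \<ominus> z)\<close>.\<close>

lemma continuous_map_into_seminorm_topology: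
  assumes into: "\<And>x. x \<in> topspace Y \<Longrightarrow> f x \<in> carrier V"
    and "\<And>x q e. x \<in> topspace Y \<Longrightarrow> q \<in> Q \<Longrightarrow> 0 < e \<Longrightarrow>
          \<exists>U. openin Y U \<and> x \<in> U \<and> (\<forall>y\<in>U. q (f y \<ominus> f x) < e)"
  shows "continuous_map Y T f"
  unfolding seminorm_topology_def
proof (rule continuous_on_generated_topo, goal_cases)
  case (1 W)
  then obtain q z e where W: "W = {y \<in> carrier V. q (y \<ominus> z) < e}" "q \<in> Q" "z \<in> carrier V" "0 < e"
    by blast
  show ?case
  proof (subst openin_subopen, intro ballI)
    fix x assume x: "x \<in> f -` W \<inter> topspace Y"
    then obtain U where U: "openin Y U" "x \<in> U" "\<And>y. y \<in> U \<Longrightarrow> q (f y \<ominus> f x) < e - q (f x \<ominus> z)"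
      using assms(2)[of x q "e - q (f x \<ominus> z)"] W by auto
    have "y \<in> f -` W" if "y \<in> U" for y
    proof -
      have yX: "y \<in> topspace Y" using that U(1) openin_subset by blast
      have "q (f y \<ominus> z) \<le> q (f y \<ominus> f x) + q (f x \<ominus> z)"
        using Q_diff_trans[OF W(2) into[OF yX] into, of x z] x W(3) by auto
      then show ?thesis using U(3)[OF that] into[OF yX] W(1) by auto
    qed
    then show "\<exists>U. openin Y U \<and> x \<in> U \<and> U \<subseteq> f -` W \<inter> topspace Y"
      using U openin_subset[OF U(1)] by blast
  qed
next
  case 2
  show ?case
    using into topspace_T unfolding seminorm_topology_def topology_generated_by_topspace by blast
qed

lemma sum_Q_small:
  assumes F: "finite F" "F \<subseteq> Q" and \<eta>: "0 < \<eta>" and x: "x \<in> carrier V"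
  shows "\<exists>U. openin T U \<and> x \<in> U \<and> U \<subseteq> carrier V \<and> (\<forall>y\<in>U. (\<Sum>r\<in>F. r (y \<ominus> x)) < \<eta>)"
proof -
  \<comment> \<open>The summand 1 covers the empty set and makes the final estimate strict.\<close>
  define \<delta> where "\<delta> = \<eta> / (real (card F) + 1)"
  have \<delta>: "\<delta> > 0" using \<eta> by (simp add: \<delta>_def)
  let ?U = "{y \<in> carrier V. \<forall>q\<in>F. q (y \<ominus> x) < \<delta>}"
  have "(\<Sum>r\<in>F. r (y \<ominus> x)) < \<eta>" if "y \<in> ?U" for y
  proof -
    have "(\<Sum>r\<in>F. r (y \<ominus> x)) \<le> real (card F) * \<delta>"
      using that by (intro sum_bounded_above) (auto intro: less_imp_le)
    also have "\<dots> < \<eta>" using \<eta> by (simp add: \<delta>_def field_simps)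
    finally show ?thesis .
  qed
  moreover have "openin T ?U" using openin_finite_ball[OF F x \<delta>] .
  moreover have "x \<in> ?U" using x F \<delta> by auto
  ultimately show ?thesis by blast
qed

text \<open>Stated for additive maps because conjugation is only antilinear.\<close>

lemma continuous_map_additive:
  assumes closed: "\<And>x. x \<in> carrier V \<Longrightarrow> L x \<in> carrier V"
    and add: "\<And>x y. x \<in> carrier V \<Longrightarrow> y \<in> carrier V \<Longrightarrow> L (x \<oplus> y) = L x \<oplus> L y"
    and bound: "\<And>q. q \<in> Q \<Longrightarrow> \<exists>C r. r \<in> Q \<and> (\<forall>x\<in>carrier V. q (L x) \<le> C * r x)"
  shows "continuous_map T T L"
proof (rule continuous_map_into_seminorm_topology)
  fix x q and e :: real assume "x \<in> topspace T" and q: "q \<in> Q" and e: "0 < e"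
  then have x: "x \<in> carrier V" by simp
  obtain C r where r: "r \<in> Q" and Cr: "\<And>x. x \<in> carrier V \<Longrightarrow> q (L x) \<le> C * r x"
    using bound[OF q] by blast
  define \<delta> where "\<delta> = e / (\<bar>C\<bar> + 1)"
  have \<delta>: "\<delta> > 0" using e by (simp add: \<delta>_def)
  have "q (L y \<ominus> L x) < e" if y: "y \<in> carrier V" "r (y \<ominus> x) < \<delta>" for y
  proof -
    have d: "y \<ominus> x \<in> carrier V" using x y by simp
    have "L y = L (y \<ominus> x) \<oplus> L x" using add[OF d x] x y by (simp add: diff_add)
    then have "L y \<ominus> L x = L (y \<ominus> x)" by (intro diff_eqI) (use x y d closed in auto)
    then have "q (L y \<ominus> L x) \<le> C * r (y \<ominus> x)" using Cr[OF d] by simp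
    also have "\<dots> \<le> (\<bar>C\<bar> + 1) * r (y \<ominus> x)" by (intro mult_right_mono) (use Q_nonneg[OF r d] in auto)
    also have "\<dots> < (\<bar>C\<bar> + 1) * \<delta>" using y by (intro mult_strict_left_mono) auto
    also have "\<dots> = e" by (simp add: \<delta>_def)
    finally show ?thesis .
  qed
  then show "\<exists>U. openin T U \<and> x \<in> U \<and> (\<forall>y\<in>U. q (L y \<ominus> L x) < e)"
    using x \<delta> r by (intro exI[of _ "{y \<in> carrier V. r (y \<ominus> x) < \<delta>}"]) (auto intro!: openin_seminorm_ball)
qed (use closed in auto)

text \<open>With increments d and d' the difference B y y' - B x x' equals B d d' + B d x' + B x d'.
  The bound admits a finite sum of seminorms because the bracket involves several
  derivatives.\<close>

lemma continuous_map_biadditive: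
  assumes closed: "\<And>x y. x \<in> carrier V \<Longrightarrow> y \<in> carrier V \<Longrightarrow> B x y \<in> carrier V"
    and addl: "\<And>x y z. x \<in> carrier V \<Longrightarrow> y \<in> carrier V \<Longrightarrow> z \<in> carrier V \<Longrightarrow> B (x \<oplus> y) z = B x z \<oplus> B y z"
    and addr: "\<And>x y z. x \<in> carrier V \<Longrightarrow> y \<in> carrier V \<Longrightarrow> z \<in> carrier V \<Longrightarrow> B z (x \<oplus> y) = B z x \<oplus> B z y"
    and bound: "\<And>q. q \<in> Q \<Longrightarrow> \<exists>C F. finite F \<and> F \<subseteq> Q \<and>
       (\<forall>x\<in>carrier V. \<forall>y\<in>carrier V. q (B x y) \<le> C * (\<Sum>r\<in>F. r x) * (\<Sum>r\<in>F. r y))"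
  shows "continuous_map (prod_topology T T) T (\<lambda>(x, y). B x y)"
proof (rule continuous_map_into_seminorm_topology)
  fix xx q and e :: real assume "xx \<in> topspace (prod_topology T T)" and q: "q \<in> Q" and e: "0 < e"
  then obtain x x' where xx: "xx = (x, x')" and x: "x \<in> carrier V" "x' \<in> carrier V" by auto
  obtain C F where F: "finite F" "F \<subseteq> Q"
    and CF: "\<And>x y. x \<in> carrier V \<Longrightarrow> y \<in> carrier V \<Longrightarrow> q (B x y) \<le> C * (\<Sum>r\<in>F. r x) * (\<Sum>r\<in>F. r y)"
    using bound[OF q] by blast
  define P where "P = (\<lambda>x. \<Sum>r\<in>F. r x)"
  have P0: "0 \<le> P x" if "x \<in> carrier V" for x
    unfolding P_def using F that Q_nonneg by (intro sum_nonneg) auto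
  define D where "D = \<bar>C\<bar> + 1"
  have CP: "q (B x y) \<le> D * (P x * P y)" if "x \<in> carrier V" "y \<in> carrier V" for x y
  proof -
    have "q (B x y) \<le> C * (P x * P y)" using CF[OF that] by (simp add: P_def mult.assoc)
    also have "\<dots> \<le> D * (P x * P y)" by (intro mult_right_mono) (use P0 that in \<open>auto simp: D_def\<close>)
    finally show ?thesis .
  qed
  define K where "K = 1 + P x + P x'"
  have K: "K > 0" using P0 x by (simp add: K_def add_pos_nonneg)
  \<comment> \<open>Since \<open>\<eta> \<le> 1\<close>, the product of two increments is at most a
    single one, so the three terms together stay below \<open>\<eta> * K\<close>.\<close>
  define \<eta> where "\<eta> = min 1 (e / (D * K))"
  have D: "D > 0" by (simp add: D_def)
  have \<eta>: "0 < \<eta>" "\<eta> \<le> 1" "D * (\<eta> * K) \<le> e"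
  proof -
    show "0 < \<eta>" using e K D by (simp add: \<eta>_def)
    show "\<eta> \<le> 1" by (simp add: \<eta>_def)
    have "\<eta> \<le> e / (D * K)" by (simp add: \<eta>_def)
    then show "D * (\<eta> * K) \<le> e" using D K by (simp add: field_simps)
  qed
  obtain U where U: "openin T U" "x \<in> U" "U \<subseteq> carrier V" "\<And>y. y \<in> U \<Longrightarrow> P (y \<ominus> x) < \<eta>"
    using sum_Q_small[OF F \<eta>(1) x(1)] unfolding P_def by blast
  obtain U' where U': "openin T U'" "x' \<in> U'" "U' \<subseteq> carrier V" "\<And>y. y \<in> U' \<Longrightarrow> P (y \<ominus> x') < \<eta>"
    using sum_Q_small[OF F \<eta>(1) x(2)] unfolding P_def by blast
  have "q (B y y' \<ominus> B x x') < e" if yU: "y \<in> U" "y' \<in> U'" for y y'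
  proof -
    have y: "y \<in> carrier V" "y' \<in> carrier V" using yU U U' by auto
    define d where "d = y \<ominus> x"
    define d' where "d' = y' \<ominus> x'"
    have d: "d \<in> carrier V" "d' \<in> carrier V" using x y by (auto simp: d_def d'_def)
    have "B y y' = B (d \<oplus> x) (d' \<oplus> x')" using x y by (simp add: d_def d'_def diff_add)
    also have "\<dots> = B d (d' \<oplus> x') \<oplus> B x (d' \<oplus> x')" using x d by (intro addl) auto
    also have "\<dots> = (B d d' \<oplus> B d x') \<oplus> (B x d' \<oplus> B x x')"
      using x d by (simp only: addr)
    also have "\<dots> = (B d d' \<oplus> B d x') \<oplus> B x d' \<oplus> B x x'"
      using x d closed by (simp add: M.a_assoc)
    finally have eq: "B y y' \<ominus> B x x' = (B d d' \<oplus> B d x') \<oplus> B x d'"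
      by (intro diff_eqI) (use x y d closed in auto)
    have "q (B y y' \<ominus> B x x') \<le> q (B d d') + q (B d x') + q (B x d')"
    proof -
      have "B d d' \<in> carrier V" "B d x' \<in> carrier V" "B x d' \<in> carrier V"
        using closed d x by blast+
      then show ?thesis unfolding eq
        using Q_triangle[OF q, of "B d d' \<oplus> B d x'" "B x d'"] Q_triangle[OF q, of "B d d'" "B d x'"]
        by simp
    qed
    also have "\<dots> \<le> D * (P d * P d') + D * (P d * P x') + D * (P x * P d')"
      using CP d x by (intro add_mono) auto
    also have "\<dots> = D * (P d * P d' + P d * P x' + P x * P d')" by (simp add: algebra_simps)
    also have "\<dots> < D * (\<eta> * K)"
    proof (rule mult_strict_left_mono[OF _ D])
      have 1: "P d < \<eta>" "P d' < \<eta>" using U(4) U'(4) yU by (auto simp: d_def d'_def)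
      have "P d * P d' + P d * P x' + P x * P d' \<le> P d * 1 + \<eta> * P x' + P x * \<eta>"
        using 1 P0 d x \<eta> by (intro add_mono mult_left_mono mult_right_mono) auto
      also have "\<dots> < \<eta> * K" using 1 by (simp add: K_def algebra_simps)
      finally show "P d * P d' + P d * P x' + P x * P d' < \<eta> * K" .
    qed
    also have "\<dots> \<le> e" by (rule \<eta>)
    finally show ?thesis .
  qed
  then show "\<exists>W. openin (prod_topology T T) W \<and> xx \<in> W \<and>
      (\<forall>yy\<in>W. q ((case yy of (x, y) \<Rightarrow> B x y) \<ominus> (case xx of (x, y) \<Rightarrow> B x y)) < e)"
    using U U' xx by (intro exI[of _ "U \<times> U'"]) (auto simp: openin_prod_Times_iff)
qed (use closed in auto)

lemma continuous_map_add: "continuous_map (prod_topology T T) T (\<lambda>(x, y). x \<oplus> y)"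
proof (rule continuous_map_into_seminorm_topology)
  fix xx q and e :: real assume "xx \<in> topspace (prod_topology T T)" and q: "q \<in> Q" and e: "0 < e"
  then obtain x x' where xx: "xx = (x, x')" and x: "x \<in> carrier V" "x' \<in> carrier V" by auto
  let ?U = "\<lambda>x. {y \<in> carrier V. q (y \<ominus> x) < e/2}"
  have "q ((y \<oplus> y') \<ominus> (x \<oplus> x')) < e" if "y \<in> ?U x" "y' \<in> ?U x'" for y y'
  proof -
    have "q ((y \<oplus> y') \<ominus> (x \<oplus> x')) = q ((y \<ominus> x) \<oplus> (y' \<ominus> x'))"
      using that x by (simp add: add_diff_add)
    also have "\<dots> \<le> q (y \<ominus> x) + q (y' \<ominus> x')" using that x q by (intro Q_triangle) auto
    also have "\<dots> < e" using that by simp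
    finally show ?thesis .
  qed
  moreover have "openin T (?U x)" "openin T (?U x')" using x e q by (simp_all only: openin_seminorm_ball half_gt_zero)
  then have "openin (prod_topology T T) (?U x \<times> ?U x')" by (simp add: openin_prod_Times_iff)
  moreover have "xx \<in> ?U x \<times> ?U x'" using x e q xx by auto
  ultimately show "\<exists>W. openin (prod_topology T T) W \<and> xx \<in> W \<and>
      (\<forall>yy\<in>W. q ((case yy of (x, y) \<Rightarrow> x \<oplus> y) \<ominus> (case xx of (x, y) \<Rightarrow> x \<oplus> y)) < e)"
    using xx by (intro exI[of _ "?U x \<times> ?U x'"]) auto
qed auto

text \<open>The same expansion as for a biadditive map, with the modulus measuring the increment of
  the scalar.\<close>

lemma continuous_map_scale: "continuous_map (prod_topology euclidean T) T (\<lambda>(c, x). c \<odot> x)"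
proof (rule continuous_map_into_seminorm_topology)
  fix xx :: "complex \<times> 'v" and q and e :: real
  assume "xx \<in> topspace (prod_topology euclidean T)" and q: "q \<in> Q" and e: "0 < e"
  then obtain c x where xx: "xx = (c, x)" and x: "x \<in> carrier V" by auto
  define K where "K = 1 + q x + cmod c"
  have K: "K > 0" using Q_nonneg[OF q x] by (simp add: K_def add_pos_nonneg)
  define \<eta> where "\<eta> = min 1 (e / K)"
  have \<eta>: "0 < \<eta>" "\<eta> \<le> 1" "\<eta> * K \<le> e"
  proof -
    show "0 < \<eta>" using e K by (simp add: \<eta>_def)
    show "\<eta> \<le> 1" by (simp add: \<eta>_def)
    have "\<eta> \<le> e / K" by (simp add: \<eta>_def)
    then show "\<eta> * K \<le> e" using K by (simp add: field_simps)
  qed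
  let ?U = "{y \<in> carrier V. q (y \<ominus> x) < \<eta>}"
  have "q (b \<odot> y \<ominus> c \<odot> x) < e" if "b \<in> ball c \<eta>" "y \<in> ?U" for b y
  proof -
    have y: "y \<in> carrier V" using that by simp
    define d where "d = y \<ominus> x"
    have d: "d \<in> carrier V" "y = d \<oplus> x" using x y by (auto simp: d_def diff_add)
    have "b \<odot> y = (b - c) \<odot> y \<oplus> c \<odot> y" using scale_add_left[OF y, of "b - c" c] by simp
    also have "\<dots> = ((b - c) \<odot> d \<oplus> (b - c) \<odot> x) \<oplus> c \<odot> d \<oplus> c \<odot> x"
      using d x by (simp add: scale_add_right M.a_assoc)
    finally have eq: "b \<odot> y \<ominus> c \<odot> x = ((b - c) \<odot> d \<oplus> (b - c) \<odot> x) \<oplus> c \<odot> d"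
      by (intro diff_eqI) (use x y d in auto)
    have bc: "cmod (b - c) < \<eta>" and qd: "q d < \<eta>" using that by (auto simp: dist_norm norm_minus_commute d_def)
    have "q (b \<odot> y \<ominus> c \<odot> x) \<le> q ((b - c) \<odot> d) + q ((b - c) \<odot> x) + q (c \<odot> d)"
      unfolding eq using Q_triangle[OF q, of "(b - c) \<odot> d \<oplus> (b - c) \<odot> x" "c \<odot> d"]
        Q_triangle[OF q, of "(b - c) \<odot> d" "(b - c) \<odot> x"] d x by force
    also have "\<dots> = cmod (b - c) * q d + cmod (b - c) * q x + cmod c * q d"
      using q d x by (simp add: Q_scale)
    also have "\<dots> \<le> 1 * q d + \<eta> * q x + cmod c * \<eta>"
      using bc qd \<eta> Q_nonneg[OF q d(1)] Q_nonneg[OF q x] by (intro add_mono mult_left_mono mult_right_mono) auto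
    also have "\<dots> < \<eta> * K" using qd by (simp add: K_def algebra_simps)
    also have "\<dots> \<le> e" by (rule \<eta>)
    finally show ?thesis .
  qed
  moreover have "openin (prod_topology euclidean T) (ball c \<eta> \<times> ?U)" "xx \<in> ball c \<eta> \<times> ?U"
    using x \<eta> q xx by (auto simp: openin_prod_Times_iff intro!: openin_seminorm_ball)
  ultimately show "\<exists>W. openin (prod_topology euclidean T) W \<and> xx \<in> W \<and>
      (\<forall>yy\<in>W. q ((case yy of (c, x) \<Rightarrow> c \<odot> x) \<ominus> (case xx of (c, x) \<Rightarrow> c \<odot> x)) < e)"
    using xx by (intro exI[of _ "ball c \<eta> \<times> ?U"]) auto
qed auto

lemma frechet_spaceI:
  assumes countable: "countable Q"
    and separating: "\<And>x. x \<in> carrier V \<Longrightarrow> (\<And>q. q \<in> Q \<Longrightarrow> q x = 0) \<Longrightarrow> x = \<zero>"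
    and complete: "\<And>\<sigma>. range \<sigma> \<subseteq> carrier V \<Longrightarrow>
       (\<And>q e. q \<in> Q \<Longrightarrow> 0 < e \<Longrightarrow> \<exists>K. \<forall>i\<ge>K. \<forall>j\<ge>K. q (\<sigma> i \<ominus> \<sigma> j) < e) \<Longrightarrow>
       \<exists>x\<in>carrier V. \<forall>q\<in>Q. (\<lambda>i. q (\<sigma> i \<ominus> x)) \<longlonglongrightarrow> (0::real)"
  shows "frechet_space V T"
proof -
  define s where "s = from_nat_into Q"
  have s_range: "range s = Q" using countable Q_nonempty by (simp add: s_def range_from_nat_into)
  have sQ [simp, intro]: "s k \<in> Q" for k using s_range by blast
  \<comment> \<open>The cut-off 1/(k+1) tends to 0. Taking a supremum in place of the usual weighted
    series lets upper bounds on \<open>d\<close>, in particular the triangle inequality, be checked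
    for each \<open>k\<close> separately.\<close>
  define b where "b k x y = min (inverse (real (Suc k))) (s k (x \<ominus> y))" for k x y
  \<comment> \<open>The value 0 off the carrier keeps \<open>d\<close> symmetric and nonnegative for
    all arguments, as \<open>Metric_space\<close> demands.\<close>
  define d where "d x y = (if x \<in> carrier V \<and> y \<in> carrier V then (SUP k. b k x y) else 0)" for x y
  have b_le1: "b k x y \<le> 1" for k x y
    unfolding b_def by (rule min.coboundedI1) (simp add: inverse_le_1_iff)
  have bdd: "bdd_above (range (\<lambda>k. b k x y))" for x y
    using b_le1 by (intro bdd_aboveI[of _ 1]) auto
  have d_le: "d x y \<le> r \<longleftrightarrow> (\<forall>k. b k x y \<le> r)" if "x \<in> carrier V" "y \<in> carrier V" for x y r
    using that by (simp add: d_def cSUP_le_iff[OF _ bdd])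
  have b_nonneg: "0 \<le> b k x y" if "x \<in> carrier V" "y \<in> carrier V" for k x y
    using that by (auto simp: b_def intro!: Q_nonneg)
  have b_le_d: "b k x y \<le> d x y" if "x \<in> carrier V" "y \<in> carrier V" for k x y
    using d_le[OF that, of "d x y"] by auto
  interpret d: Metric_space "carrier V" d
  proof
    show "0 \<le> d x y" for x y
    proof (cases "x \<in> carrier V \<and> y \<in> carrier V")
      case True
      then show ?thesis using b_nonneg[of x y 0] b_le_d[of x y 0] by linarith
    qed (auto simp: d_def)
    show "d x y = d y x" for x y
      by (auto simp: d_def b_def Q_diff_commute intro!: arg_cong[where f = Sup] image_cong)
    show "d x y = 0 \<longleftrightarrow> x = y" if xy: "x \<in> carrier V" "y \<in> carrier V" for x y
    proof
      assume "d x y = 0"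
      have "q (x \<ominus> y) = 0" if q: "q \<in> Q" for q
      proof -
        obtain k where k: "q = s k" using s_range q by auto
        have "b k x y \<le> 0" using b_le_d[OF xy, of k] \<open>d x y = 0\<close> by simp
        then have "s k (x \<ominus> y) \<le> 0" 
          by (auto simp: b_def min_le_iff_disj simp del: of_nat_Suc)
        then show ?thesis using Q_nonneg[of "s k" "x \<ominus> y"] xy k by auto
      qed
      then have z: "x \<ominus> y = \<zero>" using xy by (intro separating) auto
      have "x = (x \<ominus> y) \<oplus> y" using xy by (simp add: diff_add)
      then show "x = y" using z xy by simp
    next
      assume "x = y"
      then have "d x y \<le> 0" using xy by (subst d_le) (auto simp: b_def min_le_iff_disj)
      moreover have "0 \<le> d x y" using b_nonneg[OF xy, of 0] b_le_d[OF xy, of 0] by linarith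
      ultimately show "d x y = 0" by simp
    qed
    show "d x z \<le> d x y + d y z"
      if xyz: "x \<in> carrier V" "y \<in> carrier V" "z \<in> carrier V" for x y z
    proof (subst d_le[OF xyz(1,3)], intro allI)
      fix k
      have "b k x z \<le> b k x y + b k y z"
        using Q_diff_trans[OF sQ xyz, of k] b_nonneg[OF xyz(1,2), of k] b_nonneg[OF xyz(2,3), of k]
        unfolding b_def by linarith
      also have "\<dots> \<le> d x y + d y z" using b_le_d xyz by (intro add_mono) auto
      finally show "b k x z \<le> d x y + d y z" .
    qed
  qed
  have small_Suc: "\<exists>K. \<forall>k\<ge>K. inverse (real (Suc k)) < r" if r: "0 < r" for r :: real
  proof -
    obtain K where K: "inverse (real (Suc K)) < r" using reals_Archimedean[OF r] by blast
    have "inverse (real (Suc k)) < r" if "k \<ge> K" for k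
      using that K le_imp_inverse_le[of "real (Suc K)" "real (Suc k)"] by linarith
    then show ?thesis by blast
  qed
  \<comment> \<open>Since \<open>b k \<le> 1/(k+1)\<close>, only finitely many seminorms matter at a given scale.\<close>
  have finite_ball: "\<exists>F e. finite F \<and> F \<subseteq> Q \<and> 0 < e \<and> {y \<in> carrier V. \<forall>q\<in>F. q (y \<ominus> x) < e} \<subseteq> d.mball x r"
    if x: "x \<in> carrier V" and r: "0 < r" for x r
  proof -
    obtain K where K: "\<And>k. k \<ge> K \<Longrightarrow> inverse (real (Suc k)) < r/2" using small_Suc[of "r/2"] r by auto
    have "y \<in> d.mball x r" if y: "y \<in> carrier V" "\<forall>q\<in>s ` {..<K}. q (y \<ominus> x) < r/2" for y
    proof -
      have "b k x y \<le> r/2" for k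
      proof (cases "k < K")
        case True
        then have "s k (x \<ominus> y) < r/2" using y x Q_diff_commute[OF sQ x y(1), of k] by auto
        then show ?thesis by (simp add: b_def)
      next
        case False
        then show ?thesis using K[of k] by (simp add: b_def)
      qed
      then have "d x y \<le> r/2" using d_le x y by blast
      then show ?thesis using x y r by simp
    qed
    then show ?thesis using r
      by (intro exI[of _ "s ` {..<K}"] exI[of _ "r/2"]) auto
  qed
  have top_eq: "d.mtopology = T"
  proof (rule topology_eq[THEN iffD2], intro allI iffI)
    fix U assume U: "openin d.mtopology U"
    show "openin T U"
    proof (subst openin_subopen, intro ballI)
      fix x assume x: "x \<in> U"
      then obtain r where r: "0 < r" "d.mball x r \<subseteq> U" using U by (auto simp: d.openin_mtopology)
      have xV: "x \<in> carrier V" using U x by (auto simp: d.openin_mtopology)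
      obtain F e where F: "finite F" "F \<subseteq> Q" "0 < e"
          "{y \<in> carrier V. \<forall>q\<in>F. q (y \<ominus> x) < e} \<subseteq> d.mball x r"
        using finite_ball[OF xV r(1)] by blast
      have "x \<in> {y \<in> carrier V. \<forall>q\<in>F. q (y \<ominus> x) < e}" using xV F by auto
      then show "\<exists>W. openin T W \<and> x \<in> W \<and> W \<subseteq> U"
        using openin_finite_ball[OF F(1,2) xV F(3)] F(4) r(2) by blast
    qed
  next
    have "continuous_map d.mtopology T id"
    proof (rule continuous_map_into_seminorm_topology)
      fix x q and e :: real assume "x \<in> topspace d.mtopology" and q: "q \<in> Q" and e: "0 < e"
      then have x: "x \<in> carrier V" by simp
      obtain k where k: "q = s k" using s_range q by auto
      \<comment> \<open>Below 1/(k+1) the cut-off in \<open>b\<close> is inactive, so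
        \<open>b k x y < r\<close> bounds the seminorm itself.\<close>
      define r where "r = min e (inverse (real (Suc k)))"
      have r: "r > 0" using e by (simp add: r_def)
      have "q (y \<ominus> x) < e" if y: "y \<in> d.mball x r" for y
      proof -
        have yV: "y \<in> carrier V" and "b k x y < r" using y b_le_d[OF x, of y k] by auto
        then have "s k (x \<ominus> y) < e" by (auto simp: b_def r_def)
        then show ?thesis using k Q_diff_commute[OF sQ x yV, of k] by simp
      qed
      then show "\<exists>U. openin d.mtopology U \<and> x \<in> U \<and> (\<forall>y\<in>U. q (id y \<ominus> id x) < e)"
        using x r by (intro exI[of _ "d.mball x r"]) auto
    qed simp
    moreover fix U assume U: "openin T U"
    ultimately have "openin d.mtopology {x \<in> topspace d.mtopology. id x \<in> U}"
      by (rule openin_continuous_map_preimage)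
    moreover have "{x \<in> topspace d.mtopology. id x \<in> U} = U"
      using openin_subset[OF U] by auto
    ultimately show "openin d.mtopology U" by simp
  qed
  have mcomplete: "d.mcomplete"
    unfolding d.mcomplete_def
  proof (intro allI impI)
    fix \<sigma> assume \<sigma>: "d.MCauchy \<sigma>"
    have "\<exists>K. \<forall>i\<ge>K. \<forall>j\<ge>K. q (\<sigma> i \<ominus> \<sigma> j) < e" if q: "q \<in> Q" and e: "0 < e" for q e
    proof -
      obtain k where k: "q = s k" using s_range q by auto
      define r where "r = min e (inverse (real (Suc k)))"
      have "r > 0" using e by (simp add: r_def)
      then obtain K where K: "\<And>i j. K \<le> i \<Longrightarrow> K \<le> j \<Longrightarrow> d (\<sigma> i) (\<sigma> j) < r"
        using \<sigma> unfolding d.MCauchy_def by blast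
      have "q (\<sigma> i \<ominus> \<sigma> j) < e" if "i \<ge> K" "j \<ge> K" for i j
      proof -
        have "\<sigma> i \<in> carrier V" "\<sigma> j \<in> carrier V" using \<sigma> unfolding d.MCauchy_def by auto
        then have "b k (\<sigma> i) (\<sigma> j) < r" using b_le_d[of "\<sigma> i" "\<sigma> j" k] K[OF that] by linarith
        then show ?thesis by (auto simp: b_def r_def k)
      qed
      then show ?thesis by blast
    qed
    moreover have \<sigma>V: "range \<sigma> \<subseteq> carrier V" using \<sigma> unfolding d.MCauchy_def by auto
    ultimately obtain x where x: "x \<in> carrier V" and lim: "\<And>q. q \<in> Q \<Longrightarrow> (\<lambda>i. q (\<sigma> i \<ominus> x)) \<longlonglongrightarrow> 0"
      using complete[of \<sigma>] by blast
    have "limitin d.mtopology \<sigma> x sequentially"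
      unfolding d.limitin_metric
    proof (intro conjI allI impI x)
      fix r :: real assume "0 < r"
      obtain F e where F: "finite F" "F \<subseteq> Q" "0 < e"
          "{y \<in> carrier V. \<forall>q\<in>F. q (y \<ominus> x) < e} \<subseteq> d.mball x r"
        using finite_ball[OF x \<open>0 < r\<close>] by blast
      have "\<forall>\<^sub>F i in sequentially. \<forall>q\<in>F. q (\<sigma> i \<ominus> x) < e"
        using F lim by (intro eventually_ball_finite ballI order_tendstoD(2)[of _ 0]) auto
      then show "\<forall>\<^sub>F i in sequentially. \<sigma> i \<in> carrier V \<and> d (\<sigma> i) x < r"
      proof (rule eventually_mono)
        fix i assume "\<forall>q\<in>F. q (\<sigma> i \<ominus> x) < e"
        then have "\<sigma> i \<in> d.mball x r" using F(4) \<sigma>V by blast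
        then show "\<sigma> i \<in> carrier V \<and> d (\<sigma> i) x < r" by (simp add: d.commute)
      qed
    qed
    then show "\<exists>x. limitin d.mtopology \<sigma> x sequentially" by blast
  qed
  have invariant: "d (x \<oplus> z) (y \<oplus> z) = d x y"
    if "x \<in> carrier V" "y \<in> carrier V" "z \<in> carrier V" for x y z
  proof -
    have "(x \<oplus> z) \<ominus> (y \<oplus> z) = x \<ominus> y"
      using that by (simp add: add_diff_add)
    then show ?thesis using that by (simp add: d_def b_def)
  qed
  have convex: "\<exists>W. openin T W \<and> \<zero> \<in> W \<and> W \<subseteq> U \<and>
           (\<forall>x\<in>W. \<forall>y\<in>W. \<forall>t\<in>{0..1}.
              complex_of_real (1 - t) \<odot> x \<oplus> complex_of_real t \<odot> y \<in> W)"
    if U: "openin T U" "\<zero> \<in> U" for U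
  proof -
    obtain r where r: "0 < r" "d.mball \<zero> r \<subseteq> U"
      using U top_eq by (metis d.openin_mtopology)
    obtain F e where F: "finite F" "F \<subseteq> Q" "0 < e"
        "{y \<in> carrier V. \<forall>q\<in>F. q (y \<ominus> \<zero>) < e} \<subseteq> d.mball \<zero> r"
      using finite_ball[OF M.zero_closed r(1)] by blast
    define W where "W = {y \<in> carrier V. \<forall>q\<in>F. q y < e}"
    have diff0: "y \<ominus> \<zero> = y" if "y \<in> carrier V" for y
      by (rule diff_eqI) (use that in auto)
    have W_eq: "W = {y \<in> carrier V. \<forall>q\<in>F. q (y \<ominus> \<zero>) < e}" by (auto simp: W_def diff0)
    have "complex_of_real (1 - t) \<odot> x \<oplus> complex_of_real t \<odot> y \<in> W"
      if xy: "x \<in> W" "y \<in> W" and t: "t \<in> {0..1}" for x y t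
    proof -
      have V: "x \<in> carrier V" "y \<in> carrier V" using xy by (auto simp: W_def)
      have "q (complex_of_real (1 - t) \<odot> x \<oplus> complex_of_real t \<odot> y) < e" if q: "q \<in> F" for q
      proof -
        have qQ: "q \<in> Q" using q F by auto
        have "q (complex_of_real (1 - t) \<odot> x \<oplus> complex_of_real t \<odot> y)
            \<le> q (complex_of_real (1 - t) \<odot> x) + q (complex_of_real t \<odot> y)"
          using qQ V by (intro Q_triangle) auto
        also have "\<dots> = (1 - t) * q x + t * q y"
          using qQ V t by (simp add: Q_scale del: of_real_diff)
        also have "\<dots> < e"
        proof (rule convex_bound_lt)
          show "q x < e" "q y < e" using xy q by (auto simp: W_def)
        qed (use t in auto)
        finally show ?thesis .
      qed
      then show ?thesis using V by (auto simp: W_def)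
    qed
    moreover have "openin T W" unfolding W_eq using F by (intro openin_finite_ball) auto
    moreover have "\<zero> \<in> W" using F by (auto simp: W_def)
    moreover have "W \<subseteq> U" using F(4) r(2) unfolding W_eq by (rule order_trans)
    ultimately show ?thesis by (intro exI[of _ W] conjI ballI)
  qed
  show ?thesis
    unfolding frechet_space_def
  proof (intro conjI allI impI)
    show "module ring_of_type_algebra V" by (rule module_axioms)
    show "\<exists>d. Metric_space (carrier V) d \<and> Metric_space.mtopology (carrier V) d = T \<and>
        Metric_space.mcomplete (carrier V) d \<and>
        (\<forall>x\<in>carrier V. \<forall>y\<in>carrier V. \<forall>z\<in>carrier V. d (x \<oplus> z) (y \<oplus> z) = d x y)"
      using d.Metric_space_axioms top_eq mcomplete invariant by (intro exI[of _ d] conjI ballI)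
  qed (simp_all only: continuous_map_add continuous_map_scale topspace_T convex)
qed

end

section \<open>The space of arrays with finite seminorms, and its completeness\<close>

section \<open>The seminorms on coefficient arrays\<close>

definition hn :: "real \<Rightarrow> nat \<Rightarrow> nat \<Rightarrow> nat^'n::finite \<Rightarrow> nat^'n \<Rightarrow> ('n, complex) array \<Rightarrow> real" where
  "hn hbar m l R S a = enn2real (hc hbar m l a R S) powr (1 / 2 ^ (m + 1))"

definition fin_coeffs :: "real \<Rightarrow> ('n::finite, complex) array set" where
  "fin_coeffs hbar = {a. \<forall>m. \<forall>l<2^m. \<forall>R S. hc hbar m l a R S < \<infinity>}"

lemma fin_coeffsD: "a \<in> fin_coeffs hbar \<Longrightarrow> l < 2 ^ m \<Longrightarrow> hc hbar m l a R S < \<infinity>"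
  by (simp add: fin_coeffs_def)

lemma power_powr_inverse:
  assumes "0 \<le> x" "0 < k" shows "(x ^ k) powr (1 / real k) = x"
proof (cases "x = 0")
  case False
  then have "0 < x" using assms by simp
  then show ?thesis using assms by (simp add: powr_realpow[symmetric] powr_powr)
qed (use assms in simp)

lemma hn_nonneg [simp]: "0 \<le> hn hbar m l R S a"
  by (simp add: hn_def)

lemma hc_eq_hn_power:
  assumes "hc hbar m l a R S < \<infinity>"
  shows "hc hbar m l a R S = ennreal (hn hbar m l R S a ^ (2 ^ (m + 1)))"
proof -
  have *: "(x powr (1 / 2 ^ (m + 1))) ^ (2 ^ (m + 1)) = x" if "0 \<le> x" for x :: real
  proof (cases "x = 0")
    case False
    then have "0 < x powr (1 / 2 ^ (m + 1))" using that by simp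
    then have "(x powr (1 / 2 ^ (m + 1))) ^ (2 ^ (m + 1)) = (x powr (1 / 2 ^ (m + 1))) powr real (2 ^ (m + 1))"
      by (rule powr_realpow[symmetric])
    also have "\<dots> = x" using that False by (simp add: powr_powr)
    finally show ?thesis .
  qed (simp add: zero_power)
  have "hn hbar m l R S a ^ (2 ^ (m + 1)) = enn2real (hc hbar m l a R S)"
    unfolding hn_def by (rule *[OF enn2real_nonneg])
  then show ?thesis using assms by simp
qed

lemma hn_le_iff:
  assumes "0 \<le> r"
  shows "hc hbar m l a R S < \<infinity> \<and> hn hbar m l R S a \<le> r \<longleftrightarrow> hc hbar m l a R S \<le> ennreal (r ^ (2 ^ (m + 1)))"
    (is "?l \<longleftrightarrow> ?r")
proof
  assume ?l
  then show ?r using hc_eq_hn_power[of hbar m l a R S] by (auto intro!: ennreal_leI power_mono)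
next
  assume r: ?r
  then have fin: "hc hbar m l a R S < \<infinity>" by (rule le_less_trans) simp
  then have "hn hbar m l R S a ^ (2 ^ (m + 1)) \<le> r ^ (2 ^ (m + 1))"
    using r hc_eq_hn_power[OF fin] assms by simp
  then have "hn hbar m l R S a \<le> r" 
    using assms by (subst (asm) power_mono_iff) auto
  then show ?l using fin by simp
qed

lemma hc_scale_less_top: "hc hbar m l a R S < \<infinity> \<Longrightarrow> hc hbar m l (\<lambda>R S. c * a R S) R S < \<infinity>"
  unfolding hc_scale by (simp add: ennreal_mult_less_top)

lemma hn_scale: "hn hbar m l R S (\<lambda>R S. c * a R S) = norm c * hn hbar m l R S a"
proof -
  have "(norm c ^ 2 ^ (m + 1)) powr (1 / 2 ^ (m + 1)) = norm c"
    using power_powr_inverse[of "norm c" "2 ^ (m + 1)"] by simp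
  then show ?thesis unfolding hn_def hc_scale by (simp add: enn2real_mult powr_mult)
qed

text \<open>Minkowski's gauge argument: the arrays where \<open>hc\<close> is at most 1 form a
  convex set, and the sum is a multiple of a convex combination of the normalised arrays.\<close>

lemma hc_hn_add:
  assumes hbar: "0 < hbar" and fin: "hc hbar m l a R S < \<infinity>" "hc hbar m l b R S < \<infinity>"
  shows "hc hbar m l (\<lambda>R S. a R S + b R S) R S < \<infinity> \<and>
    hn hbar m l R S (\<lambda>R S. a R S + b R S) \<le> hn hbar m l R S a + hn hbar m l R S b"
proof -
  let ?n = "hn hbar m l R S" and ?k = "2 ^ (m + 1) :: nat"
  have main: "hc hbar m l (\<lambda>R S. a R S + b R S) R S < \<infinity> \<and> ?n (\<lambda>R S. a R S + b R S) \<le> (?n a + ?n b) + e" if e: "0 < e" for e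
  proof -
    \<comment> \<open>The summand \<open>e / 2\<close> keeps the normalising factors positive when a
      seminorm vanishes.\<close>
    define s where "s = ?n a + e / 2"
    define t where "t = ?n b + e / 2"
    have st: "0 < s" "0 < t" "?n a \<le> s" "?n b \<le> t" using e hn_nonneg[of hbar m l R S] by (auto simp: s_def t_def add_nonneg_pos)
    have unit: "hc hbar m l (\<lambda>R S. of_real (1 / r) * c R S) R S \<le> 1" if "0 < r" "?n c \<le> r" "hc hbar m l c R S < \<infinity>" for r c
    proof -
      have "?n (\<lambda>R S. of_real (1 / r) * c R S) \<le> 1"
        using that unfolding hn_scale by (simp add: norm_divide)
      then show ?thesis
        using hn_le_iff[of 1 hbar m l "\<lambda>R S. of_real (1 / r) * c R S" R S] hc_scale_less_top[OF that(3), of "of_real (1 / r)"] by simp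
    qed
    let ?u = "\<lambda>R S. of_real (s / (s + t)) * (of_real (1 / s) * a R S) + of_real (t / (s + t)) * (of_real (1 / t) * b R S)"
    have "hc hbar m l ?u R S
        \<le> ennreal (s / (s + t)) * hc hbar m l (\<lambda>R S. of_real (1 / s) * a R S) R S + ennreal (t / (s + t)) * hc hbar m l (\<lambda>R S. of_real (1 / t) * b R S) R S"
      using st by (intro hc_convex hbar) (auto simp: add_divide_distrib[symmetric])
    also have "\<dots> \<le> ennreal (s / (s + t)) * 1 + ennreal (t / (s + t)) * 1"
      using st fin by (intro add_mono mult_left_mono unit) auto
    also have "\<dots> = 1" using st by (simp add: ennreal_plus[symmetric] add_divide_distrib[symmetric] del: ennreal_plus)
    finally have u: "hc hbar m l ?u R S < \<infinity> \<and> ?n ?u \<le> 1"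
      using hn_le_iff[of 1 hbar m l ?u R S] by simp
    have eq: "(\<lambda>R S. a R S + b R S) = (\<lambda>R S. of_real (s + t) * ?u R S)"
      using st by (intro ext) (simp add: distrib_left field_simps flip: of_real_add)
    have "?n (\<lambda>R S. a R S + b R S) = (s + t) * ?n ?u" 
      unfolding eq hn_scale norm_of_real using st by (simp only: abs_of_pos add_pos_pos)
    also have "\<dots> \<le> (s + t) * 1" using u st by (intro mult_left_mono) auto
    finally have "?n (\<lambda>R S. a R S + b R S) \<le> (?n a + ?n b) + e" by (simp add: s_def t_def)
    moreover have "hc hbar m l (\<lambda>R S. a R S + b R S) R S < \<infinity>"
      unfolding eq using u by (intro hc_scale_less_top) simp
    ultimately show ?thesis by simp
  qed
  show ?thesis using main[OF zero_less_one] main by (auto intro: field_le_epsilon)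
qed

lemma fin_coeffs_add: "0 < hbar \<Longrightarrow> a \<in> fin_coeffs hbar \<Longrightarrow> b \<in> fin_coeffs hbar \<Longrightarrow> (\<lambda>R S. a R S + b R S) \<in> fin_coeffs hbar"
  using hc_hn_add unfolding fin_coeffs_def by blast

lemma fin_coeffs_cmult: "a \<in> fin_coeffs hbar \<Longrightarrow> (\<lambda>R S. c * a R S) \<in> fin_coeffs hbar"
  using hc_scale_less_top unfolding fin_coeffs_def by blast

lemma fin_coeffs_zero: "(\<lambda>R S. 0) \<in> fin_coeffs hbar"
proof -
  have "hc hbar m l (\<lambda>R S. 0) R S = 0" for m l and R S :: "nat^'a"
    using hc_scale[of hbar m l 0 "\<lambda>R S. 0" R S] by (simp add: power_0_left)
  then show ?thesis unfolding fin_coeffs_def by simp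
qed

lemma fin_coeffs_diff:
  assumes "0 < hbar" "a \<in> fin_coeffs hbar" "b \<in> fin_coeffs hbar" shows "(\<lambda>R S. a R S - b R S) \<in> fin_coeffs hbar"
  using fin_coeffs_add[OF assms(1,2) fin_coeffs_cmult[OF assms(3), of "-1"]] by simp

lemma fin_coeffs_sum:
  assumes "0 < hbar" "\<And>k. k \<in> F \<Longrightarrow> a k \<in> fin_coeffs hbar" shows "(\<lambda>R S. \<Sum>k\<in>F. a k R S) \<in> fin_coeffs hbar"
  using assms(2) by (induction F rule: infinite_finite_induct) (auto intro: fin_coeffs_zero fin_coeffs_add[OF assms(1)])

lemma hn_add:
  "0 < hbar \<Longrightarrow> l < 2 ^ m \<Longrightarrow> a \<in> fin_coeffs hbar \<Longrightarrow> b \<in> fin_coeffs hbar \<Longrightarrow>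
    hn hbar m l R S (\<lambda>R S. a R S + b R S) \<le> hn hbar m l R S a + hn hbar m l R S b"
  using hc_hn_add fin_coeffsD by blast

lemma hn_sum:
  assumes "0 < hbar" "l < 2 ^ m" "\<And>k. k \<in> F \<Longrightarrow> a k \<in> fin_coeffs hbar"
  shows "hn hbar m l R S (\<lambda>R S. \<Sum>k\<in>F. a k R S) \<le> (\<Sum>k\<in>F. hn hbar m l R S (a k))"
  using assms(3)
proof (induction F rule: infinite_finite_induct)
  case (insert k F)
  have "hn hbar m l R S (\<lambda>R S. a k R S + (\<Sum>k\<in>F. a k R S)) \<le> hn hbar m l R S (a k) + hn hbar m l R S (\<lambda>R S. \<Sum>k\<in>F. a k R S)"
    using insert.prems by (intro hn_add assms(1,2) fin_coeffs_sum) auto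
  then show ?case using insert by force
qed (use hn_scale[of hbar m l R S 0 "\<lambda>R S. 0"] in auto)

text \<open>The square on the left and the additional level on the right give the same exponent
  \<open>2 ^ (m + 2)\<close>, so the estimate has constant 1.\<close>

lemma hn_conv:
  assumes "0 < hbar" "l < 2 ^ m" "a \<in> fin_coeffs hbar" "b \<in> fin_coeffs hbar"
  shows "hc hbar m l (conv a b) R S < \<infinity> \<and>
    hn hbar m l R S (conv a b) \<le> hn hbar (Suc m) l R S a * hn hbar (Suc m) l R S b"
proof -
  let ?s = "hn hbar (Suc m) l R S a" and ?t = "hn hbar (Suc m) l R S b"
  have l: "l < 2 ^ Suc m" using assms(2) by simp
  have "(hc hbar m l (conv a b) R S)\<^sup>2 \<le> hc hbar (Suc m) l a R S * hc hbar (Suc m) l b R S"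
    by (rule hc_conv[OF assms(1,2)])
  also have "\<dots> = ennreal (?s ^ 2 ^ (Suc m + 1)) * ennreal (?t ^ 2 ^ (Suc m + 1))"
    using hc_eq_hn_power[OF fin_coeffsD[OF assms(3) l]] hc_eq_hn_power[OF fin_coeffsD[OF assms(4) l]] by simp
  also have "\<dots> = (ennreal ((?s * ?t) ^ 2 ^ (m + 1)))\<^sup>2"
    by (simp add: ennreal_mult[symmetric] ennreal_power power_mult_distrib power_mult[symmetric] mult.commute)
  finally have "hc hbar m l (conv a b) R S \<le> ennreal ((?s * ?t) ^ 2 ^ (m + 1))"
    by (simp only: ennreal_mono_power2_iff)
  then show ?thesis by (subst hn_le_iff) auto
qed

lemma fin_coeffs_conv:
  "0 < hbar \<Longrightarrow> a \<in> fin_coeffs hbar \<Longrightarrow> b \<in> fin_coeffs hbar \<Longrightarrow> conv a b \<in> fin_coeffs hbar"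
  unfolding fin_coeffs_def[of hbar] using hn_conv[of hbar _ _ a b] by (auto simp: fin_coeffs_def)

text \<open>Takes the place of a root: a number that is at least 1 is dominated by its
  powers.\<close>

lemma ennreal_le_power:
  assumes "d < \<infinity>" shows "\<exists>C\<ge>1. d \<le> ennreal (C ^ 2 ^ m)"
proof (intro exI conjI)
  let ?C = "1 + enn2real d"
  show "1 \<le> ?C" by simp
  have "enn2real d \<le> ?C ^ 1" by simp
  also have "\<dots> \<le> ?C ^ 2 ^ m" by (rule power_increasing) auto
  finally have "ennreal (enn2real d) \<le> ennreal (?C ^ 2 ^ m)" by (rule ennreal_leI)
  moreover have "ennreal (enn2real d) = d" using assms by simp
  ultimately show "d \<le> ennreal (?C ^ 2 ^ m)" by (simp only:)
qed

text \<open>The constant depends on \<open>R\<close> and \<open>S\<close> through \<open>K\<close>,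
  but not on \<open>a\<close>. Exponential growth of \<open>K\<close> enters as finiteness of
  \<open>K R S\<close>.\<close>

lemma hn_star:
  fixes R S :: "nat^'n::finite"
  assumes "l < 2 ^ m"
  shows "\<exists>C\<ge>0. \<forall>a\<in>fin_coeffs hbar. hc hbar m l (star a) R S < \<infinity> \<and>
      hn hbar m l R S (star a) \<le> C * hn hbar (Suc m) (l + 2 ^ m) R S a"
proof -
  obtain K :: "('n, ennreal) array" where K: "exp_bounded K"
    "\<And>a R S. (hc hbar m l (star a) R S)\<^sup>2 \<le> K R S * hc hbar (Suc m) (l + 2 ^ m) a R S"
    using hc_star[OF assms, of hbar] by blast
  obtain C where C: "1 \<le> C" and KC: "K R S \<le> ennreal (C ^ 2 ^ (Suc m + 1))"
    using ennreal_le_power[OF exp_bounded_less_top[OF K(1)]] by blast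
  have "hc hbar m l (star a) R S < \<infinity> \<and> hn hbar m l R S (star a) \<le> C * hn hbar (Suc m) (l + 2 ^ m) R S a"
    if a: "a \<in> fin_coeffs hbar" for a
  proof -
    let ?s = "hn hbar (Suc m) (l + 2 ^ m) R S a"
    have l: "l + 2 ^ m < 2 ^ Suc m" using assms by simp
    have "(hc hbar m l (star a) R S)\<^sup>2 \<le> K R S * hc hbar (Suc m) (l + 2 ^ m) a R S" by (rule K)
    also have "\<dots> \<le> ennreal (C ^ 2 ^ (Suc m + 1)) * ennreal (?s ^ 2 ^ (Suc m + 1))"
      unfolding hc_eq_hn_power[OF fin_coeffsD[OF a l]] by (intro mult_right_mono KC) simp
    also have "\<dots> = (ennreal ((C * ?s) ^ 2 ^ (m + 1)))\<^sup>2"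
      using C by (simp add: ennreal_mult[symmetric] ennreal_power power_mult_distrib power_mult[symmetric] mult.commute)
    finally have "hc hbar m l (star a) R S \<le> ennreal ((C * ?s) ^ 2 ^ (m + 1))"
      by (simp only: ennreal_mono_power2_iff)
    then show ?thesis using C by (subst hn_le_iff) auto
  qed
  then show ?thesis using C by (intro exI[of _ C]) auto
qed

lemma fin_coeffs_star: "a \<in> fin_coeffs hbar \<Longrightarrow> star a \<in> fin_coeffs hbar"
  using hn_star unfolding fin_coeffs_def[of hbar] by (auto simp: fin_coeffs_def) blast

text \<open>\<open>True\<close> stands for the derivative in z, \<open>False\<close> for the one in
  its conjugate.\<close>

definition shift :: "bool \<Rightarrow> 'n::finite \<Rightarrow> ('n, complex) array \<Rightarrow> ('n, complex) array" where
  "shift c k a = (if c then (\<lambda>R S. a (R + unit_index k) S) else (\<lambda>R S. a R (S + unit_index k)))"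

lemma hn_shift:
  assumes "0 < hbar" "l < 2 ^ m"
  shows "\<exists>C R' S'. 0 \<le> C \<and> (\<forall>a\<in>fin_coeffs hbar. hc hbar m l (shift c k a) R S < \<infinity> \<and>
      hn hbar m l R S (shift c k a) \<le> C * hn hbar m l R' S' a)"
proof -
  have "shift_le (unit_index k) (\<lambda>a. wt hbar (shift c k a)) (wt hbar)"
    using wt_shift_le[OF assms(1), of "unit_index k"] by (cases c) (simp_all add: shift_def)
  then have "shift_le (unit_index k) (\<lambda>a. hc hbar m l (shift c k a)) (hc hbar m l)" by (rule shift_le_hc)
  then obtain d R' S' where d: "d < \<infinity>" "\<And>a. hc hbar m l (shift c k a) R S \<le> d * hc hbar m l a R' S'"
    unfolding shift_le_def by blast
  obtain C where C: "1 \<le> C" and dC: "d \<le> ennreal (C ^ 2 ^ (m + 1))"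
    using ennreal_le_power[OF d(1)] by blast
  have "hc hbar m l (shift c k a) R S < \<infinity> \<and> hn hbar m l R S (shift c k a) \<le> C * hn hbar m l R' S' a"
    if a: "a \<in> fin_coeffs hbar" for a
  proof -
    have "hc hbar m l (shift c k a) R S \<le> d * hc hbar m l a R' S'" by (rule d)
    also have "\<dots> \<le> ennreal (C ^ 2 ^ (m + 1)) * ennreal (hn hbar m l R' S' a ^ 2 ^ (m + 1))"
      unfolding hc_eq_hn_power[OF fin_coeffsD[OF a assms(2)]] by (intro mult_right_mono dC) simp
    also have "\<dots> = ennreal ((C * hn hbar m l R' S' a) ^ 2 ^ (m + 1))"
      using C by (simp add: ennreal_mult[symmetric] power_mult_distrib)
    finally show ?thesis using C by (subst hn_le_iff) auto
  qed
  then show ?thesis using C by (intro exI[of _ C] exI[of _ R'] exI[of _ S']) auto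
qed

lemma fin_coeffs_shift:
  assumes "0 < hbar" "a \<in> fin_coeffs hbar" shows "shift c k a \<in> fin_coeffs hbar"
  using hn_shift[OF assms(1)] assms(2) unfolding fin_coeffs_def[of hbar] by (auto simp: fin_coeffs_def) blast

text \<open>The term \<open>N = 0\<close> at level 0. It makes each coefficient a continuous
  functional, which gives the separation property and coefficientwise limits.\<close>

lemma coeff_le_hn:
  assumes "0 < hbar" "hc hbar 0 0 a R S < \<infinity>"
  shows "norm (a R S) \<le> hn hbar 0 0 R S a / sqrt ((2 * hbar) ^ (mabs R + mabs S))"
proof -
  let ?w = "(2 * hbar) ^ (mabs R + mabs S)"
  have w: "0 < ?w" using assms by simp
  have "wt hbar a R S \<le> hc hbar 0 0 a R S" by (simp add: le_fsum)
  also have "\<dots> = ennreal ((hn hbar 0 0 R S a)\<^sup>2)" using hc_eq_hn_power[OF assms(2)] by simp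
  finally have "?w * (norm (a R S))\<^sup>2 \<le> (hn hbar 0 0 R S a)\<^sup>2" by (simp add: wt_def)
  then have "(sqrt ?w * norm (a R S))\<^sup>2 \<le> (hn hbar 0 0 R S a)\<^sup>2" using w by (simp add: power_mult_distrib)
  then have "sqrt ?w * norm (a R S) \<le> hn hbar 0 0 R S a" by (rule power2_le_imp_le) simp
  then show ?thesis using w by (simp add: field_simps)
qed

text \<open>The limit is taken coefficient by coefficient. Fatou, applied to the Cauchy estimate for
  \<open>\<sigma> i\<close> and \<open>\<sigma> j\<close> as j grows, bounds the seminorms of the
  difference between \<open>\<sigma> i\<close> and the limit.\<close>

lemma hn_complete:
  fixes \<sigma> :: "nat \<Rightarrow> ('n::finite, complex) array"
  assumes hbar: "0 < hbar" and \<sigma>: "\<And>i. \<sigma> i \<in> fin_coeffs hbar"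
    and cauchy: "\<And>m l R S e. l < 2 ^ m \<Longrightarrow> 0 < e \<Longrightarrow>
       \<exists>K. \<forall>i\<ge>K. \<forall>j\<ge>K. hn hbar m l R S (\<lambda>R S. \<sigma> i R S - \<sigma> j R S) < e"
  shows "\<exists>a\<in>fin_coeffs hbar. \<forall>m l R S. l < 2 ^ m \<longrightarrow>
     (\<lambda>i. hn hbar m l R S (\<lambda>R S. \<sigma> i R S - a R S)) \<longlonglongrightarrow> 0"
proof -
  have diff: "(\<lambda>R S. \<sigma> i R S - \<sigma> j R S) \<in> fin_coeffs hbar" for i j
    by (intro fin_coeffs_diff hbar \<sigma>)
  have "\<exists>x. (\<lambda>i. \<sigma> i R S) \<longlonglongrightarrow> x" for R S
  proof -
    let ?w = "sqrt ((2 * hbar) ^ (mabs R + mabs S))"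
    have w: "0 < ?w" using hbar by simp
    have "Cauchy (\<lambda>i. \<sigma> i R S)"
      unfolding Cauchy_def
    proof (intro allI impI)
      fix e :: real assume "0 < e"
      then obtain K where K: "\<And>i j. K \<le> i \<Longrightarrow> K \<le> j \<Longrightarrow> hn hbar 0 0 R S (\<lambda>R S. \<sigma> i R S - \<sigma> j R S) < e * ?w"
        using cauchy[of 0 0 "e * ?w" R S] w by auto
      have "dist (\<sigma> i R S) (\<sigma> j R S) < e" if "K \<le> i" "K \<le> j" for i j
      proof -
        have "hc hbar 0 0 (\<lambda>R S. \<sigma> i R S - \<sigma> j R S) R S < \<infinity>" using fin_coeffsD[OF diff, of 0 0] by simp
        from coeff_le_hn[OF hbar this] have "norm (\<sigma> i R S - \<sigma> j R S) \<le> hn hbar 0 0 R S (\<lambda>R S. \<sigma> i R S - \<sigma> j R S) / ?w" .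
        also have "\<dots> < e" using K[OF that] w by (simp add: pos_divide_less_eq)
        finally show ?thesis by (simp add: dist_norm)
      qed
      then show "\<exists>K. \<forall>i\<ge>K. \<forall>j\<ge>K. dist (\<sigma> i R S) (\<sigma> j R S) < e" by blast
    qed
    then show ?thesis using Cauchy_convergent_iff convergent_def by blast
  qed
  then obtain a where a: "\<And>R S. (\<lambda>i. \<sigma> i R S) \<longlonglongrightarrow> a R S" by metis
  have close: "\<exists>K. \<forall>i\<ge>K. hc hbar m l (\<lambda>R S. \<sigma> i R S - a R S) R S < \<infinity> \<and> hn hbar m l R S (\<lambda>R S. \<sigma> i R S - a R S) \<le> e"
    if l: "l < 2 ^ m" and e: "0 < e" for m l R S e
  proof -
    obtain K where K: "\<And>i j. K \<le> i \<Longrightarrow> K \<le> j \<Longrightarrow> hn hbar m l R S (\<lambda>R S. \<sigma> i R S - \<sigma> j R S) < e"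
      using cauchy[OF l e] by blast
    have "hc hbar m l (\<lambda>R S. \<sigma> i R S - a R S) R S \<le> ennreal (e ^ 2 ^ (m + 1))" if "K \<le> i" for i
    proof (rule hc_limit_le)
      show "(\<lambda>j. \<sigma> i R S - \<sigma> j R S) \<longlonglongrightarrow> \<sigma> i R S - a R S" for R S by (intro tendsto_intros a)
      show "hc hbar m l (\<lambda>R S. \<sigma> i R S - \<sigma> j R S) R S \<le> ennreal (e ^ 2 ^ (m + 1))" if "K \<le> j" for j
        using hn_le_iff[of e hbar m l "\<lambda>R S. \<sigma> i R S - \<sigma> j R S" R S] e fin_coeffsD[OF diff l] K[OF \<open>K \<le> i\<close> that] by auto
    qed
    then show ?thesis using hn_le_iff[of e hbar m l _ R S] e by (intro exI[of _ K]) auto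
  qed
  have "a \<in> fin_coeffs hbar"
    unfolding fin_coeffs_def
  proof (intro CollectI allI impI)
    fix m l :: nat and R S assume l: "l < 2 ^ m"
    obtain i where i: "hc hbar m l (\<lambda>R S. \<sigma> i R S - a R S) R S < \<infinity>" using close[OF l zero_less_one] by blast
    \<comment> \<open>The limit is \<open>\<sigma> i\<close> minus a difference whose seminorm is
      finite.\<close>
    have "hc hbar m l (\<lambda>R S. \<sigma> i R S + (-1) * (\<sigma> i R S - a R S)) R S < \<infinity>"
      using hc_hn_add[OF hbar fin_coeffsD[OF \<sigma> l] hc_scale_less_top[OF i]] by blast
    then show "hc hbar m l a R S < \<infinity>" by simp
  qed
  moreover have "(\<lambda>i. hn hbar m l R S (\<lambda>R S. \<sigma> i R S - a R S)) \<longlonglongrightarrow> 0" if l: "l < 2 ^ m" for m l R S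
  proof (rule LIMSEQ_I)
    fix e :: real assume "0 < e"
    then obtain K where K: "\<And>i. K \<le> i \<Longrightarrow> hn hbar m l R S (\<lambda>R S. \<sigma> i R S - a R S) \<le> e / 2"
      using close[OF l half_gt_zero[OF \<open>0 < e\<close>], of R S] by blast
    have "norm (hn hbar m l R S (\<lambda>R S. \<sigma> i R S - a R S) - 0) < e" if "K \<le> i" for i
      using K[OF that] \<open>0 < e\<close> by simp
    then show "\<exists>K. \<forall>i\<ge>K. norm (hn hbar m l R S (\<lambda>R S. \<sigma> i R S - a R S) - 0) < e" by blast
  qed
  ultimately show ?thesis by blast
qed

lemma hn_separating:
  assumes "0 < hbar" "a \<in> fin_coeffs hbar" "\<And>R S. hn hbar 0 0 R S a = 0"
  shows "a = (\<lambda>R S. 0)"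
proof (intro ext)
  fix R S
  have "hc hbar 0 0 a R S < \<infinity>" using fin_coeffsD[OF assms(2), of 0 0] by simp
  from coeff_le_hn[OF assms(1) this] show "a R S = 0" by (simp add: assms(3))
qed

lemma fin_coeffs_entire:
  assumes "0 < hbar" "a \<in> fin_coeffs hbar" shows "entire_coeffs a"
proof -
  have "hc hbar 1 1 a 0 0 < \<infinity>" using fin_coeffsD[OF assms(2), of 1 1] by simp
  then show ?thesis using hc_growth[OF assms(1)] entire_coeffsI_growth[OF assms(1)] by blast
qed

section \<open>Passage from arrays to classes of functions\<close>

section \<open>Jets and germs\<close>

definition jet :: "complex^'n::finite \<Rightarrow> (complex^'n \<Rightarrow> complex) \<Rightarrow> ('n, complex) array" where
  "jet p f = (\<lambda>R S. wderiv R S f p)"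

text \<open>The fibre of the jet map over \<open>a\<close>; as soon as it is nonempty it is a class
  of the quotient.\<close>

definition germ :: "complex^'n::finite \<Rightarrow> ('n, complex) array \<Rightarrow> (complex^'n \<Rightarrow> complex) set" where
  "germ p a = {f. smooth f \<and> jet p f = a}"

lemma jet_add: "smooth f \<Longrightarrow> smooth g \<Longrightarrow> jet p (\<lambda>x. f x + g x) = (\<lambda>R S. jet p f R S + jet p g R S)"
  by (simp add: jet_def wderiv_add)

lemma jet_cmult: "smooth f \<Longrightarrow> jet p (\<lambda>x. c * f x) = (\<lambda>R S. c * jet p f R S)"
  by (simp add: jet_def wderiv_cmult)

lemma jet_mult: "smooth f \<Longrightarrow> smooth g \<Longrightarrow> jet p (\<lambda>x. f x * g x) = conv (jet p f) (jet p g)"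
  by (intro ext) (simp add: jet_def wderiv_mult conv_def)

lemma jet_cnj: "smooth f \<Longrightarrow> jet p (\<lambda>x. cnj (f x)) = star (jet p f)"
  by (intro ext) (simp add: jet_def wderiv_cnj star_def)

lemma jet_dz: "smooth f \<Longrightarrow> jet p (dz k f) = shift True k (jet p f)"
  by (simp add: jet_def shift_def wderiv_dz)

lemma jet_dzbar: "smooth f \<Longrightarrow> jet p (dzbar k f) = shift False k (jet p f)"
  by (simp add: jet_def shift_def wderiv_dzbar)

lemma jet_zero: "jet p (\<lambda>x. 0) = (\<lambda>R S. 0)"
  using jet_cmult[OF smooth_const[of 0], of p 0] by simp

lemma jet_sum:
  assumes "\<And>k. k \<in> F \<Longrightarrow> smooth (f k)"
  shows "jet p (\<lambda>x. \<Sum>k\<in>F. f k x) = (\<lambda>R S. \<Sum>k\<in>F. jet p (f k) R S)"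
  using assms by (induction F rule: infinite_finite_induct) (simp_all add: jet_zero jet_add smooth_sum)

text \<open>Written with sums and scalar multiples only, so that the lemmas for these two operations
  apply to every part.\<close>

definition pois :: "('n::finite, complex) array \<Rightarrow> ('n, complex) array \<Rightarrow> ('n, complex) array" where
  "pois a b = (\<lambda>R S. 2 / \<i> * (\<Sum>k\<in>UNIV. conv (shift True k a) (shift False k b) R S
      + (-1) * conv (shift False k a) (shift True k b) R S))"

lemma poisson_eq: "poisson f g = (\<lambda>x. 2 / \<i> * (\<Sum>k\<in>UNIV. dz k f x * dzbar k g x + (-1) * (dzbar k f x * dz k g x)))"
  by (intro ext) (simp add: poisson_def)

lemma smooth_poisson: "smooth f \<Longrightarrow> smooth g \<Longrightarrow> smooth (poisson f g)"
  unfolding poisson_eq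
  by (intro smooth_cmult smooth_sum smooth_add smooth_mult dz.smooth_d dzbar.smooth_d)

lemma jet_poisson:
  assumes "smooth f" "smooth g" shows "jet p (poisson f g) = pois (jet p f) (jet p g)"
proof -
  have sm: "smooth (\<lambda>x. dz k f x * dzbar k g x)" "smooth (\<lambda>x. dzbar k f x * dz k g x)" for k
    using assms by (intro smooth_mult dz.smooth_d dzbar.smooth_d; simp)+
  show ?thesis
    unfolding poisson_eq pois_def
    by (simp only: jet_cmult jet_sum jet_add jet_mult smooth_sum smooth_add smooth_cmult sm assms
        dz.smooth_d dzbar.smooth_d jet_dz jet_dzbar)
qed

text \<open>Two smooth functions have the same jet exactly when their difference has a vanishing
  one.\<close>

lemma jet_class_eq_germ:
  assumes f: "smooth f" shows "jet_class p f = germ p (jet p f)"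
proof (rule Set.set_eqI)
  fix g
  show "g \<in> jet_class p f \<longleftrightarrow> g \<in> germ p (jet p f)"
  proof
    assume "g \<in> jet_class p f"
    then obtain u where u: "g = (\<lambda>x. f x + u x)" "smooth u" "\<And>R S. wderiv R S u p = 0"
      by (auto simp: jet_class_def jet_null_def)
    then have "jet p u = (\<lambda>R S. 0)" by (simp add: jet_def)
    then show "g \<in> germ p (jet p f)" using u f by (simp add: germ_def smooth_add jet_add)
  next
    assume "g \<in> germ p (jet p f)"
    then have g: "smooth g" "jet p g = jet p f" by (auto simp: germ_def)
    define u where "u = (\<lambda>x. g x + (-1) * f x)"
    have "smooth u" unfolding u_def by (intro smooth_add smooth_cmult f g)
    moreover have "jet p u = (\<lambda>R S. 0)"
      unfolding u_def jet_add[OF g(1) smooth_cmult[OF f]] jet_cmult[OF f] g(2) by simp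
    then have "wderiv R S u p = 0" for R S by (simp add: jet_def fun_eq_iff)
    ultimately have "u \<in> jet_null p" by (simp add: jet_null_def)
    moreover have "g = (\<lambda>x. f x + u x)" by (simp add: u_def)
    ultimately show "g \<in> jet_class p f" by (auto simp: jet_class_def)
  qed
qed

text \<open>All members of the union defining \<open>lift2\<close> are the same class; nonempty
  fibres guarantee that there is a member.\<close>

lemma lift2_germ:
  assumes "germ p a \<noteq> {}" "germ p b \<noteq> {}"
    and F: "\<And>f g. smooth f \<Longrightarrow> smooth g \<Longrightarrow> smooth (F f g)"
    and \<Phi>: "\<And>f g. smooth f \<Longrightarrow> smooth g \<Longrightarrow> jet p (F f g) = \<Phi> (jet p f) (jet p g)"
  shows "lift2 p F (germ p a) (germ p b) = germ p (\<Phi> a b)"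
proof -
  have "jet_class p (F f g) = germ p (\<Phi> a b)" if "f \<in> germ p a" "g \<in> germ p b" for f g
    using that by (auto simp: germ_def[of p a] germ_def[of p b] jet_class_eq_germ F \<Phi>)
  then show ?thesis using assms(1,2) unfolding lift2_def by auto
qed

lemma lift1_germ:
  assumes "germ p a \<noteq> {}"
    and F: "\<And>f. smooth f \<Longrightarrow> smooth (F f)"
    and \<Phi>: "\<And>f. smooth f \<Longrightarrow> jet p (F f) = \<Phi> (jet p f)"
  shows "lift1 p F (germ p a) = germ p (\<Phi> a)"
proof -
  have "jet_class p (F f) = germ p (\<Phi> a)" if "f \<in> germ p a" for f
    using that by (auto simp: germ_def[of p a] jet_class_eq_germ F \<Phi>)
  then show ?thesis using assms(1) unfolding lift1_def by auto
qed

lemma ex_smooth_jet: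
  assumes "0 < hbar" "a \<in> fin_coeffs hbar" shows "\<exists>f. smooth f \<and> jet p f = a"
  using fin_coeffs_entire[OF assms]
  by (intro exI[of _ "cseries a p"]) (simp add: smooth_cseries jet_def wderiv_cseries_center)

lemma germ_nonempty: "0 < hbar \<Longrightarrow> a \<in> fin_coeffs hbar \<Longrightarrow> germ p a \<noteq> {}"
  using ex_smooth_jet unfolding germ_def by blast

lemma mem_A_tilde: "0 < hbar \<Longrightarrow> f \<in> A_tilde p hbar \<longleftrightarrow> smooth f \<and> jet p f \<in> fin_coeffs hbar"
  by (simp add: A_tilde_def fin_coeffs_def h_eq_hc jet_def)

text \<open>The inclusion from right to left is where Taylor series are needed: every array in
  \<open>fin_coeffs\<close> has to be the jet of a smooth function.\<close>

lemma A_alg_carrier: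
  assumes "0 < hbar" shows "carrier (A_alg p hbar) = germ p ` fin_coeffs hbar"
proof
  show "carrier (A_alg p hbar) \<subseteq> germ p ` fin_coeffs hbar"
    using mem_A_tilde[OF assms, of _ p] by (auto simp: A_alg_def jet_class_eq_germ)
  show "germ p ` fin_coeffs hbar \<subseteq> carrier (A_alg p hbar)"
  proof
    fix x assume "x \<in> germ p ` fin_coeffs hbar"
    then obtain a where a: "a \<in> fin_coeffs hbar" "x = germ p a" by blast
    then obtain f where f: "smooth f" "jet p f = a" using ex_smooth_jet[OF assms] by blast
    then show "x \<in> carrier (A_alg p hbar)"
      using a mem_A_tilde[OF assms, of f p] by (auto simp: A_alg_def jet_class_eq_germ intro!: image_eqI[of _ _ f])
  qed
qed

lemma A_alg_ops:
  assumes hbar: "0 < hbar" and a: "a \<in> fin_coeffs hbar" and b: "b \<in> fin_coeffs hbar"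
  shows "germ p a \<oplus>\<^bsub>A_alg p hbar\<^esub> germ p b = germ p (\<lambda>R S. a R S + b R S)"
    and "germ p a \<otimes>\<^bsub>A_alg p hbar\<^esub> germ p b = germ p (conv a b)"
    and "c \<odot>\<^bsub>A_alg p hbar\<^esub> germ p a = germ p (\<lambda>R S. c * a R S)"
    and "A_star p (germ p a) = germ p (star a)"
    and "A_bracket p (germ p a) (germ p b) = germ p (pois a b)"
proof -
  note ne = germ_nonempty[OF hbar a, of p] germ_nonempty[OF hbar b, of p]
  have "lift2 p (\<lambda>f g x. f x + g x) (germ p a) (germ p b) = germ p (\<lambda>R S. a R S + b R S)"
    by (rule lift2_germ[OF ne, where \<Phi> = "\<lambda>a b R S. a R S + b R S"]) (simp_all only: smooth_add jet_add)
  then show "germ p a \<oplus>\<^bsub>A_alg p hbar\<^esub> germ p b = germ p (\<lambda>R S. a R S + b R S)"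
    by (simp only: A_alg_def ring.simps)
  have "lift2 p (\<lambda>f g x. f x * g x) (germ p a) (germ p b) = germ p (conv a b)"
    by (rule lift2_germ[OF ne, where \<Phi> = conv]) (simp_all only: smooth_mult jet_mult)
  then show "germ p a \<otimes>\<^bsub>A_alg p hbar\<^esub> germ p b = germ p (conv a b)"
    by (simp only: A_alg_def monoid.simps)
  have "lift1 p (\<lambda>f x. c * f x) (germ p a) = germ p (\<lambda>R S. c * a R S)"
    by (rule lift1_germ[OF ne(1), where \<Phi> = "\<lambda>a R S. c * a R S"]) (simp_all only: smooth_cmult jet_cmult)
  then show "c \<odot>\<^bsub>A_alg p hbar\<^esub> germ p a = germ p (\<lambda>R S. c * a R S)"
    by (simp only: A_alg_def module.simps)
  show "A_star p (germ p a) = germ p (star a)"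
    unfolding A_star_def
    by (rule lift1_germ[OF ne(1), where \<Phi> = star]) (simp_all only: smooth_cnj jet_cnj)
  show "A_bracket p (germ p a) (germ p b) = germ p (pois a b)"
    unfolding A_bracket_def
    by (rule lift2_germ[OF ne, where \<Phi> = pois]) (simp_all only: smooth_poisson jet_poisson)
qed

lemma A_alg_zero: "\<zero>\<^bsub>A_alg p hbar\<^esub> = germ p (\<lambda>R S. 0)"
  by (simp add: A_alg_def jet_class_eq_germ smooth_const jet_zero)

text \<open>\<open>h\<close> reads only the jet, so \<open>snorm\<close> is constant on a fibre and
  \<open>the_elem\<close> is applied to a singleton.\<close>

lemma A_snorm_germ:
  assumes "0 < hbar" "a \<in> fin_coeffs hbar" shows "A_snorm p hbar m l R S (germ p a) = hn hbar m l R S a"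
proof -
  have "snorm p hbar m l R S f = hn hbar m l R S a" if "f \<in> germ p a" for f
    using that h_eq_hc[OF assms(1), of p m l R S f] by (auto simp: snorm_def hn_def germ_def jet_def)
  then have "snorm p hbar m l R S ` germ p a = {hn hbar m l R S a}"
    using germ_nonempty[OF assms, of p] by auto
  then show ?thesis by (simp add: A_snorm_def)
qed

text \<open>Transported from functions: the three arrays are realised as jets at 0, and pointwise
  multiplication is associative. This avoids manipulating multinomial sums.\<close>

lemma conv_assoc:
  assumes "0 < hbar" "a \<in> fin_coeffs hbar" "b \<in> fin_coeffs hbar" "c \<in> fin_coeffs hbar"
  shows "conv (conv a b) c = conv a (conv b c)"
proof -
  obtain f g k :: "complex^'a \<Rightarrow> complex" where
    sm: "smooth f" "smooth g" "smooth k" and jets: "jet 0 f = a" "jet 0 g = b" "jet 0 k = c"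
    using ex_smooth_jet[OF assms(1)] assms(2-4) by metis
  have "conv (conv a b) c = jet 0 (\<lambda>x. (f x * g x) * k x)"
    using sm jets by (simp only: jet_mult smooth_mult)
  also have "\<dots> = conv a (conv b c)"
    using sm jets by (simp only: mult.assoc jet_mult smooth_mult)
  finally show ?thesis .
qed

lemma star_conv:
  assumes "0 < hbar" "a \<in> fin_coeffs hbar" "b \<in> fin_coeffs hbar"
  shows "star (conv a b) = conv (star b) (star a)"
proof -
  obtain f g :: "complex^'a \<Rightarrow> complex" where
    sm: "smooth f" "smooth g" and jets: "jet 0 f = a" "jet 0 g = b"
    using ex_smooth_jet[OF assms(1)] assms(2,3) by metis
  have "star (conv a b) = jet 0 (\<lambda>x. cnj (f x * g x))"
    using sm jets by (simp only: jet_mult smooth_mult jet_cnj)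
  also have "\<dots> = jet 0 (\<lambda>x. cnj (g x) * cnj (f x))" by (simp add: mult.commute)
  also have "\<dots> = conv (star b) (star a)"
    using sm jets by (simp only: jet_mult smooth_cnj jet_cnj)
  finally show ?thesis .
qed

lemma star_star [simp]: "star (star a) = a"
  by (simp add: star_def[abs_def])

lemma star_cmult: "star (\<lambda>R S. c * a R S) = (\<lambda>R S. cnj c * star a R S)"
  by (simp add: star_def[abs_def])

lemma conv_add_left: "conv (\<lambda>R S. a R S + b R S) c = (\<lambda>R S. conv a c R S + conv b c R S)"
  by (intro ext) (simp add: conv_def distrib_right distrib_left sum.distrib)

lemma conv_add_right: "conv c (\<lambda>R S. a R S + b R S) = (\<lambda>R S. conv c a R S + conv c b R S)"
  by (intro ext) (simp add: conv_def distrib_left sum.distrib)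

lemma conv_cmult_left: "conv (\<lambda>R S. c * a R S) b = (\<lambda>R S. c * conv a b R S)"
  by (intro ext) (simp add: conv_def sum_distrib_left mult_ac)

lemma conv_cmult_right: "conv a (\<lambda>R S. c * b R S) = (\<lambda>R S. c * conv a b R S)"
  by (intro ext) (simp add: conv_def sum_distrib_left mult_ac)

lemma shift_add: "shift d k (\<lambda>R S. a R S + b R S) = (\<lambda>R S. shift d k a R S + shift d k b R S)"
  by (simp add: shift_def)

lemma pois_add_left: "pois (\<lambda>R S. a R S + b R S) c = (\<lambda>R S. pois a c R S + pois b c R S)"
  by (intro ext) (simp add: pois_def shift_add conv_add_left distrib_left sum.distrib sum_subtractf algebra_simps)

lemma pois_add_right: "pois c (\<lambda>R S. a R S + b R S) = (\<lambda>R S. pois c a R S + pois c b R S)"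
  by (intro ext) (simp add: pois_def shift_add conv_add_right distrib_left sum.distrib sum_subtractf algebra_simps)

lemma fin_coeffs_pois:
  "0 < hbar \<Longrightarrow> a \<in> fin_coeffs hbar \<Longrightarrow> b \<in> fin_coeffs hbar \<Longrightarrow> pois a b \<in> fin_coeffs hbar"
  unfolding pois_def
  by (intro fin_coeffs_cmult fin_coeffs_sum fin_coeffs_add fin_coeffs_conv fin_coeffs_shift)

text \<open>Each term of the bracket multiplies a derivative in z with one in its conjugate; the
  derivatives shift indices, and the product raises the level by one.\<close>

lemma hn_pois:
  fixes R S :: "nat^'n::finite"
  assumes hbar: "0 < hbar" and l: "l < 2 ^ m"
  shows "\<exists>C F. finite F \<and> (\<forall>a\<in>fin_coeffs hbar. \<forall>b\<in>fin_coeffs hbar.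
      hn hbar m l R S (pois a b) \<le> C * (\<Sum>(R',S')\<in>F. hn hbar (Suc m) l R' S' a) * (\<Sum>(R',S')\<in>F. hn hbar (Suc m) l R' S' b))"
proof -
  have l': "l < 2 ^ Suc m" using l by simp
  have "\<forall>d k. \<exists>C R' S'. 0 \<le> C \<and> (\<forall>a\<in>fin_coeffs hbar. hn hbar (Suc m) l R S (shift d k a) \<le> C * hn hbar (Suc m) l R' S' a)"
    using hn_shift[OF hbar l', where R = R and S = S] by blast
  then obtain C R' S' where C: "\<And>d (k::'n). 0 \<le> C d k"
    "\<And>d k a. a \<in> fin_coeffs hbar \<Longrightarrow> hn hbar (Suc m) l R S (shift d k a) \<le> C d k * hn hbar (Suc m) l (R' d k) (S' d k) a"
    by metis
  \<comment> \<open>The shifted indices for both kinds of derivatives and all coordinates.\<close>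
  define F where "F = (\<lambda>(d,k). (R' d k, S' d k)) ` (UNIV :: (bool \<times> 'n) set)"
  have F: "finite F" by (simp add: F_def)
  define P where "P a = (\<Sum>(R',S')\<in>F. hn hbar (Suc m) l R' S' a)" for a
  have P0: "0 \<le> P a" for a unfolding P_def by (intro sum_nonneg) auto
  have shift_P: "hn hbar (Suc m) l R S (shift d k a) \<le> C d k * P a" if "a \<in> fin_coeffs hbar" for d k a
  proof -
    have "(R' d k, S' d k) \<in> F" by (auto simp: F_def)
    then have "(case (R' d k, S' d k) of (R',S') \<Rightarrow> hn hbar (Suc m) l R' S' a) \<le> P a"
      unfolding P_def using F by (intro member_le_sum) auto
    then have "hn hbar (Suc m) l (R' d k) (S' d k) a \<le> P a" by simp
    then show ?thesis using C(1)[of d k] C(2)[OF that, of d k] by (meson mult_left_mono order_trans)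
  qed
  have conv_P: "hn hbar m l R S (conv (shift d k a) (shift d' k a')) \<le> (C d k * C d' k) * (P a * P a')"
    if "a \<in> fin_coeffs hbar" "a' \<in> fin_coeffs hbar" for d d' k a a'
  proof -
    have "hn hbar m l R S (conv (shift d k a) (shift d' k a'))
        \<le> hn hbar (Suc m) l R S (shift d k a) * hn hbar (Suc m) l R S (shift d' k a')"
      using hn_conv[OF hbar l] fin_coeffs_shift[OF hbar] that by blast
    also have "\<dots> \<le> (C d k * P a) * (C d' k * P a')"
      using that C(1) P0 by (intro mult_mono shift_P) auto
    finally show ?thesis by (simp add: mult_ac)
  qed
  \<comment> \<open>The factor 2 is the modulus of \<open>2 / \<i>\<close>.\<close>
  define D where "D = 2 * (\<Sum>k\<in>UNIV. C True k * C False k + C False k * C True k)"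
  have "hn hbar m l R S (pois a b) \<le> D * P a * P b" if a: "a \<in> fin_coeffs hbar" and b: "b \<in> fin_coeffs hbar" for a b
  proof -
    let ?u = "\<lambda>k. conv (shift True k a) (shift False k b)" and ?v = "\<lambda>k. conv (shift False k a) (shift True k b)"
    have uv: "?u k \<in> fin_coeffs hbar" "?v k \<in> fin_coeffs hbar" for k
      using a b by (intro fin_coeffs_conv fin_coeffs_shift hbar; simp)+
    have uv': "(\<lambda>R S. ?u k R S + (-1) * ?v k R S) \<in> fin_coeffs hbar" for k
      by (intro fin_coeffs_add fin_coeffs_cmult hbar uv)
    have "hn hbar m l R S (pois a b) = 2 * hn hbar m l R S (\<lambda>R S. \<Sum>k\<in>UNIV. ?u k R S + (-1) * ?v k R S)"
      unfolding pois_def hn_scale by (simp add: norm_divide)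
    also have "\<dots> \<le> 2 * (\<Sum>k\<in>UNIV. hn hbar m l R S (\<lambda>R S. ?u k R S + (-1) * ?v k R S))"
      by (intro mult_left_mono hn_sum hbar l uv') auto
    also have "\<dots> \<le> 2 * (\<Sum>k\<in>UNIV. (C True k * C False k) * (P a * P b) + (C False k * C True k) * (P a * P b))"
    proof (intro mult_left_mono sum_mono)
      fix k
      have "hn hbar m l R S (\<lambda>R S. ?u k R S + (-1) * ?v k R S) \<le> hn hbar m l R S (?u k) + hn hbar m l R S (\<lambda>R S. (-1) * ?v k R S)"
        by (intro hn_add hbar l fin_coeffs_cmult uv)
      also have "\<dots> = hn hbar m l R S (?u k) + hn hbar m l R S (?v k)" unfolding hn_scale by simp
      also have "\<dots> \<le> (C True k * C False k) * (P a * P b) + (C False k * C True k) * (P a * P b)"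
        by (intro add_mono conv_P a b)
      finally show "hn hbar m l R S (\<lambda>R S. ?u k R S + (-1) * ?v k R S) \<le> \<dots>" .
    qed simp
    also have "\<dots> = D * P a * P b"
      by (simp add: D_def sum_distrib_right sum_distrib_left algebra_simps)
    finally show ?thesis .
  qed
  then show ?thesis using F unfolding P_def by (intro exI[of _ D] exI[of _ F] conjI ballI)
qed

section \<open>The Frechet-Poisson *-algebra\<close>

definition snorm_set :: "complex^'n::finite \<Rightarrow> real \<Rightarrow> ((complex^'n \<Rightarrow> complex) set \<Rightarrow> real) set" where
  "snorm_set p hbar = {A_snorm p hbar m l R S | m l R S. l < 2^m}"

lemma snorm_setE:
  assumes "q \<in> snorm_set p hbar"
  obtains m l R S where "l < 2 ^ m" "q = A_snorm p hbar m l R S"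
  using assms unfolding snorm_set_def by blast

lemma countable_snorm_set: "countable (snorm_set p hbar)"
proof -
  have "snorm_set p hbar \<subseteq> range (\<lambda>(m, l, R, S). A_snorm p hbar m l R S)"
    unfolding snorm_set_def by (auto intro: range_eqI[of _ _ "(_, _, _, _)"])
  then show ?thesis by (rule countable_subset) simp
qed

lemma seminormed_module_A_alg:
  fixes p :: "complex^'n::finite"
  assumes hbar: "0 < hbar"
  shows "seminormed_module (A_alg p hbar) (snorm_set p hbar)"
proof -
  let ?V = "A_alg p hbar"
  note car = A_alg_carrier[OF hbar, of p] and ops = A_alg_ops[OF hbar, of _ _ p]
  have obt: "\<exists>a. a \<in> fin_coeffs hbar \<and> x = germ p a" if "x \<in> carrier ?V" for x
    using that car by blast
  have mem: "germ p a \<in> carrier ?V" if "a \<in> fin_coeffs hbar" for a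
    using that car by blast
  note fa = fin_coeffs_add[OF hbar] and fc = fin_coeffs_cmult
  have abel: "abelian_group ?V"
  proof (rule abelian_groupI)
    fix x y assume "x \<in> carrier ?V" "y \<in> carrier ?V"
    then obtain a b where ab: "a \<in> fin_coeffs hbar" "x = germ p a" "b \<in> fin_coeffs hbar" "y = germ p b" using obt by blast
    then show "x \<oplus>\<^bsub>?V\<^esub> y \<in> carrier ?V" by (simp add: ops mem fa)
    show "x \<oplus>\<^bsub>?V\<^esub> y = y \<oplus>\<^bsub>?V\<^esub> x" using ab by (simp add: ops add.commute)
    fix z assume "z \<in> carrier ?V"
    then obtain c where c: "c \<in> fin_coeffs hbar" "z = germ p c" using obt by blast
    show "x \<oplus>\<^bsub>?V\<^esub> y \<oplus>\<^bsub>?V\<^esub> z = x \<oplus>\<^bsub>?V\<^esub> (y \<oplus>\<^bsub>?V\<^esub> z)"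
      using ab c by (simp add: ops fa add.assoc)
  next
    show "\<zero>\<^bsub>?V\<^esub> \<in> carrier ?V" by (simp add: A_alg_zero mem fin_coeffs_zero)
  next
    fix x assume "x \<in> carrier ?V"
    then obtain a where a: "a \<in> fin_coeffs hbar" "x = germ p a" using obt by blast
    show "\<zero>\<^bsub>?V\<^esub> \<oplus>\<^bsub>?V\<^esub> x = x" using a by (simp add: A_alg_zero ops fin_coeffs_zero)
    have "germ p (\<lambda>R S. (-1) * a R S) \<oplus>\<^bsub>?V\<^esub> x = \<zero>\<^bsub>?V\<^esub>"
      using a fc[OF a(1), of "-1"] by (simp add: A_alg_zero ops)
    then show "\<exists>y\<in>carrier ?V. y \<oplus>\<^bsub>?V\<^esub> x = \<zero>\<^bsub>?V\<^esub>"
      using mem[OF fc[OF a(1), of "-1"]] by blast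
  qed
  have mod: "module (ring_of_type_algebra :: complex ring) ?V"
  proof (rule moduleI)
    show "cring (ring_of_type_algebra :: complex ring)" by auto
    show "abelian_group ?V" by (rule abel)
  next
    fix c x assume "x \<in> carrier ?V"
    then obtain a where a: "a \<in> fin_coeffs hbar" "x = germ p a" using obt by blast
    show "c \<odot>\<^bsub>?V\<^esub> x \<in> carrier ?V" using a by (simp add: ops(3)[OF a(1) a(1)] mem fc)
  next
    fix c d x assume "x \<in> carrier ?V"
    then obtain a where a: "a \<in> fin_coeffs hbar" "x = germ p a" using obt by blast
    note sm = ops(3)[where b = a]
    show "(c \<oplus>\<^bsub>ring_of_type_algebra\<^esub> d) \<odot>\<^bsub>?V\<^esub> x = c \<odot>\<^bsub>?V\<^esub> x \<oplus>\<^bsub>?V\<^esub> d \<odot>\<^bsub>?V\<^esub> x"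
      using a by (simp add: sm ops(1) fc ring_of_type_algebra_def distrib_right)
    show "(c \<otimes>\<^bsub>ring_of_type_algebra\<^esub> d) \<odot>\<^bsub>?V\<^esub> x = c \<odot>\<^bsub>?V\<^esub> (d \<odot>\<^bsub>?V\<^esub> x)"
      using a by (simp add: sm fc ring_of_type_algebra_def mult.assoc)
  next
    fix c x y assume "x \<in> carrier ?V" "y \<in> carrier ?V"
    then obtain a b where ab: "a \<in> fin_coeffs hbar" "x = germ p a" "b \<in> fin_coeffs hbar" "y = germ p b" using obt by blast
    note sm = ops(3)[where b = a]
    show "c \<odot>\<^bsub>?V\<^esub> (x \<oplus>\<^bsub>?V\<^esub> y) = c \<odot>\<^bsub>?V\<^esub> x \<oplus>\<^bsub>?V\<^esub> c \<odot>\<^bsub>?V\<^esub> y"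
      using ab by (simp add: sm ops(1) fa fc distrib_left)
  next
    fix x assume "x \<in> carrier ?V"
    then obtain a where a: "a \<in> fin_coeffs hbar" "x = germ p a" using obt by blast
    show "\<one>\<^bsub>ring_of_type_algebra\<^esub> \<odot>\<^bsub>?V\<^esub> x = x"
      using a by (simp add: ops(3)[OF a(1) a(1)] ring_of_type_algebra_def)
  qed
  show ?thesis
  proof (rule seminormed_module.intro[OF mod], unfold_locales)
    have "(0::nat) < 2 ^ 0" by simp
    then have "A_snorm p hbar 0 0 0 0 \<in> snorm_set p hbar" unfolding snorm_set_def by blast
    then show "snorm_set p hbar \<noteq> {}" by blast
  next
    fix q x assume "q \<in> snorm_set p hbar" "x \<in> carrier ?V"
    then obtain m l R S a where "q = A_snorm p hbar m l R S" "a \<in> fin_coeffs hbar" "x = germ p a"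
      using obt[of x] by (elim snorm_setE) blast
    then show "0 \<le> q x" by (simp add: A_snorm_germ[OF hbar])
  next
    fix q x y assume q: "q \<in> snorm_set p hbar" and xy: "x \<in> carrier ?V" "y \<in> carrier ?V"
    obtain a where a: "a \<in> fin_coeffs hbar" "x = germ p a" using obt[OF xy(1)] by blast
    obtain b where b: "b \<in> fin_coeffs hbar" "y = germ p b" using obt[OF xy(2)] by blast
    obtain m l R S where "l < 2 ^ m" "q = A_snorm p hbar m l R S" using q by (rule snorm_setE)
    then show "q (x \<oplus>\<^bsub>?V\<^esub> y) \<le> q x + q y"
      using a b by (simp add: A_snorm_germ[OF hbar] ops(1) fa hn_add[OF hbar])
  next
    fix q c x assume q: "q \<in> snorm_set p hbar" and "x \<in> carrier ?V"
    then obtain a where a: "a \<in> fin_coeffs hbar" "x = germ p a" using obt by blast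
    obtain m l R S where "q = A_snorm p hbar m l R S" using q by (rule snorm_setE)
    then show "q (c \<odot>\<^bsub>?V\<^esub> x) = cmod c * q x"
      using a by (simp add: A_snorm_germ[OF hbar] ops(3)[OF a(1) a(1)] fc hn_scale)
  qed
qed

theorem corollary4p4:
  fixes p :: "complex^'n::finite" and hbar :: real
  assumes "hbar > 0"
  shows "frechet_star_algebra (A_alg p hbar) (A_topology p hbar) (A_star p) \<and>
         (\<forall>a\<in>carrier (A_alg p hbar). \<forall>b\<in>carrier (A_alg p hbar).
            A_bracket p a b \<in> carrier (A_alg p hbar)) \<and>
         continuous_map (prod_topology (A_topology p hbar) (A_topology p hbar)) (A_topology p hbar)
           (\<lambda>(a, b). A_bracket p a b)"
proof -
  let ?V = "A_alg p hbar"
  note hbar = \<open>0 < hbar\<close>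
  interpret seminormed_module ?V "snorm_set p hbar" by (rule seminormed_module_A_alg[OF hbar])
  have top: "A_topology p hbar = T" by (simp add: A_topology_def snorm_set_def)
  note car = A_alg_carrier[OF hbar, of p] and ops = A_alg_ops[OF hbar, of _ _ p]
  have obt: "\<exists>a. a \<in> fin_coeffs hbar \<and> x = germ p a" if "x \<in> carrier ?V" for x
    using that car by blast
  have mem: "germ p a \<in> carrier ?V" if "a \<in> fin_coeffs hbar" for a
    using that car by blast
  have q_in: "A_snorm p hbar m l R S \<in> snorm_set p hbar" if "l < 2 ^ m" for m l R S
    using that unfolding snorm_set_def by blast
  note snorm = A_snorm_germ[OF hbar, of _ p]
  note fa = fin_coeffs_add[OF hbar] and fc = fin_coeffs_cmult and fd = fin_coeffs_diff[OF hbar]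
    and fconv = fin_coeffs_conv[OF hbar] and fs = fin_coeffs_star and fp = fin_coeffs_pois[OF hbar]
  have diff: "germ p a \<ominus>\<^bsub>?V\<^esub> germ p b = germ p (\<lambda>R S. a R S - b R S)" if "a \<in> fin_coeffs hbar" "b \<in> fin_coeffs hbar" for a b
    by (rule diff_eqI) (use that in \<open>simp_all add: mem fd ops(1)\<close>)
  have mult_closed: "x \<otimes>\<^bsub>?V\<^esub> y \<in> carrier ?V" if "x \<in> carrier ?V" "y \<in> carrier ?V" for x y
    using obt[OF that(1)] obt[OF that(2)] by (auto simp: ops(2) mem fconv)
  have bracket_closed: "A_bracket p x y \<in> carrier ?V" if "x \<in> carrier ?V" "y \<in> carrier ?V" for x y
    using obt[OF that(1)] obt[OF that(2)] by (auto simp: ops(5) mem fp)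
  have star_closed: "A_star p x \<in> carrier ?V" if "x \<in> carrier ?V" for x
    using obt[OF that] by (auto simp: ops(4)[where b = "\<lambda>R S. 0"] fin_coeffs_zero mem fs)
  \<comment> \<open>Both facts come from a statement about two arrays; the zero array fills the
    second place.\<close>
  note star_op = ops(4)[OF _ fin_coeffs_zero] and smult_op = ops(3)[OF _ fin_coeffs_zero]
  have distr_left: "(x \<oplus>\<^bsub>?V\<^esub> y) \<otimes>\<^bsub>?V\<^esub> z = x \<otimes>\<^bsub>?V\<^esub> z \<oplus>\<^bsub>?V\<^esub> y \<otimes>\<^bsub>?V\<^esub> z"
    and distr_right: "z \<otimes>\<^bsub>?V\<^esub> (x \<oplus>\<^bsub>?V\<^esub> y) = z \<otimes>\<^bsub>?V\<^esub> x \<oplus>\<^bsub>?V\<^esub> z \<otimes>\<^bsub>?V\<^esub> y"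
    and assoc: "(x \<otimes>\<^bsub>?V\<^esub> y) \<otimes>\<^bsub>?V\<^esub> z = x \<otimes>\<^bsub>?V\<^esub> (y \<otimes>\<^bsub>?V\<^esub> z)"
    and bracket_left: "A_bracket p (x \<oplus>\<^bsub>?V\<^esub> y) z = A_bracket p x z \<oplus>\<^bsub>?V\<^esub> A_bracket p y z"
    and bracket_right: "A_bracket p z (x \<oplus>\<^bsub>?V\<^esub> y) = A_bracket p z x \<oplus>\<^bsub>?V\<^esub> A_bracket p z y"
    if xyz: "x \<in> carrier ?V" "y \<in> carrier ?V" "z \<in> carrier ?V" for x y z
  proof -
    obtain a b c where abc: "a \<in> fin_coeffs hbar" "x = germ p a" "b \<in> fin_coeffs hbar" "y = germ p b" "c \<in> fin_coeffs hbar" "z = germ p c"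
      using obt xyz by meson
    show "(x \<oplus>\<^bsub>?V\<^esub> y) \<otimes>\<^bsub>?V\<^esub> z = x \<otimes>\<^bsub>?V\<^esub> z \<oplus>\<^bsub>?V\<^esub> y \<otimes>\<^bsub>?V\<^esub> z" using abc by (simp add: ops(1,2) fa fconv conv_add_left)
    show "z \<otimes>\<^bsub>?V\<^esub> (x \<oplus>\<^bsub>?V\<^esub> y) = z \<otimes>\<^bsub>?V\<^esub> x \<oplus>\<^bsub>?V\<^esub> z \<otimes>\<^bsub>?V\<^esub> y" using abc by (simp add: ops(1,2) fa fconv conv_add_right)
    show "(x \<otimes>\<^bsub>?V\<^esub> y) \<otimes>\<^bsub>?V\<^esub> z = x \<otimes>\<^bsub>?V\<^esub> (y \<otimes>\<^bsub>?V\<^esub> z)" using abc conv_assoc[OF hbar, of a b c] by (simp add: ops(2) fconv)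
    show "A_bracket p (x \<oplus>\<^bsub>?V\<^esub> y) z = A_bracket p x z \<oplus>\<^bsub>?V\<^esub> A_bracket p y z" using abc by (simp add: ops(1,5) fa fp pois_add_left)
    show "A_bracket p z (x \<oplus>\<^bsub>?V\<^esub> y) = A_bracket p z x \<oplus>\<^bsub>?V\<^esub> A_bracket p z y" using abc by (simp add: ops(1,5) fa fp pois_add_right)
  qed
  have smult: "(c \<odot>\<^bsub>?V\<^esub> x) \<otimes>\<^bsub>?V\<^esub> y = c \<odot>\<^bsub>?V\<^esub> (x \<otimes>\<^bsub>?V\<^esub> y) \<and> x \<otimes>\<^bsub>?V\<^esub> (c \<odot>\<^bsub>?V\<^esub> y) = c \<odot>\<^bsub>?V\<^esub> (x \<otimes>\<^bsub>?V\<^esub> y)"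
    if "x \<in> carrier ?V" "y \<in> carrier ?V" for c x y
    using obt[OF that(1)] obt[OF that(2)]
    by (auto simp: smult_op ops(2) fc fconv conv_cmult_left conv_cmult_right)
  have star_star: "A_star p (A_star p x) = x" and star_smult: "A_star p (c \<odot>\<^bsub>?V\<^esub> x) = cnj c \<odot>\<^bsub>?V\<^esub> A_star p x" if "x \<in> carrier ?V" for c x
    using obt[OF that] by (auto simp: smult_op star_op fc fs star_cmult)
  have star_add: "A_star p (x \<oplus>\<^bsub>?V\<^esub> y) = A_star p x \<oplus>\<^bsub>?V\<^esub> A_star p y"
    and star_mult: "A_star p (x \<otimes>\<^bsub>?V\<^esub> y) = A_star p y \<otimes>\<^bsub>?V\<^esub> A_star p x" if xy: "x \<in> carrier ?V" "y \<in> carrier ?V" for x y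
  proof -
    obtain a b where ab: "a \<in> fin_coeffs hbar" "x = germ p a" "b \<in> fin_coeffs hbar" "y = germ p b"
      using obt xy by meson
    have "star (\<lambda>R S. a R S + b R S) = (\<lambda>R S. star a R S + star b R S)" by (intro ext) (simp add: star_def)
    then show "A_star p (x \<oplus>\<^bsub>?V\<^esub> y) = A_star p x \<oplus>\<^bsub>?V\<^esub> A_star p y" using ab by (simp add: star_op ops(1) fs fa)
    show "A_star p (x \<otimes>\<^bsub>?V\<^esub> y) = A_star p y \<otimes>\<^bsub>?V\<^esub> A_star p x"
      using ab star_conv[OF hbar, of a b] by (simp add: star_op ops(2) fs fconv)
  qed
  have frechet: "frechet_space ?V T"
  proof (rule frechet_spaceI[OF countable_snorm_set])
    fix x assume "x \<in> carrier ?V" and z: "\<And>q. q \<in> snorm_set p hbar \<Longrightarrow> q x = 0"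
    then obtain a where a: "a \<in> fin_coeffs hbar" "x = germ p a" using obt by blast
    have "hn hbar 0 0 R S a = 0" for R S using z[OF q_in[of 0 0 R S]] a by (simp add: snorm)
    then show "x = \<zero>\<^bsub>?V\<^esub>" using hn_separating[OF hbar a(1)] a by (simp add: A_alg_zero)
  next
    fix \<sigma> :: "nat \<Rightarrow> _"
    assume \<sigma>: "range \<sigma> \<subseteq> carrier ?V"
      and cauchy: "\<And>q e. q \<in> snorm_set p hbar \<Longrightarrow> 0 < e \<Longrightarrow> \<exists>K. \<forall>i\<ge>K. \<forall>j\<ge>K. q (\<sigma> i \<ominus>\<^bsub>?V\<^esub> \<sigma> j) < e"
    have "\<forall>i. \<exists>a. a \<in> fin_coeffs hbar \<and> \<sigma> i = germ p a" using \<sigma> obt by blast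
    then obtain \<tau> where \<tau>: "\<And>i. \<tau> i \<in> fin_coeffs hbar" "\<And>i. \<sigma> i = germ p (\<tau> i)" by metis
    have "\<exists>K. \<forall>i\<ge>K. \<forall>j\<ge>K. hn hbar m l R S (\<lambda>R S. \<tau> i R S - \<tau> j R S) < e" if "l < 2 ^ m" "0 < e" for m l R S e
      using cauchy[OF q_in[OF that(1), of R S] that(2)] by (simp add: \<tau> diff snorm fd)
    from hn_complete[OF hbar \<tau>(1) this]
    obtain a where a: "a \<in> fin_coeffs hbar"
      "\<And>m l R S. l < 2 ^ m \<Longrightarrow> (\<lambda>i. hn hbar m l R S (\<lambda>R S. \<tau> i R S - a R S)) \<longlonglongrightarrow> 0" by blast
    have "(\<lambda>i. q (\<sigma> i \<ominus>\<^bsub>?V\<^esub> germ p a)) \<longlonglongrightarrow> 0" if q: "q \<in> snorm_set p hbar" for q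
      using q
    proof (rule snorm_setE)
      fix m l R S assume "l < 2 ^ m" "q = A_snorm p hbar m l R S"
      then show ?thesis using a(2)[of l m R S] by (simp add: \<tau> a(1) diff snorm fd)
    qed
    then show "\<exists>x\<in>carrier ?V. \<forall>q\<in>snorm_set p hbar. (\<lambda>i. q (\<sigma> i \<ominus>\<^bsub>?V\<^esub> x)) \<longlonglongrightarrow> 0"
      using mem[OF a(1)] by blast
  qed
  have cont_mult: "continuous_map (prod_topology T T) T (\<lambda>(x, y). x \<otimes>\<^bsub>?V\<^esub> y)"
  proof (rule continuous_map_biadditive[OF mult_closed distr_left distr_right])
    fix q assume "q \<in> snorm_set p hbar"
    then obtain m l R S where q: "l < 2 ^ m" "q = A_snorm p hbar m l R S" by (rule snorm_setE)
    let ?r = "A_snorm p hbar (Suc m) l R S"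
    have "q (x \<otimes>\<^bsub>?V\<^esub> y) \<le> 1 * (\<Sum>r\<in>{?r}. r x) * (\<Sum>r\<in>{?r}. r y)" if xy: "x \<in> carrier ?V" "y \<in> carrier ?V" for x y
    proof -
      obtain a where a: "a \<in> fin_coeffs hbar" "x = germ p a" using obt[OF xy(1)] by blast
      obtain b where b: "b \<in> fin_coeffs hbar" "y = germ p b" using obt[OF xy(2)] by blast
      show ?thesis
        using conjunct2[OF hn_conv[OF hbar q(1) a(1) b(1), of R S]] by (simp add: a b q ops(2) snorm fconv)
    qed
    moreover have "?r \<in> snorm_set p hbar" using q(1) by (intro q_in) simp
    ultimately show "\<exists>C F. finite F \<and> F \<subseteq> snorm_set p hbar \<and>
       (\<forall>x\<in>carrier ?V. \<forall>y\<in>carrier ?V. q (x \<otimes>\<^bsub>?V\<^esub> y) \<le> C * (\<Sum>r\<in>F. r x) * (\<Sum>r\<in>F. r y))"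
      by (intro exI[of _ 1] exI[of _ "{?r}"]) auto
  qed
  have cont_bracket: "continuous_map (prod_topology T T) T (\<lambda>(x, y). A_bracket p x y)"
  proof (rule continuous_map_biadditive[OF bracket_closed bracket_left bracket_right])
    fix q assume "q \<in> snorm_set p hbar"
    then obtain m l R S where q: "l < 2 ^ m" "q = A_snorm p hbar m l R S" by (rule snorm_setE)
    obtain C F where F: "finite F" and CF: "\<And>a b. a \<in> fin_coeffs hbar \<Longrightarrow> b \<in> fin_coeffs hbar \<Longrightarrow>
      hn hbar m l R S (pois a b) \<le> C * (\<Sum>(R',S')\<in>F. hn hbar (Suc m) l R' S' a) * (\<Sum>(R',S')\<in>F. hn hbar (Suc m) l R' S' b)"
      using hn_pois[OF hbar q(1), of R S] by blast
    let ?s = "\<lambda>(R',S'). A_snorm p hbar (Suc m) l R' S'"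
    let ?G = "?s ` F"
    have G: "finite ?G" "?G \<subseteq> snorm_set p hbar" using F q(1) by (auto intro!: q_in)
    define P where "P a = (\<Sum>(R',S')\<in>F. hn hbar (Suc m) l R' S' a)" for a
    \<comment> \<open>Distinct index pairs may name the same seminorm, so the sum over
      \<open>F\<close> is bounded by \<open>card F\<close> times the sum over the image
      \<open>?G\<close>.\<close>
    define N where "N = real (card F)"
    have PG: "P a \<le> N * (\<Sum>r\<in>?G. r (germ p a))" and P0: "0 \<le> P a" if "a \<in> fin_coeffs hbar" for a
    proof -
      show "0 \<le> P a" unfolding P_def by (intro sum_nonneg) auto
      have "(case i of (R',S') \<Rightarrow> hn hbar (Suc m) l R' S' a) \<le> (\<Sum>r\<in>?G. r (germ p a))" if i: "i \<in> F" for i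
      proof -
        have "?s i (germ p a) \<le> (\<Sum>r\<in>?G. r (germ p a))"
          using G i Q_nonneg mem[OF \<open>a \<in> fin_coeffs hbar\<close>] by (intro member_le_sum) auto
        then show ?thesis by (simp add: case_prod_unfold snorm \<open>a \<in> fin_coeffs hbar\<close>)
      qed
      then show "P a \<le> N * (\<Sum>r\<in>?G. r (germ p a))"
        unfolding P_def N_def by (intro sum_bounded_above)
    qed
    have "q (A_bracket p x y) \<le> (\<bar>C\<bar> * N * N) * (\<Sum>r\<in>?G. r x) * (\<Sum>r\<in>?G. r y)" if xy: "x \<in> carrier ?V" "y \<in> carrier ?V" for x y
    proof -
      obtain a b where ab: "a \<in> fin_coeffs hbar" "x = germ p a" "b \<in> fin_coeffs hbar" "y = germ p b"
        using obt xy by meson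
      have "q (A_bracket p x y) = hn hbar m l R S (pois a b)" using ab by (simp add: q ops(5) snorm fp)
      also have "\<dots> \<le> C * (P a * P b)" using CF[OF ab(1,3)] by (simp add: P_def mult.assoc)
      also have "\<dots> \<le> \<bar>C\<bar> * (P a * P b)" using P0 ab by (intro mult_right_mono) auto
      also have "\<dots> \<le> \<bar>C\<bar> * ((N * (\<Sum>r\<in>?G. r x)) * (N * (\<Sum>r\<in>?G. r y)))"
        using PG P0 ab order_trans[OF P0 PG] by (intro mult_left_mono mult_mono) auto
      finally show ?thesis by (simp only: mult_ac)
    qed
    then show "\<exists>C F. finite F \<and> F \<subseteq> snorm_set p hbar \<and>
       (\<forall>x\<in>carrier ?V. \<forall>y\<in>carrier ?V. q (A_bracket p x y) \<le> C * (\<Sum>r\<in>F. r x) * (\<Sum>r\<in>F. r y))"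
      using G by (intro exI[of _ "\<bar>C\<bar> * N * N"] exI[of _ ?G]) auto
  qed
  have cont_star: "continuous_map T T (A_star p)"
  proof (rule continuous_map_additive[OF star_closed star_add])
    fix q assume "q \<in> snorm_set p hbar"
    then obtain m l R S where q: "l < 2 ^ m" "q = A_snorm p hbar m l R S" by (rule snorm_setE)
    obtain C where C: "\<And>a. a \<in> fin_coeffs hbar \<Longrightarrow> hn hbar m l R S (star a) \<le> C * hn hbar (Suc m) (l + 2 ^ m) R S a"
      using hn_star[OF q(1), of hbar R S] by blast
    have "q (A_star p x) \<le> C * A_snorm p hbar (Suc m) (l + 2 ^ m) R S x" if "x \<in> carrier ?V" for x
      using obt[OF that] C by (auto simp: q star_op snorm fs)
    moreover have "A_snorm p hbar (Suc m) (l + 2 ^ m) R S \<in> snorm_set p hbar" using q(1) by (intro q_in) simp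
    ultimately show "\<exists>C r. r \<in> snorm_set p hbar \<and> (\<forall>x\<in>carrier ?V. q (A_star p x) \<le> C * r x)" by blast
  qed
  have "frechet_star_algebra ?V T (A_star p)"
    unfolding frechet_star_algebra_def
    by (intro conjI ballI allI frechet mult_closed assoc distr_left distr_right conjunct1[OF smult] conjunct2[OF smult]
        cont_mult star_closed star_star star_smult star_add star_mult cont_star)
  then show ?thesis unfolding top using bracket_closed cont_bracket by blast
qed

end
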